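(* Let $G$ be a finitely presented group whose word problem is solvable in subexponential time. Let $A$ be a finite generating set of $G$ and let $X=A\cup A^{-1}$. Let $\mathfrak{R}$ be the family of all length-invariant discrete probability measures $\mu:X^*\to[0,1]$. (1) Suppose that $G$ has a subgroup of finite index that possesses a non-elementary word-hyperbolic quotient group. Then the word problem $WP(G,A)\subseteq X^*$ is solvable with linear average-case time-complexity uniformly relative to $\mathfrak{R}$. (2) Suppose that $G$ has a subgroup of finite index that possesses a non-amenable automatic quotient group. Then the word problem $WP(G,A)\subseteq X^*$ is solvable with quadratic average-case time-complexity uniformly relative to $\mathfrak{R}$.
   Context: Word problem: a finite generating set of a group $G$ is a finite alphabet $A$ with a map $\pi: A\to G$ whose image generates $G$ (different letters may represent the same element, and letters may represent $1$). Put $X=A\cup A^{-1}$, where $A^{-1}$ is the set of formal inverses, and let $X^*$ be the set of all (not necessarily freely reduced) words in $X$. Then $WP(G,A)\subseteq X^*$ is the set of words representing $1\in G$. Its worst-case complexity does not depend on the choice of finite generating set, so one speaks of the word problem of $G$. Complexity: an algorithm is a deterministic multi-tape Turing machine. A non-negative function $f(n)$ is subexponential if $\lim_{n\to\infty} f(n)/r^n=0$ for every $r>1$. Solvable in subexponential time means decidable by an algorithm with running time bounded by a subexponential function of the input length. Measures: for a finite alphabet $X$ with $|X|\ge 2$, a discrete probability measure on $X^*$ is a function $\mu:X^*\to[0,1]$ with $\sum_{w\in X^*}\mu(w)=1$; it is length-invariant if $\mu(w)=\mu(w')$ whenever $|w|=|w'|$. Average-case complexity: let $\mathcal{D}\subseteq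 X^*$ and let $M$ be an algorithm that decides, for every $w\in X^*$, whether $w\in\mathcal{D}$, in time $T(w)<\infty$. Let $f(n)$ be a non-decreasing positive function and let $\mathfrak{R}$ be a family of discrete probability measures on $X^*$. $M$ solves $\mathcal{D}$ with average-case time-complexity bounded by $f(n)$ uniformly relative to $\mathfrak{R}$ if there is $0<C<\infty$ such that for every $\mu\in\mathfrak{R}$, $$\sum_{w\in X^*}\frac{T(w)}{f(|w|)}\mu(w)\le C.$$ $\mathcal{D}$ is solvable with linear (respectively quadratic) average-case time-complexity uniformly relative to $\mathfrak{R}$ if this holds for some algorithm $M$ and some linear (respectively quadratic) function $f$. A word-hyperbolic group is non-elementary if it is not virtually cyclic (finite groups count as virtually cyclic). *)

theory Defs
  imports "HOL-Analysis.Infinite_Sum" "HOL-Algebra.Elementary_Groups"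
begin

section \<open>Words, generating sets and the word problem\<close>

text \<open>The letters \<open>A \<union> A\<^sup>-\<^sup>1\<close> are the elements of the disjoint sum \<open>A <+> A\<close>:
  \<open>Inl a\<close> stands for \<open>a\<close> and \<open>Inr a\<close> for its formal inverse. Words are arbitrary, not
  necessarily freely reduced, lists of such letters.\<close>

abbreviation signed_letters :: "'a set \<Rightarrow> ('a + 'a) set"
  where "signed_letters A \<equiv> A <+> A"

primrec formal_inv :: "'a + 'a \<Rightarrow> 'a + 'a" where
  "formal_inv (Inl a) = Inr a"
| "formal_inv (Inr a) = Inl a"

primrec letter_val :: "('g, 'm) monoid_scheme \<Rightarrow> ('a \<Rightarrow> 'g) \<Rightarrow> 'a + 'a \<Rightarrow> 'g" where
  "letter_val G \<pi> (Inl a) = \<pi> a"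
| "letter_val G \<pi> (Inr a) = inv\<^bsub>G\<^esub> (\<pi> a)"

primrec word_val :: "('g, 'm) monoid_scheme \<Rightarrow> ('a \<Rightarrow> 'g) \<Rightarrow> ('a + 'a) list \<Rightarrow> 'g" where
  "word_val G \<pi> [] = \<one>\<^bsub>G\<^esub>"
| "word_val G \<pi> (x # w) = letter_val G \<pi> x \<otimes>\<^bsub>G\<^esub> word_val G \<pi> w"

definition finite_generating_set :: "('g, 'm) monoid_scheme \<Rightarrow> 'a set \<Rightarrow> ('a \<Rightarrow> 'g) \<Rightarrow> bool"
  where "finite_generating_set G A \<pi> \<longleftrightarrow>
    finite A \<and> \<pi> ` A \<subseteq> carrier G \<and> generate G (\<pi> ` A) = carrier G"

definition WP :: "('g, 'm) monoid_scheme \<Rightarrow> 'a set \<Rightarrow> ('a \<Rightarrow> 'g) \<Rightarrow> ('a + 'a) list set"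
  where "WP G A \<pi> = {w \<in> lists (signed_letters A). word_val G \<pi> w = \<one>\<^bsub>G\<^esub>}"


section \<open>Free groups and finite presentations\<close>

inductive free_eq :: "'a set \<Rightarrow> ('a + 'a) list \<Rightarrow> ('a + 'a) list \<Rightarrow> bool" for S where
  free_eq_refl: "w \<in> lists (signed_letters S) \<Longrightarrow> free_eq S w w"
| free_eq_sym: "free_eq S u v \<Longrightarrow> free_eq S v u"
| free_eq_trans: "free_eq S u v \<Longrightarrow> free_eq S v w \<Longrightarrow> free_eq S u w"
| free_eq_cancel: "u \<in> lists (signed_letters S) \<Longrightarrow> v \<in> lists (signed_letters S) \<Longrightarrow>
    x \<in> signed_letters S \<Longrightarrow> free_eq S (u @ [x, formal_inv x] @ v) (u @ v)"

definition free_rel :: "'a set \<Rightarrow> (('a + 'a) list \<times> ('a + 'a) list) set"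
  where "free_rel S = {(u, v). free_eq S u v}"

definition free_group :: "'a set \<Rightarrow> ('a + 'a) list set monoid"
  where "free_group S =
    \<lparr> carrier = lists (signed_letters S) // free_rel S,
      monoid.mult = (\<lambda>U V. \<Union>u\<in>U. \<Union>v\<in>V. free_rel S `` {u @ v}),
      one = free_rel S `` {[]} \<rparr>"

definition normal_closure :: "('g, 'm) monoid_scheme \<Rightarrow> 'g set \<Rightarrow> 'g set"
  where "normal_closure G R = \<Inter>{N. N \<lhd> G \<and> R \<subseteq> N}"

text \<open>Taking the generators from \<open>nat\<close> is no restriction, since they form a finite set. The same
  applies to the generating sets bound by existential quantifiers below.\<close>

definition finitely_presented :: "('g, 'm) monoid_scheme \<Rightarrow> bool"
  where "finitely_presented G \<longleftrightarrow>
    (\<exists>(S :: nat set) R. finite S \<and> finite R \<and> R \<subseteq> carrier (free_group S) \<and>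
       G \<cong> free_group S Mod normal_closure (free_group S) R)"

lemma free_eq_lists:
  "free_eq S u v \<Longrightarrow> u \<in> lists (signed_letters S) \<and> v \<in> lists (signed_letters S)"
proof (induction rule: free_eq.induct)
  case (free_eq_cancel u v x)
  then show ?case by (cases x) auto
qed auto

lemma equiv_free_rel: "equiv (lists (signed_letters S)) (free_rel S)"
proof (rule equivI)
  show "free_rel S \<subseteq> lists (signed_letters S) \<times> lists (signed_letters S)"
    by (auto simp: free_rel_def dest: free_eq_lists)
  show "refl_on (lists (signed_letters S)) (free_rel S)"
    by (simp add: free_rel_def refl_on_def free_eq_refl)
  show "sym (free_rel S)"
    by (rule symI) (simp add: free_rel_def, erule free_eq_sym)
  show "trans (free_rel S)"
    by (rule transI) (simp add: free_rel_def, erule (1) free_eq_trans)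
qed

lemma free_eq_append_right:
  "free_eq S u u' \<Longrightarrow> v \<in> lists (signed_letters S) \<Longrightarrow> free_eq S (u @ v) (u' @ v)"
proof (induction rule: free_eq.induct)
  case (free_eq_refl w)
  then show ?case by (intro free_eq.free_eq_refl) simp
next
  case (free_eq_sym a b)
  then show ?case by - (rule free_eq.free_eq_sym[of S "a @ v"], simp_all)
next
  case (free_eq_trans a b c)
  then show ?case by - (rule free_eq.free_eq_trans[of S "a @ v" "b @ v"], simp_all)
next
  case (free_eq_cancel a b x)
  then have "free_eq S (a @ [x, formal_inv x] @ (b @ v)) (a @ (b @ v))"
    by (intro free_eq.free_eq_cancel) auto
  then show ?case by simp
qed

lemma free_eq_append_left:
  "free_eq S v v' \<Longrightarrow> u \<in> lists (signed_letters S) \<Longrightarrow> free_eq S (u @ v) (u @ v')"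
proof (induction rule: free_eq.induct)
  case (free_eq_refl w)
  then show ?case by (intro free_eq.free_eq_refl) simp
next
  case (free_eq_sym a b)
  then show ?case by - (rule free_eq.free_eq_sym[of S "u @ a"], simp_all)
next
  case (free_eq_trans a b c)
  then show ?case by - (rule free_eq.free_eq_trans[of S "u @ a" "u @ b"], simp_all)
next
  case (free_eq_cancel a b x)
  then have "free_eq S ((u @ a) @ [x, formal_inv x] @ b) ((u @ a) @ b)"
    by (intro free_eq.free_eq_cancel) auto
  then show ?case by simp
qed

lemma free_eq_append:
  assumes "free_eq S u u'" "free_eq S v v'"
  shows "free_eq S (u @ v) (u' @ v')"
proof (rule free_eq_trans)
  show "free_eq S (u @ v) (u' @ v)"
    by (rule free_eq_append_right[OF assms(1) free_eq_lists[OF assms(2), THEN conjunct1]])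
  show "free_eq S (u' @ v) (u' @ v')"
    by (rule free_eq_append_left[OF assms(2) free_eq_lists[OF assms(1), THEN conjunct2]])
qed

lemma free_group_mult:
  assumes "u \<in> lists (signed_letters S)" "v \<in> lists (signed_letters S)"
  shows "(free_rel S `` {u}) \<otimes>\<^bsub>free_group S\<^esub> (free_rel S `` {v}) = free_rel S `` {u @ v}"
proof -
  have eq: "free_rel S `` {u' @ v'} = free_rel S `` {u @ v}"
    if "u' \<in> free_rel S `` {u}" "v' \<in> free_rel S `` {v}" for u' v'
  proof -
    have "(u @ v, u' @ v') \<in> free_rel S"
      using that by (simp add: free_rel_def free_eq_append)
    then show ?thesis by (rule equiv_class_eq[OF equiv_free_rel, symmetric])
  qed
  have u: "u \<in> free_rel S `` {u}"
    by (rule equiv_class_self[OF equiv_free_rel assms(1)])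
  have v: "v \<in> free_rel S `` {v}"
    by (rule equiv_class_self[OF equiv_free_rel assms(2)])
  have "(\<Union>u'\<in>free_rel S `` {u}. \<Union>v'\<in>free_rel S `` {v}. free_rel S `` {u' @ v'})
      = (\<Union>u'\<in>free_rel S `` {u}. \<Union>v'\<in>free_rel S `` {v}. free_rel S `` {u @ v})"
    by (intro SUP_cong refl eq)
  also have "\<dots> = free_rel S `` {u @ v}"
  proof -
    have "free_rel S `` {u} \<noteq> {}" "free_rel S `` {v} \<noteq> {}"
      using u v by (metis empty_iff)+
    then show ?thesis by (simp only: UN_constant if_False)
  qed
  finally show ?thesis by (simp add: free_group_def)
qed

lemma free_group_is_group: "group (free_group S)"
proof (rule groupI)
  let ?L = "lists (signed_letters S)" and ?F = "free_group S"
  have carrier: "carrier ?F = ?L // free_rel S"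
    and one: "\<one>\<^bsub>?F\<^esub> = free_rel S `` {[]}"
    by (simp_all add: free_group_def)
  show "x \<otimes>\<^bsub>?F\<^esub> y \<in> carrier ?F" if "x \<in> carrier ?F" "y \<in> carrier ?F" for x y
    using that unfolding carrier
    by (elim quotientE) (simp add: free_group_mult quotientI)
  show "\<one>\<^bsub>?F\<^esub> \<in> carrier ?F"
    unfolding carrier one by (simp add: quotientI)
  show "x \<otimes>\<^bsub>?F\<^esub> y \<otimes>\<^bsub>?F\<^esub> z = x \<otimes>\<^bsub>?F\<^esub> (y \<otimes>\<^bsub>?F\<^esub> z)"
    if "x \<in> carrier ?F" "y \<in> carrier ?F" "z \<in> carrier ?F" for x y z
    using that unfolding carrier
    by (elim quotientE) (simp add: free_group_mult)
  show "\<one>\<^bsub>?F\<^esub> \<otimes>\<^bsub>?F\<^esub> x = x" if "x \<in> carrier ?F" for x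
    using that unfolding carrier one
    by (elim quotientE) (simp add: free_group_mult)
  show "\<exists>y\<in>carrier ?F. y \<otimes>\<^bsub>?F\<^esub> x = \<one>\<^bsub>?F\<^esub>" if x: "x \<in> carrier ?F" for x
  proof -
    obtain w where w: "w \<in> ?L" "x = free_rel S `` {w}"
      using x unfolding carrier by (rule quotientE)
    have inv: "\<exists>v\<in>?L. free_eq S (v @ w) []"
      using w(1)
    proof (induction w)
      case Nil
      show ?case by (auto intro: free_eq_refl)
    next
      case (Cons a w)
      then obtain v where v: "v \<in> ?L" "free_eq S (v @ w) []" by auto
      have a: "formal_inv a \<in> signed_letters S"
        using Cons.hyps by (cases a) auto
      have "formal_inv (formal_inv a) = a" by (cases a) auto
      then have "free_eq S (v @ [formal_inv a, a] @ w) (v @ w)"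
        using free_eq_cancel[of v S w "formal_inv a"] v a Cons.hyps by auto
      then have "free_eq S ((v @ [formal_inv a]) @ (a # w)) []"
        using free_eq_trans[OF _ v(2)] by simp
      then show ?case using v(1) a by (intro bexI[of _ "v @ [formal_inv a]"]) auto
    qed
    then obtain v where v: "v \<in> ?L" "free_eq S (v @ w) []" by blast
    then have "free_rel S `` {v @ w} = free_rel S `` {[]}"
      using equiv_class_eq[OF equiv_free_rel] by (auto simp: free_rel_def)
    then show ?thesis
      using v(1) w unfolding carrier one
      by (intro bexI[of _ "free_rel S `` {v}"]) (simp_all add: free_group_mult quotientI)
  qed
qed


section \<open>Deterministic multi-tape Turing machines\<close>

text \<open>States are natural numbers; \<open>Mark n\<close> are auxiliary work symbols. The sets of states and of
  tape symbols of a machine are required to be finite. All tapes are two-way infinite.\<close>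

datatype 'x symbol = Blank | Letter 'x | Mark nat

datatype direction = Go_Left | Stay | Go_Right

primrec shift :: "direction \<Rightarrow> int" where
  "shift Go_Left = -1"
| "shift Stay = 0"
| "shift Go_Right = 1"

record 'x tm =
  tm_tapes :: nat
  tm_states :: "nat set"
  tm_symbols :: "'x symbol set"
  tm_start :: nat
  tm_accept :: nat
  tm_reject :: nat
  tm_trans :: "nat \<Rightarrow> 'x symbol list \<Rightarrow> nat \<times> ('x symbol \<times> direction) list"

definition turing_machine :: "'x set \<Rightarrow> 'x tm \<Rightarrow> bool"
  where "turing_machine X M \<longleftrightarrow>
    tm_tapes M \<ge> 1 \<and>
    finite (tm_states M) \<and> finite (tm_symbols M) \<and>
    Blank \<in> tm_symbols M \<and> Letter ` X \<subseteq> tm_symbols M \<and>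
    tm_start M \<in> tm_states M \<and> tm_accept M \<in> tm_states M \<and> tm_reject M \<in> tm_states M \<and>
    tm_accept M \<noteq> tm_reject M \<and>
    (\<forall>q\<in>tm_states M. \<forall>ss\<in>lists (tm_symbols M). length ss = tm_tapes M \<longrightarrow>
       (case tm_trans M q ss of (q', as) \<Rightarrow>
          q' \<in> tm_states M \<and> length as = tm_tapes M \<and> fst ` set as \<subseteq> tm_symbols M))"

text \<open>A tape consists of its contents and the position of the head.\<close>

type_synonym 'x tape = "(int \<Rightarrow> 'x symbol) \<times> int"
type_synonym 'x config = "nat \<times> 'x tape list"

definition tape_read :: "'x tape \<Rightarrow> 'x symbol"
  where "tape_read t = fst t (snd t)"

definition tape_act :: "'x symbol \<times> direction \<Rightarrow> 'x tape \<Rightarrow> 'x tape"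
  where "tape_act a t = ((fst t)(snd t := fst a), snd t + shift (snd a))"

definition tm_halted :: "'x tm \<Rightarrow> 'x config \<Rightarrow> bool"
  where "tm_halted M c \<longleftrightarrow> fst c = tm_accept M \<or> fst c = tm_reject M"

definition tm_step :: "'x tm \<Rightarrow> 'x config \<Rightarrow> 'x config"
  where "tm_step M c =
    (if tm_halted M c then c
     else let (q', as) = tm_trans M (fst c) (map tape_read (snd c))
          in (q', map2 tape_act as (snd c)))"

definition input_tape :: "'x list \<Rightarrow> 'x tape"
  where "input_tape w =
    ((\<lambda>i. if 0 \<le> i \<and> i < int (length w) then Letter (w ! nat i) else Blank), 0)"

definition tm_init :: "'x tm \<Rightarrow> 'x list \<Rightarrow> 'x config"
  where "tm_init M w = (tm_start M, input_tape w # replicate (tm_tapes M - 1) (\<lambda>_. Blank, 0))"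

definition tm_run :: "'x tm \<Rightarrow> 'x list \<Rightarrow> nat \<Rightarrow> 'x config"
  where "tm_run M w n = (tm_step M ^^ n) (tm_init M w)"

definition tm_time :: "'x tm \<Rightarrow> 'x list \<Rightarrow> nat"
  where "tm_time M w = (LEAST n. tm_halted M (tm_run M w n))"

definition decides :: "'x tm \<Rightarrow> 'x set \<Rightarrow> 'x list set \<Rightarrow> bool"
  where "decides M X D \<longleftrightarrow>
    turing_machine X M \<and>
    (\<forall>w\<in>lists X. (\<exists>n. tm_halted M (tm_run M w n)) \<and>
       (fst (tm_run M w (tm_time M w)) = tm_accept M \<longleftrightarrow> w \<in> D))"


section \<open>Worst-case and average-case complexity\<close>

definition subexponential :: "(nat \<Rightarrow> real) \<Rightarrow> bool"
  where "subexponential f \<longleftrightarrow> (\<forall>n. 0 \<le> f n) \<and> (\<forall>r>1. (\<lambda>n. f n / r ^ n) \<longlonglongrightarrow> 0)"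

definition solvable_in_subexponential_time :: "'x set \<Rightarrow> 'x list set \<Rightarrow> bool"
  where "solvable_in_subexponential_time X D \<longleftrightarrow>
    (\<exists>M f. decides M X D \<and> subexponential f \<and>
       (\<forall>w\<in>lists X. real (tm_time M w) \<le> f (length w)))"

text \<open>The worst-case complexity of the word problem does not depend on the finite generating set,
  so it is enough to ask for the time bound for one of them.\<close>

definition word_problem_subexponential :: "('g, 'm) monoid_scheme \<Rightarrow> bool"
  where "word_problem_subexponential G \<longleftrightarrow>
    (\<exists>(A :: nat set) \<pi>. finite_generating_set G A \<pi> \<and>
       solvable_in_subexponential_time (signed_letters A) (WP G A \<pi>))"

definition discrete_prob_measure :: "'x set \<Rightarrow> ('x list \<Rightarrow> real) \<Rightarrow> bool"
  where "discrete_prob_measure X \<mu> \<longleftrightarrow>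
    (\<forall>w\<in>lists X. 0 \<le> \<mu> w \<and> \<mu> w \<le> 1) \<and> (\<mu> has_sum 1) (lists X)"

definition length_invariant :: "'x set \<Rightarrow> ('x list \<Rightarrow> real) \<Rightarrow> bool"
  where "length_invariant X \<mu> \<longleftrightarrow>
    (\<forall>w\<in>lists X. \<forall>w'\<in>lists X. length w = length w' \<longrightarrow> \<mu> w = \<mu> w')"

definition length_invariant_measures :: "'x set \<Rightarrow> ('x list \<Rightarrow> real) set"
  where "length_invariant_measures X = {\<mu>. discrete_prob_measure X \<mu> \<and> length_invariant X \<mu>}"

text \<open>Summability is required explicitly because \<open>infsum\<close> is \<open>0\<close> on divergent families.\<close>

definition solves_with_average_time ::
    "'x tm \<Rightarrow> 'x set \<Rightarrow> 'x list set \<Rightarrow> ('x list \<Rightarrow> real) set \<Rightarrow> (nat \<Rightarrow> real) \<Rightarrow> bool"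
  where "solves_with_average_time M X D \<RR> f \<longleftrightarrow>
    decides M X D \<and> mono f \<and> (\<forall>n. 0 < f n) \<and>
    (\<exists>C>0. \<forall>\<mu>\<in>\<RR>.
       (\<lambda>w. real (tm_time M w) / f (length w) * \<mu> w) summable_on lists X \<and>
       (\<Sum>\<^sub>\<infinity>w\<in>lists X. real (tm_time M w) / f (length w) * \<mu> w) \<le> C)"

definition linear_average_time :: "'x set \<Rightarrow> 'x list set \<Rightarrow> ('x list \<Rightarrow> real) set \<Rightarrow> bool"
  where "linear_average_time X D \<RR> \<longleftrightarrow>
    (\<exists>M a b. a > 0 \<and> solves_with_average_time M X D \<RR> (\<lambda>n. a * real n + b))"

definition quadratic_average_time :: "'x set \<Rightarrow> 'x list set \<Rightarrow> ('x list \<Rightarrow> real) set \<Rightarrow> bool"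
  where "quadratic_average_time X D \<RR> \<longleftrightarrow>
    (\<exists>M a b c. a > 0 \<and>
       solves_with_average_time M X D \<RR> (\<lambda>n. a * real n ^ 2 + b * real n + c))"


section \<open>Finite index and virtually cyclic groups\<close>

definition finite_index_subgroup :: "'g set \<Rightarrow> ('g, 'm) monoid_scheme \<Rightarrow> bool"
  where "finite_index_subgroup H G \<longleftrightarrow> subgroup H G \<and> finite (rcosets\<^bsub>G\<^esub> H)"

definition virtually_cyclic :: "('g, 'm) monoid_scheme \<Rightarrow> bool"
  where "virtually_cyclic G \<longleftrightarrow>
    (\<exists>C. finite_index_subgroup C G \<and> cyclic_group (G\<lparr>carrier := C\<rparr>))"


section \<open>Word-hyperbolic groups\<close>

definition word_length :: "('g, 'm) monoid_scheme \<Rightarrow> 'a set \<Rightarrow> ('a \<Rightarrow> 'g) \<Rightarrow> 'g \<Rightarrow> nat"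
  where "word_length G A \<pi> g =
    (LEAST n. \<exists>w\<in>lists (signed_letters A). length w = n \<and> word_val G \<pi> w = g)"

definition word_dist :: "('g, 'm) monoid_scheme \<Rightarrow> 'a set \<Rightarrow> ('a \<Rightarrow> 'g) \<Rightarrow> 'g \<Rightarrow> 'g \<Rightarrow> real"
  where "word_dist G A \<pi> g h = real (word_length G A \<pi> (inv\<^bsub>G\<^esub> g \<otimes>\<^bsub>G\<^esub> h))"

definition gromov_product :: "('p \<Rightarrow> 'p \<Rightarrow> real) \<Rightarrow> 'p \<Rightarrow> 'p \<Rightarrow> 'p \<Rightarrow> real"
  where "gromov_product d p x y = (d p x + d p y - d x y) / 2"

text \<open>Gromov's definition: the group with a word metric is a hyperbolic metric space.\<close>

definition gromov_hyperbolic :: "'p set \<Rightarrow> ('p \<Rightarrow> 'p \<Rightarrow> real) \<Rightarrow> bool"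
  where "gromov_hyperbolic P d \<longleftrightarrow>
    (\<exists>\<delta>. \<forall>p\<in>P. \<forall>x\<in>P. \<forall>y\<in>P. \<forall>z\<in>P.
       gromov_product d p x z \<ge> min (gromov_product d p x y) (gromov_product d p y z) - \<delta>)"

definition word_hyperbolic :: "('g, 'm) monoid_scheme \<Rightarrow> bool"
  where "word_hyperbolic G \<longleftrightarrow>
    (\<exists>(A :: nat set) \<pi>. finite_generating_set G A \<pi> \<and>
       gromov_hyperbolic (carrier G) (word_dist G A \<pi>))"


section \<open>Amenable groups\<close>

text \<open>Von Neumann's definition for discrete groups: there is a left-invariant, finitely additive
  probability measure on all subsets.\<close>

definition amenable :: "('g, 'm) monoid_scheme \<Rightarrow> bool"
  where "amenable G \<longleftrightarrow>
    (\<exists>m :: 'g set \<Rightarrow> real.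
       (\<forall>U. U \<subseteq> carrier G \<longrightarrow> 0 \<le> m U) \<and> m (carrier G) = 1 \<and>
       (\<forall>U V. U \<subseteq> carrier G \<longrightarrow> V \<subseteq> carrier G \<longrightarrow> U \<inter> V = {} \<longrightarrow> m (U \<union> V) = m U + m V) \<and>
       (\<forall>g\<in>carrier G. \<forall>U. U \<subseteq> carrier G \<longrightarrow> m (g <#\<^bsub>G\<^esub> U) = m U))"


section \<open>Automatic groups\<close>

definition regular_language :: "'x set \<Rightarrow> 'x list set \<Rightarrow> bool"
  where "regular_language X L \<longleftrightarrow>
    (\<exists>(Q :: nat set) q0 F \<delta>. finite Q \<and> q0 \<in> Q \<and> F \<subseteq> Q \<and>
       (\<forall>q\<in>Q. \<forall>x\<in>X. \<delta> q x \<in> Q) \<and>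
       L = {w \<in> lists X. foldl \<delta> q0 w \<in> F})"

text \<open>A pair of words is read synchronously; the shorter word is padded at the end by \<open>None\<close>.\<close>

definition pad_pair :: "'x list \<Rightarrow> 'x list \<Rightarrow> ('x option \<times> 'x option) list"
  where "pad_pair u v =
    map (\<lambda>i. (if i < length u then Some (u ! i) else None,
              if i < length v then Some (v ! i) else None))
      [0..<max (length u) (length v)]"

definition padded_letters :: "'x set \<Rightarrow> ('x option \<times> 'x option) set"
  where "padded_letters X =
    (insert None (Some ` X) \<times> insert None (Some ` X)) - {(None, None)}"

text \<open>\<open>W\<close> is the language of the word acceptor. The multiplier language for the suffix \<open>s\<close> is
  regular for \<open>s\<close> a single letter and for the empty word (the equality recogniser).\<close>

definition automatic_group :: "('g, 'm) monoid_scheme \<Rightarrow> bool"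
  where "automatic_group G \<longleftrightarrow>
    (\<exists>(A :: nat set) \<pi> W. finite_generating_set G A \<pi> \<and>
       regular_language (signed_letters A) W \<and>
       word_val G \<pi> ` W = carrier G \<and>
       (\<forall>s \<in> insert [] ((\<lambda>x. [x]) ` signed_letters A).
          regular_language (padded_letters (signed_letters A))
            {pad_pair u v | u v. u \<in> W \<and> v \<in> W \<and> word_val G \<pi> (u @ s) = word_val G \<pi> v}))"

end

theory Submission
  imports Defs "HOL-Library.Countable" "HOL-Analysis.Convex" "HOL-Analysis.Function_Topology"
begin

text \<open>Let \<open>Q = H / N\<close> be the quotient. The subexponential algorithm for \<open>G\<close> is run only on the words that
  represent an element of \<open>N\<close>, which a fast algorithm for the word problem of \<open>Q\<close> recognises
  after rewriting with coset representatives of \<open>H\<close>. These words are the closed paths at the base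
  point of the Schreier graph of \<open>N\<close>. If their number did not drop exponentially below \<open>|X|\<^sup>n\<close>, then
  the squared distributions of the walk would be almost invariant, and a limit of them would yield an
  invariant mean on \<open>Q\<close>. Hence on average the subexponential part costs only a bounded amount.

  The word problem of a hyperbolic group takes linear time because a nonempty local geodesic is
  never trivial, and that of an automatic group takes quadratic time because a normal form is multiplied by
  a letter in two sweeps. A hyperbolic group \<open>Q\<close> with an invariant mean is virtually cyclic: the
  half-spaces \<open>{x. |g\<^sup>-\<^sup>1x| \<le> |x|}\<close> of \<open>g\<close> and \<open>g\<^sup>-\<^sup>1\<close> have total mean at least 1, which for large
  powers of a loxodromic \<open>a\<close> and of a conjugate \<open>xax\<^sup>-\<^sup>1\<close> forces them to share an end, so that
  every \<open>x\<close> commensurates \<open>a\<close> and stays at bounded distance from its powers.\<close>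

section \<open>Tapes centred at the head\<close>

text \<open>Since \<open>N\<close> is normal only in \<open>H\<close>, there is no walk on a
  quotient of \<open>G\<close>; everything is counted by pairs of words that end in the same coset.
  A closed path of length \<open>2n\<close>, cut in the middle with its second half inverted, is
  such a pair, so the number of closed paths is the squared norm of the end-point counts after
  \<open>n\<close> steps. Going from \<open>n\<close> to \<open>n + 1\<close> multiplies it by at
  most \<open>|X|^2\<close>, and a factor close to \<open>|X|^2\<close> forces the translates by
  letters to have almost maximal inner products; by Cauchy-Schwarz their normalised squares are then
  almost equal as measures. Since \<open>H\<close> has finite index, finitely many translates of the
  cosets inside \<open>H\<close> cover the others, so the limit mean gives them positive weight and
  can be restricted to them. The decay rate \<open>r < 1\<close> dictates the base in which the
  subexponential bound is spent: the slow decider receives words of length at most \<open>b\<close>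
  times the original, and \<open>s ^ (b + 1) = 1 / r\<close> makes its cost balance the proportion
  of words that reach it. Both claims are one statement with the exponent of the fast decider as
  parameter; in the hyperbolic case non-amenability comes by contraposition.\<close>

type_synonym 'x ctape = "int \<Rightarrow> 'x symbol"

text \<open>Recording a tape relative to its head identifies tapes that differ by a translation, so
  no head position has to be tracked through a computation.\<close>

definition centre :: "'x tape \<Rightarrow> 'x ctape"
  where "centre t = (\<lambda>k. fst t (snd t + k))"

definition cact :: "'x symbol \<times> direction \<Rightarrow> 'x ctape \<Rightarrow> 'x ctape"
  where "cact a t = (\<lambda>k. (t(0 := fst a)) (k + shift (snd a)))"

abbreviation reads :: "'x ctape list \<Rightarrow> 'x symbol list"
  where "reads ts \<equiv> map (\<lambda>t. t 0) ts"

lemma tape_read_eq: "tape_read t = centre t 0"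
  by (simp add: tape_read_def centre_def)

lemma centre_tape_act: "centre (tape_act a t) = cact a (centre t)"
  by (auto simp: centre_def tape_act_def cact_def algebra_simps)

text \<open>\<open>two_sided l r\<close> is the tape with \<open>r\<close> from the head onwards and \<open>l\<close>, read
  from right to left, before it.\<close>

definition cell :: "'x symbol list \<Rightarrow> nat \<Rightarrow> 'x symbol"
  where "cell xs n = (if n < length xs then xs ! n else Blank)"

definition first :: "'x symbol list \<Rightarrow> 'x symbol"
  where "first xs = cell xs 0"

definition two_sided :: "'x symbol list \<Rightarrow> 'x symbol list \<Rightarrow> 'x ctape"
  where "two_sided l r = (\<lambda>k. if 0 \<le> k then cell r (nat k) else cell l (nat (- k - 1)))"

lemma first_simps [simp]: "first [] = Blank" "first (x # xs) = x"
  by (simp_all add: first_def cell_def)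

lemma cell_Cons: "cell (x # xs) n = (case n of 0 \<Rightarrow> x | Suc m \<Rightarrow> cell xs m)"
  by (cases n) (simp_all add: cell_def)

lemma cell_tl: "cell (tl xs) n = cell xs (Suc n)"
  by (cases xs) (simp_all add: cell_def)

lemma cell_append_Blank: "cell (xs @ [Blank]) = cell xs"
  by (auto simp: cell_def nth_append fun_eq_iff)

lemma two_sided_0 [simp]: "two_sided l r 0 = first r"
  by (simp add: two_sided_def first_def)

text \<open>Cells beyond the two lists read as \<open>Blank\<close>, so trailing blanks are
  immaterial. This normalises a tape after the head has walked over empty cells.\<close>

lemma two_sided_append_Blank [simp]:
  "two_sided (l @ [Blank]) r = two_sided l r" "two_sided l (r @ [Blank]) = two_sided l r"
  by (simp_all add: two_sided_def cell_append_Blank fun_eq_iff)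

lemma two_sided_Blank [simp]:
  "two_sided [Blank] r = two_sided [] r" "two_sided l [Blank] = two_sided l []"
  using two_sided_append_Blank[of "[]"] two_sided_append_Blank(2)[of l "[]"] by simp_all

lemma two_sided_upd: "(two_sided l r)(0 := a) = two_sided l (a # tl r)"
  by (auto simp: two_sided_def fun_eq_iff cell_Cons cell_tl split: nat.splits)

lemma cact_two_sided [simp]:
  "cact (a, Stay) (two_sided l r) = two_sided l (a # tl r)"
  "cact (a, Go_Right) (two_sided l r) = two_sided (a # l) (tl r)"
  "cact (a, Go_Left) (two_sided l r) = two_sided (tl l) (first l # a # tl r)"
proof -
  show "cact (a, Stay) (two_sided l r) = two_sided l (a # tl r)"
    by (simp add: cact_def two_sided_upd)
  have "two_sided l (a # r') (k + 1) = two_sided (a # l) r' k" for k r'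
  proof (cases "0 \<le> k")
    case True
    then show ?thesis by (simp add: two_sided_def cell_Cons nat_add_distrib)
  next
    case False
    show ?thesis
    proof (cases "k = -1")
      case False
      then have "nat (- k - 1) = Suc (nat (- (k + 1) - 1))"
        using \<open>\<not> 0 \<le> k\<close> by linarith
      then show ?thesis
        using \<open>\<not> 0 \<le> k\<close> False by (simp add: two_sided_def cell_Cons)
    qed (simp add: two_sided_def cell_Cons)
  qed
  then show "cact (a, Go_Right) (two_sided l r) = two_sided (a # l) (tl r)"
    by (simp add: cact_def two_sided_upd fun_eq_iff)
  have "two_sided l r' (k - 1) = two_sided (tl l) (first l # r') k" for k r'
  proof (cases "k \<le> 0")
    case True
    show ?thesis
    proof (cases "k = 0")
      case False
      then have "nat (- (k - 1) - 1) = Suc (nat (- k - 1))"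
        using True by linarith
      then show ?thesis
        using True False by (simp add: two_sided_def cell_tl)
    qed (simp add: two_sided_def cell_Cons first_def)
  next
    case False
    then have "nat k = Suc (nat (k - 1))" by linarith
    then show ?thesis using False by (simp add: two_sided_def cell_Cons)
  qed
  then show "cact (a, Go_Left) (two_sided l r) = two_sided (tl l) (first l # a # tl r)"
    by (simp add: cact_def two_sided_upd fun_eq_iff)
qed

lemma cact_keep [simp]: "cact (t 0, Stay) t = t"
  by (simp add: cact_def)

lemma centre_input_tape: "centre (input_tape w) = two_sided [] (map Letter w)"
  by (auto simp: centre_def input_tape_def two_sided_def cell_def fun_eq_iff)

lemma centre_blank: "centre (\<lambda>_. Blank, 0) = two_sided [] []"
  by (auto simp: centre_def two_sided_def cell_def fun_eq_iff)

section \<open>Runs of a machine on centred tapes\<close>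

definition cstep :: "'x tm \<Rightarrow> nat \<times> 'x ctape list \<Rightarrow> nat \<times> 'x ctape list"
  where "cstep M c =
    (if fst c = tm_accept M \<or> fst c = tm_reject M then c
     else let (q', as) = tm_trans M (fst c) (reads (snd c)) in (q', map2 cact as (snd c)))"

definition cinit :: "nat \<Rightarrow> 'x symbol list \<Rightarrow> 'x ctape list"
  where "cinit k w = two_sided [] w # replicate (k - 1) (two_sided [] [])"

definition crun :: "'x tm \<Rightarrow> 'x list \<Rightarrow> nat \<Rightarrow> nat \<times> 'x ctape list"
  where "crun M w n = (cstep M ^^ n) (tm_start M, cinit (tm_tapes M) (map Letter w))"

lemma map_centre_map2: "map centre (map2 tape_act as ts) = map2 cact as (map centre ts)"
  by (induction as ts rule: list_induct2') (simp_all add: centre_tape_act)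

lemma centre_tm_step:
  "(fst (tm_step M c), map centre (snd (tm_step M c))) = cstep M (fst c, map centre (snd c))"
proof -
  have "map tape_read (snd c) = reads (map centre (snd c))"
    by (simp add: tape_read_eq)
  then show ?thesis
    by (simp add: tm_step_def cstep_def tm_halted_def map_centre_map2 split: prod.split del: map_map)
qed

lemma centre_tm_run: "(fst (tm_run M w n), map centre (snd (tm_run M w n))) = crun M w n"
proof (induction n)
  case 0
  show ?case
    by (simp add: tm_run_def tm_init_def crun_def cinit_def centre_input_tape centre_blank)
next
  case (Suc n)
  then show ?case
    using centre_tm_step[of M "tm_run M w n"] by (simp add: tm_run_def crun_def)
qed

lemma fst_tm_run: "fst (tm_run M w n) = fst (crun M w n)"
  by (metis centre_tm_run fst_conv)

lemma tm_run_halted_mono: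
  assumes "tm_halted M (tm_run M w m)" "m \<le> n"
  shows "tm_run M w n = tm_run M w m"
  using assms(2)
proof (induction n rule: dec_induct)
  case (step n)
  then show ?case using assms(1) by (simp add: tm_run_def tm_step_def)
qed simp

text \<open>A halting configuration is never left, so the verdict seen at any later time is already
  that of the least halting time \<open>tm_time\<close>.\<close>

lemma decides_if_halts:
  assumes M: "turing_machine X M"
    and halts: "\<And>w. w \<in> lists X \<Longrightarrow>
      \<exists>n\<le>t w. fst (tm_run M w n) = (if w \<in> D then tm_accept M else tm_reject M)"
  shows "decides M X D \<and> (\<forall>w\<in>lists X. tm_time M w \<le> t w)"
proof -
  have "tm_halted M (tm_run M w (tm_time M w)) \<and> tm_time M w \<le> t w \<and>
      (fst (tm_run M w (tm_time M w)) = tm_accept M \<longleftrightarrow> w \<in> D)" if w: "w \<in> lists X" for w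
  proof -
    obtain n where n: "n \<le> t w"
      "fst (tm_run M w n) = (if w \<in> D then tm_accept M else tm_reject M)"
      using halts[OF w] by blast
    then have hn: "tm_halted M (tm_run M w n)" by (simp add: tm_halted_def)
    then have le: "tm_time M w \<le> n" unfolding tm_time_def by (rule Least_le)
    have h: "tm_halted M (tm_run M w (tm_time M w))"
      unfolding tm_time_def using hn by (rule LeastI)
    have "tm_run M w n = tm_run M w (tm_time M w)"
      by (rule tm_run_halted_mono[OF h le])
    then have "fst (tm_run M w (tm_time M w)) = tm_accept M \<longleftrightarrow> w \<in> D"
      using n(2) M by (auto simp: turing_machine_def split: if_splits)
    then show ?thesis using h le n(1) by auto
  qed
  then show ?thesis using M unfolding decides_def by blast
qed

section \<open>Machines with arbitrary states\<close>

text \<open>\<open>tm\<close> demands numbered states. Here they form a finite set of any type, so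
  that a state can carry buffers and automaton states; the numbering is applied once, in
  \<open>realisable\<close>.\<close>

locale abstract_machine =
  fixes X :: "'x set" and k :: nat and S :: "'s set" and \<Gamma> :: "'x symbol set"
    and s0 acc rej :: 's
    and T :: "'s \<Rightarrow> 'x symbol list \<Rightarrow> 's \<times> ('x symbol \<times> direction) list"
  assumes k: "1 \<le> k" and finite_states: "finite S" and finite_symbols: "finite \<Gamma>"
    and symbols: "Blank \<in> \<Gamma>" "Letter ` X \<subseteq> \<Gamma>"
    and states: "s0 \<in> S" "acc \<in> S" "rej \<in> S" "acc \<noteq> rej"
begin

text \<open>Writing back a symbol just read is always allowed, so leaving a tape alone is legal
  without any invariant on the contents of the tapes.\<close>

definition legal :: "'x symbol list \<Rightarrow> 's \<Rightarrow> ('x symbol \<times> direction) list \<Rightarrow> bool"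
  where "legal ss s' as \<longleftrightarrow> s' \<in> S \<and> length as = k \<and> fst ` set as \<subseteq> \<Gamma> \<union> set ss"

definition move :: "'s \<times> 'x ctape list \<Rightarrow> 's \<times> 'x ctape list \<Rightarrow> bool"
  where "move c c' \<longleftrightarrow> fst c \<in> S - {acc, rej} \<and>
    (\<exists>s' as. T (fst c) (reads (snd c)) = (s', as) \<and> legal (reads (snd c)) s' as \<and>
       c' = (s', map2 cact as (snd c)))"

lemma moveI:
  assumes "s \<in> S" "s \<noteq> acc" "s \<noteq> rej" "T s (reads ts) = (s', as)" "s' \<in> S"
    "length as = k" "fst ` set as \<subseteq> \<Gamma> \<union> set (reads ts)" "ts' = map2 cact as ts"
  shows "move (s, ts) (s', ts')"
  using assms by (auto simp: move_def legal_def)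

theorem realisable:
  assumes run: "\<And>w. w \<in> lists X \<Longrightarrow> \<exists>n\<le>t w. \<exists>ts.
    (move ^^ n) (s0, cinit k (map Letter w)) (if w \<in> D then acc else rej, ts)"
  shows "\<exists>M. decides M X D \<and> (\<forall>w\<in>lists X. tm_time M w \<le> t w)"
proof -
  obtain e :: "'s \<Rightarrow> nat" where e: "inj_on e S"
    using finite_imp_inj_to_nat_seg[OF finite_states] by blast
  have dec: "inv_into S e (e s) = s" if "s \<in> S" for s
    using that e by simp
  \<comment> \<open>Illegal transitions lead to the rejecting state. This default closes the finite
    sets of states and symbols under all transitions and is never met along a run of
    \<open>move\<close>.\<close>
  define M where "M = \<lparr>tm_tapes = k, tm_states = e ` S, tm_symbols = \<Gamma>, tm_start = e s0,
    tm_accept = e acc, tm_reject = e rej,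
    tm_trans = \<lambda>q ss. let (s', as) = T (inv_into S e q) ss in
      if legal ss s' as then (e s', as) else (e rej, replicate k (Blank, Stay))\<rparr>"
  have M: "turing_machine X M"
    unfolding turing_machine_def
    using k finite_states finite_symbols symbols states inj_onD[OF e, of acc rej]
    by (auto simp: M_def legal_def split: prod.splits if_splits)
  have step: "cstep M (e (fst c), snd c) = (e (fst c'), snd c') \<and> fst c' \<in> S"
    if "move c c'" for c c'
    using that states inj_onD[OF e, of "fst c"] dec[of "fst c"]
    unfolding move_def legal_def
    by (auto simp: cstep_def M_def legal_def)
  have steps: "(cstep M ^^ n) (e (fst c), snd c) = (e (fst c'), snd c')"
    if "(move ^^ n) c c'" for n c c'
    using that
  proof (induction n arbitrary: c')
    case (Suc n)
    then obtain d where d: "(move ^^ n) c d" "move d c'" by auto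
    then show ?case using Suc.IH[OF d(1)] step[OF d(2)] by simp
  qed simp
  have "decides M X D \<and> (\<forall>w\<in>lists X. tm_time M w \<le> t w)"
  proof (rule decides_if_halts[OF M])
    fix w assume "w \<in> lists X"
    then obtain n ts where n: "n \<le> t w"
      "(move ^^ n) (s0, cinit k (map Letter w)) (if w \<in> D then acc else rej, ts)"
      using run by blast
    have "crun M w n = (e (if w \<in> D then acc else rej), ts)"
      using steps[OF n(2)] by (simp add: crun_def M_def)
    then show "\<exists>n\<le>t w. fst (tm_run M w n) = (if w \<in> D then tm_accept M else tm_reject M)"
      using n(1) by (auto simp: fst_tm_run M_def intro!: exI[of _ n])
  qed
  then show ?thesis by blast
qed

end

lemma relpowp_trans: "(R ^^ m) x y \<Longrightarrow> (R ^^ n) y z \<Longrightarrow> (R ^^ (m + n)) x z"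
  by (auto simp: relpowp_add)

lemma relpowp_Suc_left: "R x y \<Longrightarrow> (R ^^ n) y z \<Longrightarrow> (R ^^ Suc n) x z"
  by (rule relpowp_Suc_I2)

section \<open>Stack machines\<close>

datatype 'c stack_op = Keep | Pop | Push 'c

fun apply_op :: "'c stack_op \<Rightarrow> 'c list \<Rightarrow> 'c list" where
  "apply_op Keep st = st"
| "apply_op Pop st = tl st"
| "apply_op (Push c) st = c # st"

primrec top_of :: "'c list \<Rightarrow> 'c option" where
  "top_of [] = None"
| "top_of (c # st) = Some c"

primrec op_symbols :: "'c stack_op \<Rightarrow> 'c set" where
  "op_symbols Keep = {}"
| "op_symbols Pop = {}"
| "op_symbols (Push c) = {c}"

text \<open>\<open>Blank\<close> encodes no stack symbol, since it marks the bottom of the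
  stack.\<close>

fun stack_symbol :: "'x + nat \<Rightarrow> 'x symbol" where
  "stack_symbol (Inl x) = Letter x"
| "stack_symbol (Inr n) = Mark n"

fun unstack_symbol :: "'x symbol \<Rightarrow> ('x + nat) option" where
  "unstack_symbol Blank = None"
| "unstack_symbol (Letter x) = Some (Inl x)"
| "unstack_symbol (Mark n) = Some (Inr n)"

lemma unstack_stack: "unstack_symbol (stack_symbol c) = Some c"
  by (cases c) auto

lemma unstack_first: "unstack_symbol (first (map stack_symbol st)) = top_of st"
  by (cases st) (auto simp: unstack_stack)

abbreviation stack_tape :: "('x + nat) list \<Rightarrow> 'x ctape"
  where "stack_tape st \<equiv> two_sided [] (map stack_symbol st)"

text \<open>A popped cell is erased, so that the tape to the left of the top of the stack stays
  blank.\<close>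

fun first_act :: "('x + nat) stack_op \<Rightarrow> 'x symbol \<Rightarrow> 'x symbol \<times> direction" where
  "first_act Keep c = (c, Stay)"
| "first_act Pop c = (Blank, Go_Right)"
| "first_act (Push a) c = (c, Go_Left)"

fun second_act :: "('x + nat) stack_op \<Rightarrow> 'x symbol \<Rightarrow> 'x symbol \<times> direction" where
  "second_act (Push a) c = (stack_symbol a, Stay)"
| "second_act _ c = (c, Stay)"

lemma stack_tape_acts:
  fixes st :: "('x + nat) list" and opr :: "('x + nat) stack_op"
  defines "t \<equiv> cact (first_act opr (stack_tape st 0)) (stack_tape st)"
  shows "cact (second_act opr (t 0)) t = stack_tape (apply_op opr st)"
proof (cases opr)
  case Keep
  then have "t = stack_tape st"
    using cact_keep[of "stack_tape st"] by (simp add: t_def)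
  then show ?thesis using Keep cact_keep[of "stack_tape st"] by simp
next
  case Pop
  then have "t = stack_tape (tl st)"
    by (simp add: t_def map_tl)
  then show ?thesis using Pop cact_keep[of "stack_tape (tl st)"] by simp
next
  case (Push a)
  \<comment> \<open>On an empty stack the cell that the head has left remains behind as a trailing
    \<open>Blank\<close>.\<close>
  then show ?thesis
    by (cases st) (simp_all add: t_def two_sided_append_Blank(2)[of _ "[_]", simplified])
qed

locale stack_machine =
  fixes X :: "'x set" and k :: nat and S :: "'s set" and \<Delta> :: "('x + nat) set"
    and s0 acc rej :: 's
    and \<delta> :: "'s \<Rightarrow> ('x + nat) option list \<Rightarrow> 's \<times> ('x + nat) stack_op list"
  assumes k: "1 \<le> k" and finite_alphabet: "finite X"
    and finite_states: "finite S" and finite_symbols: "finite \<Delta>"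
    and states: "s0 \<in> S" "acc \<in> S" "rej \<in> S" "acc \<noteq> rej"
begin

definition smove :: "'s \<times> ('x + nat) list list \<Rightarrow> 's \<times> ('x + nat) list list \<Rightarrow> bool"
  where "smove c c' \<longleftrightarrow> fst c \<in> S - {acc, rej} \<and> fst c' \<in> S \<and> length (snd c) = k \<and>
    (\<exists>ops. \<delta> (fst c) (map top_of (snd c)) = (fst c', ops) \<and> length ops = k \<and>
       (\<forall>opr\<in>set ops. op_symbols opr \<subseteq> \<Delta>) \<and> snd c' = map2 apply_op ops (snd c))"

lemma smoveI:
  assumes "s \<in> S" "s \<noteq> acc" "s \<noteq> rej" "s' \<in> S" "length st = k"
    "\<delta> s (map top_of st) = (s', ops)" "length ops = k" "\<forall>opr\<in>set ops. op_symbols opr \<subseteq> \<Delta>"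
    "st' = map2 apply_op ops st"
  shows "smove (s, st) (s', st')"
  using assms by (auto simp: smove_def)

abbreviation op_lists :: "('x + nat) stack_op list set"
  where "op_lists \<equiv> {ops. set ops \<subseteq> {opr. op_symbols opr \<subseteq> \<Delta>} \<and> length ops = k}"

text \<open>Popping moves the head to the right. Pushing needs two steps of the head, one to
  the left and one to write.\<close>

fun tape_trans :: "'s \<times> ('x + nat) stack_op list option \<Rightarrow> 'x symbol list \<Rightarrow>
    ('s \<times> ('x + nat) stack_op list option) \<times> ('x symbol \<times> direction) list" where
  "tape_trans (s, None) ss = (let (s', ops) = \<delta> s (map unstack_symbol ss)
     in ((s', Some ops), map2 first_act ops ss))"
| "tape_trans (s, Some ops) ss = ((s, None), map2 second_act ops ss)"

definition tape_states where "tape_states = S \<times> insert None (Some ` op_lists)"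

definition tape_symbols where "tape_symbols = insert Blank (Letter ` X \<union> stack_symbol ` \<Delta>)"

lemma tape_machine:
  "abstract_machine X k tape_states tape_symbols (s0, None) (acc, None) (rej, None)"
proof
  have "{opr. op_symbols opr \<subseteq> \<Delta>} \<subseteq> {Keep, Pop} \<union> Push ` \<Delta>"
  proof
    fix opr :: "('x + nat) stack_op"
    assume "opr \<in> {opr. op_symbols opr \<subseteq> \<Delta>}"
    then show "opr \<in> {Keep, Pop} \<union> Push ` \<Delta>" by (cases opr) auto
  qed
  then have "finite {opr. op_symbols opr \<subseteq> \<Delta>}"
    using finite_symbols by (auto intro: finite_subset)
  then have "finite op_lists" by (rule finite_lists_length_eq)
  then show "finite tape_states"
    using finite_states by (simp add: tape_states_def)
qed (use k finite_alphabet finite_symbols states in \<open>auto simp: tape_states_def tape_symbols_def\<close>)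

interpretation tapes: abstract_machine X k tape_states tape_symbols "(s0, None)" "(acc, None)"
  "(rej, None)" tape_trans
  by (rule tape_machine)

lemma stack_tapes_acts:
  "length ops = length st \<Longrightarrow>
   map2 cact (map2 second_act ops (reads (map2 cact (map2 first_act ops (reads (map stack_tape st)))
     (map stack_tape st)))) (map2 cact (map2 first_act ops (reads (map stack_tape st))) (map stack_tape st))
   = map stack_tape (map2 apply_op ops st)"
proof (induction ops st rule: list_induct2)
  case (Cons opr ops s st)
  then show ?case using stack_tape_acts[of opr s] by simp
qed simp

lemma in_fst_map2E:
  assumes "y \<in> fst ` set (map2 f xs zs)"
  obtains x z where "x \<in> set xs" "z \<in> set zs" "y = fst (f x z)"
proof -
  from assms obtain p where "p \<in> set (zip xs zs)" "y = fst (case p of (x, z) \<Rightarrow> f x z)"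
    by auto
  then show ?thesis
    using that[of "fst p" "snd p"] set_zip_leftD[of "fst p" "snd p"] set_zip_rightD[of "fst p" "snd p"]
    by (simp add: case_prod_unfold)
qed

text \<open>Between the two halves of a simulated step the pending operations wait in the second
  component of the state; this is the source of the factor 2 in
  \<open>stack_realisable\<close>.\<close>

lemma two_moves:
  assumes "smove (s, st) (s', st')"
  shows "(tapes.move ^^ 2) ((s, None), map stack_tape st) ((s', None), map stack_tape st')"
proof -
  obtain ops where ops: "s \<in> S" "s \<noteq> acc" "s \<noteq> rej" "s' \<in> S" "length st = k"
    "\<delta> s (map top_of st) = (s', ops)" "length ops = k" "\<forall>opr\<in>set ops. op_symbols opr \<subseteq> \<Delta>"
    "st' = map2 apply_op ops st"
    using assms by (auto simp: smove_def)
  let ?ts = "map stack_tape st"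
  let ?ts1 = "map2 cact (map2 first_act ops (reads ?ts)) ?ts"
  have "map unstack_symbol (reads ?ts) = map top_of st"
    by (simp add: unstack_first)
  then have T: "tape_trans (s, None) (reads ?ts) = ((s', Some ops), map2 first_act ops (reads ?ts))"
    by (simp only: tape_trans.simps ops(6) Let_def split_conv)
  have f: "fst (first_act opr c) \<in> {c, Blank}" for opr :: "('x + nat) stack_op" and c
    by (cases opr) auto
  have "tapes.move ((s, None), ?ts) ((s', Some ops), ?ts1)"
  proof (rule tapes.moveI[OF _ _ _ T])
    show "fst ` set (map2 first_act ops (reads ?ts)) \<subseteq> tape_symbols \<union> set (reads ?ts)"
    proof
      fix y assume "y \<in> fst ` set (map2 first_act ops (reads ?ts))"
      then obtain opr c where "y = fst (first_act opr c)" "c \<in> set (reads ?ts)"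
        by (rule in_fst_map2E)
      then show "y \<in> tape_symbols \<union> set (reads ?ts)"
        using f[of opr c] by (auto simp: tape_symbols_def)
    qed
  qed (use ops in \<open>auto simp: tape_states_def\<close>)
  moreover have "tapes.move ((s', Some ops), ?ts1) ((s', None), map stack_tape st')"
  proof (rule tapes.moveI)
    show "fst ` set (map2 second_act ops (reads ?ts1)) \<subseteq> tape_symbols \<union> set (reads ?ts1)"
    proof
      fix y assume "y \<in> fst ` set (map2 second_act ops (reads ?ts1))"
      then obtain opr c where y: "y = fst (second_act opr c)" "opr \<in> set ops" "c \<in> set (reads ?ts1)"
        by (rule in_fst_map2E)
      then show "y \<in> tape_symbols \<union> set (reads ?ts1)"
        using ops(8) by (cases opr) (auto simp: tape_symbols_def)
    qed
    show "map stack_tape st' = map2 cact (map2 second_act ops (reads ?ts1)) ?ts1"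
      using stack_tapes_acts[of ops st] ops(5,7,9) by simp
  qed (use ops in \<open>auto simp: tape_states_def\<close>)
  ultimately show ?thesis
    by (auto simp: numeral_2_eq_2)
qed

theorem stack_realisable:
  assumes run: "\<And>w. w \<in> lists X \<Longrightarrow> \<exists>n\<le>t w. \<exists>st.
    (smove ^^ n) (s0, map Inl w # replicate (k - 1) []) (if w \<in> D then acc else rej, st)"
  shows "\<exists>M. decides M X D \<and> (\<forall>w\<in>lists X. tm_time M w \<le> 2 * t w)"
proof (rule tapes.realisable)
  have moves: "(tapes.move ^^ (2 * n)) ((fst c, None), map stack_tape (snd c))
      ((fst c', None), map stack_tape (snd c'))" if "(smove ^^ n) c c'" for n c c'
    using that
  proof (induction n arbitrary: c')
    case (Suc n)
    then obtain d where d: "(smove ^^ n) c d" "smove d c'" by auto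
    have "(tapes.move ^^ (2 * n + 2)) ((fst c, None), map stack_tape (snd c))
      ((fst c', None), map stack_tape (snd c'))"
      using relpowp_trans[OF Suc.IH[OF d(1)] two_moves] d(2) by (metis prod.collapse)
    then show ?case by (simp only: mult_Suc_right add.commute)
  qed simp
  fix w assume "w \<in> lists X"
  then obtain n st where n: "n \<le> t w"
    "(smove ^^ n) (s0, map Inl w # replicate (k - 1) []) (if w \<in> D then acc else rej, st)"
    using run by blast
  have "map stack_tape (map Inl w # replicate (k - 1) []) = cinit k (map Letter w)"
    by (simp add: cinit_def comp_def)
  then show "\<exists>n\<le>2 * t w. \<exists>ts. (tapes.move ^^ n) ((s0, None), cinit k (map Letter w))
      (if w \<in> D then (acc, None) else (rej, None), ts)"
    using moves[OF n(2)] n(1)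
    by (intro exI[of _ "2 * n"] conjI exI[of _ "map stack_tape st"]) (auto split: if_splits)
qed

end

lemma relpowp_oneI:
  fixes R :: "'a \<Rightarrow> 'a \<Rightarrow> bool"
  shows "R x y \<Longrightarrow> (R ^^ 1) x y"
  by (simp add: eq_OO)

lemma relpowp_twoI:
  fixes R :: "'a \<Rightarrow> 'a \<Rightarrow> bool"
  shows "R x y \<Longrightarrow> R y z \<Longrightarrow> (R ^^ 2) x z"
  by (auto simp: numeral_2_eq_2 eq_OO)

section \<open>A machine that runs two deciders in sequence\<close>

text \<open>A guest machine over another alphabet runs on the tapes of a host with its symbols
  renamed to numbered marks. The sum type keeps letters and marks apart, and \<open>Blank\<close> is
  fixed so that untouched host cells are blank for the guest too.\<close>

definition code_symbol :: "'y::countable symbol \<Rightarrow> 'x symbol"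
  where "code_symbol s = (case s of
      Blank \<Rightarrow> Blank
    | Letter y \<Rightarrow> Mark (to_nat (Inl y :: 'y + nat))
    | Mark n \<Rightarrow> Mark (to_nat (Inr n :: 'y + nat)))"

lemma inj_code_symbol: "inj code_symbol"
  by (rule injI) (auto simp: code_symbol_def split: symbol.splits)

lemma code_symbol_Blank [simp]: "code_symbol Blank = Blank"
  by (simp add: code_symbol_def)

lemma code_symbol_eq_Blank [simp]: "code_symbol s = Blank \<longleftrightarrow> s = Blank"
  by (simp add: code_symbol_def split: symbol.split)

lemma Blank_eq_code_symbol [simp]: "Blank = code_symbol s \<longleftrightarrow> s = Blank"
  by (metis code_symbol_eq_Blank)

lemma code_two_sided: "code_symbol \<circ> two_sided l r = two_sided (map code_symbol l) (map code_symbol r)"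
  by (auto simp: two_sided_def cell_def fun_eq_iff)

lemma code_cact: "cact (code_symbol a, d) (code_symbol \<circ> t) = code_symbol \<circ> cact (a, d) t"
  by (auto simp: cact_def fun_eq_iff)

lemma map2_cact_code:
  "map2 cact (map (apfst code_symbol) as) (map ((\<circ>) code_symbol) ts)
     = map ((\<circ>) code_symbol) (map2 cact as ts)"
  by (induction as ts rule: list_induct2') (auto simp: code_cact[unfolded comp_def] comp_def)

abbreviation keep :: "'x symbol list \<Rightarrow> ('x symbol \<times> direction) list"
  where "keep ss \<equiv> map (\<lambda>c. (c, Stay)) ss"

lemma map2_cact_keep: "map2 cact (keep (reads ts)) ts = ts"
  by (induction ts) auto

definition act_at :: "nat \<Rightarrow> 'x symbol \<times> direction \<Rightarrow> 'x symbol list \<Rightarrow> ('x symbol \<times> direction) list"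
  where "act_at i a ss = keep (take i ss) @ [a] @ keep (drop (Suc i) ss)"

lemma map2_cact_act_at:
  "length pre = i \<Longrightarrow>
   map2 cact (act_at i a (reads (pre @ t # post))) (pre @ t # post) = pre @ cact a t # post"
  by (simp add: act_at_def map2_cact_keep del: map_map)

text \<open>The guest owns the block of \<open>tm_tapes M\<close> tapes from tape \<open>i\<close>
  on. Decoding by the inverse of \<open>code_symbol\<close> is meaningful as long as that block
  holds encoded symbols only.\<close>

definition embed :: "nat \<Rightarrow> 'y::countable tm \<Rightarrow> nat \<Rightarrow> 'x symbol list \<Rightarrow>
    nat \<times> ('x symbol \<times> direction) list"
  where "embed i M q ss =
    (let (q', as) = tm_trans M q (map (inv_into UNIV code_symbol) (take (tm_tapes M) (drop i ss)))
     in (q', keep (take i ss) @ map (apfst code_symbol) as @ keep (drop (i + tm_tapes M) ss)))"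

lemma embed_reads:
  fixes M :: "'y::countable tm" and pre post :: "'x ctape list"
  assumes "length pre = i" "length ts = tm_tapes M" "tm_trans M q (reads ts) = (q', as)"
  shows "embed i M q (reads (pre @ map ((\<circ>) code_symbol) ts @ post)) =
    (q', keep (reads pre) @ map (apfst code_symbol) as @ keep (reads post))"
proof -
  have "map (inv_into UNIV (code_symbol :: 'y symbol \<Rightarrow> 'x symbol)) (reads (map ((\<circ>) code_symbol) ts)) = reads ts"
    by (simp add: comp_def inv_f_f[OF inj_code_symbol])
  then show ?thesis
    using assms by (simp add: embed_def del: map_map)
qed

lemma map2_cact_embed:
  assumes "length as = length ts"
  shows "map2 cact (keep (reads pre) @ map (apfst code_symbol) as @ keep (reads post))
      (pre @ map ((\<circ>) code_symbol) ts @ post)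
    = pre @ map ((\<circ>) code_symbol) (map2 cact as ts) @ post"
  using assms by (simp add: map2_cact_keep map2_cact_code del: map_map)

text \<open>\<open>turing_machine\<close> constrains transitions only on the listed states and
  symbols, so a run must be known to stay among them before a guest step can be declared legal for
  the host.\<close>

definition cgood :: "'y tm \<Rightarrow> nat \<times> 'y ctape list \<Rightarrow> bool"
  where "cgood M c \<longleftrightarrow> fst c \<in> tm_states M \<and> length (snd c) = tm_tapes M \<and>
    (\<forall>t\<in>set (snd c). range t \<subseteq> tm_symbols M)"

lemma cgood_cstep:
  assumes M: "turing_machine X M" and c: "cgood M c"
    and q: "fst c \<noteq> tm_accept M" "fst c \<noteq> tm_reject M"
  obtains q' as where "tm_trans M (fst c) (reads (snd c)) = (q', as)" "q' \<in> tm_states M"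
    "length as = tm_tapes M" "fst ` set as \<subseteq> tm_symbols M"
    "cstep M c = (q', map2 cact as (snd c))" "cgood M (cstep M c)"
proof -
  obtain q' as where T: "tm_trans M (fst c) (reads (snd c)) = (q', as)"
    by force
  have rd: "reads (snd c) \<in> lists (tm_symbols M)"
    using c by (auto simp: cgood_def in_lists_conv_set)
  have tr: "\<forall>q\<in>tm_states M. \<forall>ss\<in>lists (tm_symbols M). length ss = tm_tapes M \<longrightarrow>
      (case tm_trans M q ss of (q', as) \<Rightarrow>
        q' \<in> tm_states M \<and> length as = tm_tapes M \<and> fst ` set as \<subseteq> tm_symbols M)"
    using M unfolding turing_machine_def by (elim conjE)
  have "fst c \<in> tm_states M" "length (reads (snd c)) = tm_tapes M"
    using c by (simp_all add: cgood_def)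
  then have "case tm_trans M (fst c) (reads (snd c)) of (q', as) \<Rightarrow>
      q' \<in> tm_states M \<and> length as = tm_tapes M \<and> fst ` set as \<subseteq> tm_symbols M"
    by (rule tr[THEN bspec, THEN bspec, THEN mp, OF _ rd])
  then have *: "q' \<in> tm_states M" "length as = tm_tapes M" "fst ` set as \<subseteq> tm_symbols M"
    by (simp_all add: T)
  have s: "cstep M c = (q', map2 cact as (snd c))"
    using q T by (simp add: cstep_def)
  have "range t \<subseteq> tm_symbols M" if t: "t \<in> set (map2 cact as (snd c))" for t
  proof -
    from t obtain p where p: "p \<in> set (zip as (snd c))" "t = cact (fst p) (snd p)"
      by auto
    then have "fst p \<in> set as" "snd p \<in> set (snd c)"
      using set_zip_leftD[of "fst p" "snd p"] set_zip_rightD[of "fst p" "snd p"] by simp_all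
    then have "fst (fst p) \<in> tm_symbols M" "range (snd p) \<subseteq> tm_symbols M"
      using *(3) c by (auto simp: cgood_def)
    then show ?thesis
      by (auto simp: p(2) cact_def)
  qed
  then have "cgood M (cstep M c)"
    using * c by (auto simp: cgood_def s)
  then show ?thesis using that[OF T * s] by blast
qed

lemma cgood_init:
  assumes M: "turing_machine X M" and w: "w \<in> lists X"
  shows "cgood M (tm_start M, cinit (tm_tapes M) (map Letter w))"
proof -
  have "range (two_sided [] (map Letter w)) \<subseteq> tm_symbols M"
    using M w by (force simp: two_sided_def cell_def turing_machine_def)
  moreover have "range (two_sided [] []) \<subseteq> tm_symbols M"
    using M by (auto simp: two_sided_def cell_def turing_machine_def)
  ultimately show ?thesis
    using M by (auto simp: cgood_def cinit_def turing_machine_def)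
qed

lemma crun_until_halt:
  assumes D: "decides M X D" and w: "w \<in> lists X" and m: "m \<le> tm_time M w"
  shows "cgood M (crun M w m)"
    and "m < tm_time M w \<Longrightarrow> fst (crun M w m) \<noteq> tm_accept M \<and> fst (crun M w m) \<noteq> tm_reject M"
proof -
  have M: "turing_machine X M" using D by (simp add: decides_def)
  show nh: "fst (crun M w m) \<noteq> tm_accept M \<and> fst (crun M w m) \<noteq> tm_reject M"
    if "m < tm_time M w" for m
    using not_less_Least[OF that[unfolded tm_time_def]] by (auto simp: tm_halted_def fst_tm_run)
  show "cgood M (crun M w m)"
    using m
  proof (induction m)
    case 0
    then show ?case using cgood_init[OF M w] by (simp add: crun_def)
  next
    case (Suc m)
    then have "cgood M (cstep M (crun M w m))"
      using nh[of m] cgood_cstep[OF M, of "crun M w m"] by (metis Suc_leD Suc_le_lessD)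
    then show ?case by (simp add: crun_def)
  qed
qed

lemma decides_final:
  assumes "decides M X D" "w \<in> lists X"
  shows "fst (crun M w (tm_time M w)) = (if w \<in> D then tm_accept M else tm_reject M)"
proof -
  obtain n where "tm_halted M (tm_run M w n)"
    using assms by (auto simp: decides_def)
  then have "tm_halted M (tm_run M w (tm_time M w))"
    unfolding tm_time_def by (rule LeastI)
  then show ?thesis
    using assms by (auto simp: decides_def tm_halted_def fst_tm_run[symmetric])
qed

text \<open>\<open>R\<close> sends the halting states of the guest to non-final states of the host,
  which can then act on the verdict. \<open>pre\<close> and \<open>post\<close> are the tapes
  outside the guest's block.\<close>

lemma (in abstract_machine) embedded_run:
  fixes M :: "'y::countable tm"
  assumes D: "decides M Y D" and w: "w \<in> lists Y"
    and k': "k = i + tm_tapes M + length post" and i: "length pre = i"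
    and R: "R ` tm_states M \<subseteq> S - {acc, rej}" and sym: "code_symbol ` tm_symbols M \<subseteq> \<Gamma>"
    and T: "\<And>q ss. q \<in> tm_states M \<Longrightarrow> q \<noteq> tm_accept M \<Longrightarrow> q \<noteq> tm_reject M \<Longrightarrow>
      T (R q) ss = apfst R (embed i M q ss)"
  obtains ts where "length ts = tm_tapes M"
    "(move ^^ tm_time M w)
      (R (tm_start M), pre @ map ((\<circ>) code_symbol) (cinit (tm_tapes M) (map Letter w)) @ post)
      (R (if w \<in> D then tm_accept M else tm_reject M), pre @ ts @ post)"
proof -
  have M: "turing_machine Y M" using D by (simp add: decides_def)
  have mv: "(move ^^ m)
      (R (tm_start M), pre @ map ((\<circ>) code_symbol) (cinit (tm_tapes M) (map Letter w)) @ post)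
      (R (fst (crun M w m)), pre @ map ((\<circ>) code_symbol) (snd (crun M w m)) @ post)"
    if "m \<le> tm_time M w" for m
    using that
  proof (induction m)
    case 0
    then show ?case by (simp add: crun_def)
  next
    case (Suc m)
    let ?c = "crun M w m"
    have g: "cgood M ?c" using crun_until_halt(1)[OF D w] Suc.prems by simp
    have nh: "fst ?c \<noteq> tm_accept M" "fst ?c \<noteq> tm_reject M"
      using crun_until_halt(2)[OF D w, of m] Suc.prems by simp_all
    obtain q' as where T': "tm_trans M (fst ?c) (reads (snd ?c)) = (q', as)"
      and q': "q' \<in> tm_states M" "length as = tm_tapes M" "fst ` set as \<subseteq> tm_symbols M"
      and st: "cstep M ?c = (q', map2 cact as (snd ?c))"
      using cgood_cstep[OF M g nh] by metis
    have q: "fst ?c \<in> tm_states M" and len: "length (snd ?c) = tm_tapes M"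
      using g by (simp_all add: cgood_def)
    let ?as = "keep (reads pre) @ map (apfst code_symbol) as @ keep (reads post)"
    let ?ts = "pre @ map ((\<circ>) code_symbol) (snd ?c) @ post"
    have "move (R (fst ?c), ?ts) (R q', pre @ map ((\<circ>) code_symbol) (map2 cact as (snd ?c)) @ post)"
    proof (rule moveI)
      show "T (R (fst ?c)) (reads ?ts) = (R q', ?as)"
        using T[OF q nh] embed_reads[OF i len T'] by simp
      show "fst ` set ?as \<subseteq> \<Gamma> \<union> set (reads ?ts)"
      proof
        fix y assume "y \<in> fst ` set ?as"
        then have "y \<in> set (reads pre) \<or> y \<in> code_symbol ` fst ` set as \<or> y \<in> set (reads post)"
          by (force simp: image_iff)
        moreover have "code_symbol ` fst ` set as \<subseteq> \<Gamma>"
          using sym q'(3) by blast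
        ultimately show "y \<in> \<Gamma> \<union> set (reads ?ts)"
          unfolding map_append set_append by blast
      qed
      show "pre @ map ((\<circ>) code_symbol) (map2 cact as (snd ?c)) @ post = map2 cact ?as ?ts"
        using map2_cact_embed[of as "snd ?c" pre post] q'(2) len by simp
    qed (use R q q' i k' in auto)
    moreover have "crun M w (Suc m) = (q', map2 cact as (snd ?c))"
      using st by (simp add: crun_def)
    ultimately show ?case
      using relpowp_Suc_I[OF Suc.IH] Suc.prems by (metis Suc_leD fst_conv snd_conv)
  qed
  show ?thesis
    using that[of "map ((\<circ>) code_symbol) (snd (crun M w (tm_time M w)))"] mv[of "tm_time M w"]
      crun_until_halt(1)[OF D w, of "tm_time M w"]
    by (simp add: decides_final[OF D w] cgood_def)
qed

section \<open>A single pass that prepares the input of two deciders\<close>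

primrec transduce :: "('i \<Rightarrow> 'x \<Rightarrow> 'i) \<Rightarrow> ('i \<Rightarrow> 'x \<Rightarrow> 'y list) \<Rightarrow> 'i \<Rightarrow> 'x list \<Rightarrow> 'y list" where
  "transduce nxt out i [] = []"
| "transduce nxt out i (x # w) = out i x @ transduce nxt out (nxt i x) w"

text \<open>\<open>Wr\<close> buffers what remains to be written for the last letter read. The flag
  of \<open>Rw1\<close> and \<open>Rw2\<close> tells whether the head has already left the blank
  behind the written word.\<close>

datatype ('i, 'y, 'z) fstate = Rd 'i | Wr 'i "'y list" "'z list" | Rw1 bool | Run1 nat
  | Rw2 bool | Run2 nat | Acc | Rej

text \<open>A finite transducer with states \<open>I\<close> translates the input for both deciders
  while it is read. \<open>M2\<close> runs only if the final state lies in \<open>F\<close> and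
  \<open>M1\<close> accepts.\<close>

locale filter_machine =
  fixes X :: "'x set" and M1 :: "'y::countable tm" and Y1 :: "'y set" and D1 :: "'y list set"
    and M2 :: "'z::countable tm" and Y2 :: "'z set" and D2 :: "'z list set"
    and I F :: "'i set" and i0 :: 'i and nxt :: "'i \<Rightarrow> 'x \<Rightarrow> 'i"
    and out1 :: "'i \<Rightarrow> 'x \<Rightarrow> 'y list" and out2 :: "'i \<Rightarrow> 'x \<Rightarrow> 'z list"
  assumes D1: "decides M1 Y1 D1" and D2: "decides M2 Y2 D2"
    and X: "finite X" and I: "finite I" "i0 \<in> I" "\<And>i x. i \<in> I \<Longrightarrow> x \<in> X \<Longrightarrow> nxt i x \<in> I"
    and out: "\<And>i x. i \<in> I \<Longrightarrow> x \<in> X \<Longrightarrow> out1 i x \<in> lists Y1"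
      "\<And>i x. i \<in> I \<Longrightarrow> x \<in> X \<Longrightarrow> out2 i x \<in> lists Y2"
begin

fun ftrans :: "('i, 'y, 'z) fstate \<Rightarrow> 'x symbol list \<Rightarrow>
    ('i, 'y, 'z) fstate \<times> ('x symbol \<times> direction) list" where
  "ftrans (Rd i) ss = (case hd ss of
      Letter x \<Rightarrow> (Wr (nxt i x) (out1 i x) (out2 i x), act_at 0 (Letter x, Go_Right) ss)
    | _ \<Rightarrow> (if i \<in> F then Rw1 False else Rej, keep ss))"
| "ftrans (Wr i (y # ys) zs) ss = (Wr i ys zs, act_at 1 (code_symbol (Letter y), Go_Right) ss)"
| "ftrans (Wr i [] (z # zs)) ss =
    (Wr i [] zs, act_at (1 + tm_tapes M1) (code_symbol (Letter z), Go_Right) ss)"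
| "ftrans (Wr i [] []) ss = (Rd i, keep ss)"
| "ftrans (Rw1 False) ss = (Rw1 True, act_at 1 (ss ! 1, Go_Left) ss)"
| "ftrans (Rw1 True) ss = (if ss ! 1 = Blank then (Run1 (tm_start M1), act_at 1 (Blank, Go_Right) ss)
     else (Rw1 True, act_at 1 (ss ! 1, Go_Left) ss))"
| "ftrans (Run1 q) ss = (if q = tm_accept M1 then (Rw2 False, keep ss)
     else if q = tm_reject M1 then (Rej, keep ss) else apfst Run1 (embed 1 M1 q ss))"
| "ftrans (Rw2 False) ss = (Rw2 True, act_at (1 + tm_tapes M1) (ss ! (1 + tm_tapes M1), Go_Left) ss)"
| "ftrans (Rw2 True) ss = (if ss ! (1 + tm_tapes M1) = Blank
     then (Run2 (tm_start M2), act_at (1 + tm_tapes M1) (Blank, Go_Right) ss)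
     else (Rw2 True, act_at (1 + tm_tapes M1) (ss ! (1 + tm_tapes M1), Go_Left) ss))"
| "ftrans (Run2 q) ss = (if q = tm_accept M2 then (Acc, keep ss)
     else if q = tm_reject M2 then (Rej, keep ss) else apfst Run2 (embed (1 + tm_tapes M1) M2 q ss))"
| "ftrans Acc ss = (Acc, keep ss)"
| "ftrans Rej ss = (Rej, keep ss)"

definition bound :: nat
  where "bound = Max (insert 0 ((\<lambda>(i, x). length (out1 i x) + length (out2 i x)) ` (I \<times> X)))"

definition letters1 where "letters1 = (\<Union>(i, x)\<in>I \<times> X. set (out1 i x))"
definition letters2 where "letters2 = (\<Union>(i, x)\<in>I \<times> X. set (out2 i x))"

lemma length_out: "i \<in> I \<Longrightarrow> x \<in> X \<Longrightarrow> length (out1 i x) + length (out2 i x) \<le> bound"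
  unfolding bound_def by (rule Max_ge) (use X I in auto)

definition fstates :: "('i, 'y, 'z) fstate set"
  where "fstates = Rd ` I
    \<union> (\<lambda>(i, ys, zs). Wr i ys zs) ` (I \<times> {ys. set ys \<subseteq> letters1 \<and> length ys \<le> bound}
         \<times> {zs. set zs \<subseteq> letters2 \<and> length zs \<le> bound})
    \<union> {Rw1 False, Rw1 True, Rw2 False, Rw2 True, Acc, Rej} \<union> Run1 ` tm_states M1 \<union> Run2 ` tm_states M2"

lemma in_fstates [simp]:
  "Rd i \<in> fstates \<longleftrightarrow> i \<in> I"
  "Wr i ys zs \<in> fstates \<longleftrightarrow> i \<in> I \<and> set ys \<subseteq> letters1 \<and> length ys \<le> bound \<and>
    set zs \<subseteq> letters2 \<and> length zs \<le> bound"
  "Rw1 b \<in> fstates" "Rw2 b \<in> fstates" "Acc \<in> fstates" "Rej \<in> fstates"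
  "Run1 q \<in> fstates \<longleftrightarrow> q \<in> tm_states M1" "Run2 q \<in> fstates \<longleftrightarrow> q \<in> tm_states M2"
  by (auto simp: fstates_def image_iff)

definition fsymbols :: "'x symbol set"
  where "fsymbols = insert Blank (Letter ` X \<union> code_symbol ` (Letter ` letters1 \<union> tm_symbols M1)
    \<union> code_symbol ` (Letter ` letters2 \<union> tm_symbols M2))"

lemma tms: "turing_machine Y1 M1" "turing_machine Y2 M2"
  using D1 D2 by (simp_all add: decides_def)

lemma finite_letters: "finite letters1" "finite letters2"
  using X I by (auto simp: letters1_def letters2_def)

sublocale host: abstract_machine X "1 + tm_tapes M1 + tm_tapes M2" fstates fsymbols "Rd i0" Acc Rej ftrans
proof
  show "finite fstates"
    using I tms finite_letters
    by (auto simp: fstates_def turing_machine_def intro!: finite_imageI finite_cartesian_product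
        finite_lists_length_le)
  show "finite fsymbols"
    using X tms finite_letters by (auto simp: fsymbols_def turing_machine_def)
qed (use I in \<open>auto simp: fsymbols_def\<close>)

lemma move_at:
  assumes "s \<in> fstates" "s \<noteq> Acc" "s \<noteq> Rej" "s' \<in> fstates"
    and "ftrans s (reads (pre @ t # post)) = (s', act_at (length pre) a (reads (pre @ t # post)))"
    and "length pre + length post = tm_tapes M1 + tm_tapes M2" "fst a \<in> insert (t 0) fsymbols"
  shows "host.move (s, pre @ t # post) (s', pre @ cact a t # post)"
proof (rule host.moveI[OF assms(1-3,5,4)])
  show "fst ` set (act_at (length pre) a (reads (pre @ t # post))) \<subseteq> fsymbols \<union> set (reads (pre @ t # post))"
    using assms(7) by (auto simp: act_at_def)
qed (use assms(6) in \<open>simp_all add: map2_cact_act_at del: map_append map_map\<close>,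
     simp add: act_at_def)

lemma move_keep:
  assumes "s \<in> fstates" "s \<noteq> Acc" "s \<noteq> Rej" "s' \<in> fstates"
    and "ftrans s (reads ts) = (s', keep (reads ts))" "length ts = 1 + tm_tapes M1 + tm_tapes M2"
  shows "host.move (s, ts) (s', ts)"
  by (rule host.moveI[OF assms(1-3,5,4)]) (use assms(6) in \<open>auto simp: map2_cact_keep simp del: map_map\<close>)

abbreviation blanks :: "nat \<Rightarrow> 'x ctape list"
  where "blanks n \<equiv> replicate n (two_sided [] [])"

abbreviation code1 :: "'y list \<Rightarrow> 'x symbol list" where "code1 \<equiv> map (\<lambda>y. code_symbol (Letter y))"
abbreviation code2 :: "'z list \<Rightarrow> 'x symbol list" where "code2 \<equiv> map (\<lambda>y. code_symbol (Letter y))"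

abbreviation ftapes :: "'x list \<Rightarrow> 'x list \<Rightarrow> 'y list \<Rightarrow> 'z list \<Rightarrow> 'x ctape list"
  where "ftapes u v ys zs \<equiv> [two_sided (map Letter u) (map Letter v)] @
    two_sided (code1 ys) [] # blanks (tm_tapes M1 - 1) @
    two_sided (code2 zs) [] # blanks (tm_tapes M2 - 1)"

lemma tapes_pos: "1 \<le> tm_tapes M1" "1 \<le> tm_tapes M2"
  using tms by (simp_all add: turing_machine_def)

lemma write1:
  assumes "i \<in> I" "set ys \<subseteq> letters1" "length ys \<le> bound" "set zs \<subseteq> letters2" "length zs \<le> bound"
  shows "(host.move ^^ length ys) (Wr i ys zs, ftapes u v ys' zs') (Wr i [] zs, ftapes u v (rev ys @ ys') zs')"
  using assms(2,3)
proof (induction ys arbitrary: ys')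
  case (Cons y ys)
  have "host.move (Wr i (y # ys) zs, ftapes u v ys' zs') (Wr i ys zs, ftapes u v (y # ys') zs')"
    using move_at[of "Wr i (y # ys) zs" "Wr i ys zs" "[two_sided (map Letter u) (map Letter v)]"
        "two_sided (code1 ys') []" "blanks (tm_tapes M1 - 1) @
        two_sided (code2 zs') [] # blanks (tm_tapes M2 - 1)" "(code_symbol (Letter y), Go_Right)"]
      Cons.prems assms tapes_pos
    by (auto simp: fsymbols_def)
  then show ?case
    using Cons.IH[of "y # ys'"] Cons.prems by (auto intro!: relpowp_Suc_left simp del: relpowp.simps)
qed simp

lemma write2:
  assumes "i \<in> I" "set zs \<subseteq> letters2" "length zs \<le> bound"
  shows "(host.move ^^ length zs) (Wr i [] zs, ftapes u v ys' zs') (Wr i [] [], ftapes u v ys' (rev zs @ zs'))"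
  using assms(2,3)
proof (induction zs arbitrary: zs')
  case (Cons z zs)
  have "host.move (Wr i [] (z # zs), ftapes u v ys' zs') (Wr i [] zs, ftapes u v ys' (z # zs'))"
    using move_at[of "Wr i [] (z # zs)" "Wr i [] zs" "[two_sided (map Letter u) (map Letter v)] @
        two_sided (code1 ys') [] # blanks (tm_tapes M1 - 1)"
        "two_sided (code2 zs') []" "blanks (tm_tapes M2 - 1)" "(code_symbol (Letter z), Go_Right)"]
      Cons.prems assms tapes_pos
    by (auto simp: fsymbols_def)
  then show ?case
    using Cons.IH[of "z # zs'"] Cons.prems by (auto intro!: relpowp_Suc_left simp del: relpowp.simps)
qed simp

lemma read_letter:
  assumes i: "i \<in> I" and x: "x \<in> X"
  shows "\<exists>n\<le>2 + bound. (host.move ^^ n) (Rd i, ftapes u (x # v) ys zs)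
    (Rd (nxt i x), ftapes (x # u) v (rev (out1 i x) @ ys) (rev (out2 i x) @ zs))"
proof -
  let ?j = "nxt i x"
  have j: "?j \<in> I" using I i x by blast
  have l: "set (out1 i x) \<subseteq> letters1" "set (out2 i x) \<subseteq> letters2"
    "length (out1 i x) \<le> bound" "length (out2 i x) \<le> bound"
    using i x length_out[OF i x] by (auto simp: letters1_def letters2_def)
  have "host.move (Rd i, ftapes u (x # v) ys zs)
      (Wr ?j (out1 i x) (out2 i x), ftapes (x # u) v ys zs)"
    using move_at[of "Rd i" "Wr ?j (out1 i x) (out2 i x)" "[]"
        "two_sided (map Letter u) (map Letter (x # v))" "two_sided (code1 ys) [] # blanks (tm_tapes M1 - 1) @
    two_sided (code2 zs) [] # blanks (tm_tapes M2 - 1)" "(Letter x, Go_Right)"]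
      i j l tapes_pos
    by auto
  moreover have "host.move (Wr ?j [] [], ts) (Rd ?j, ts)"
    if "length ts = 1 + tm_tapes M1 + tm_tapes M2" for ts
    by (rule move_keep) (use j that in \<open>auto\<close>)
  ultimately have "(host.move ^^ (1 + length (out1 i x) + length (out2 i x) + 1))
    (Rd i, ftapes u (x # v) ys zs)
    (Rd ?j, ftapes (x # u) v (rev (out1 i x) @ ys) (rev (out2 i x) @ zs))"
    using tapes_pos l
    by (intro relpowp_trans[OF relpowp_trans[OF relpowp_trans[OF relpowp_oneI
            write1[OF j, of "out1 i x" "out2 i x" "x # u" v ys zs]]
            write2[OF j, of "out2 i x" "x # u" v "rev (out1 i x) @ ys" zs]] relpowp_oneI]) simp_all
  then show ?thesis
    using length_out[OF i x] by (intro exI[of _ "1 + length (out1 i x) + length (out2 i x) + 1"]) simp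
qed

lemma read_word:
  assumes "i \<in> I" "v \<in> lists X"
  shows "\<exists>n\<le>(2 + bound) * length v. (host.move ^^ n) (Rd i, ftapes u v ys zs)
    (Rd (foldl nxt i v), ftapes (rev v @ u) []
       (rev (transduce nxt out1 i v) @ ys) (rev (transduce nxt out2 i v) @ zs))"
  using assms
proof (induction v arbitrary: i u ys zs)
  case Nil
  then show ?case by (intro exI[of _ 0]) simp
next
  case (Cons x v)
  then have x: "x \<in> X" "v \<in> lists X" by auto
  obtain m where m: "m \<le> 2 + bound" "(host.move ^^ m) (Rd i, ftapes u (x # v) ys zs)
    (Rd (nxt i x), ftapes (x # u) v (rev (out1 i x) @ ys) (rev (out2 i x) @ zs))"
    using read_letter[OF Cons.prems(1) x(1)] by blast
  obtain n where n: "n \<le> (2 + bound) * length v"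
    "(host.move ^^ n) (Rd (nxt i x), ftapes (x # u) v (rev (out1 i x) @ ys) (rev (out2 i x) @ zs))
    (Rd (foldl nxt (nxt i x) v), ftapes (rev v @ x # u) []
       (rev (transduce nxt out1 (nxt i x) v) @ rev (out1 i x) @ ys)
       (rev (transduce nxt out2 (nxt i x) v) @ rev (out2 i x) @ zs))"
    using Cons.IH[OF I(3)[OF Cons.prems(1) x(1)] x(2)] by blast
  have "(host.move ^^ (m + n)) (Rd i, ftapes u (x # v) ys zs)
    (Rd (foldl nxt i (x # v)), ftapes (rev (x # v) @ u) []
       (rev (transduce nxt out1 i (x # v)) @ ys) (rev (transduce nxt out2 i (x # v)) @ zs))"
    using relpowp_trans[OF m(2) n(2)] by simp
  moreover have "m + n \<le> (2 + bound) * length (x # v)" using m(1) n(1) by simp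
  ultimately show ?case by blast
qed

text \<open>The written word contains no blank, so the first blank to the left is the one in front
  of it. For \<open>c = Blank\<close>, possible only with \<open>l = []\<close>, the head already
  stands there, hence the two step counts.\<close>

lemma rewind_loop:
  assumes "\<And>c r l. c \<noteq> Blank \<Longrightarrow> host.move (s, pre @ two_sided l (c # r) # post)
      (s, pre @ two_sided (tl l) (first l # c # r) # post)"
    and "\<And>r. host.move (s, pre @ two_sided [] (Blank # r) # post) (s', pre @ two_sided [] r # post)"
    and "Blank \<notin> set l" "c \<noteq> Blank \<or> l = []"
  shows "(host.move ^^ (length l + (if c = Blank then 1 else 2))) (s, pre @ two_sided l (c # r) # post)
    (s', pre @ two_sided [] (rev l @ (if c = Blank then r else c # r)) # post)"
  using assms(3,4)
proof (induction l arbitrary: c r)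
  case Nil
  show ?case
  proof (cases "c = Blank")
    case True
    then show ?thesis using relpowp_oneI[of host.move, OF assms(2)[of r]] by (simp del: relpowp.simps)
  next
    case False
    then show ?thesis
      using relpowp_twoI[of host.move, OF assms(1)[of c "[]" r]] assms(2)[of "c # r"]
      by (simp add: numeral_2_eq_2 del: relpowp.simps)
  qed
next
  case (Cons a l)
  then have "host.move (s, pre @ two_sided (a # l) (c # r) # post)
      (s, pre @ two_sided l (a # c # r) # post)"
    using assms(1)[of c "a # l" r] by simp
  moreover have "(host.move ^^ (length l + 2)) (s, pre @ two_sided l (a # c # r) # post)
      (s', pre @ two_sided [] (rev l @ a # c # r) # post)"
    using Cons.IH[of a "c # r"] Cons.prems by (auto simp del: relpowp.simps)
  ultimately have "(host.move ^^ Suc (length l + 2)) (s, pre @ two_sided (a # l) (c # r) # post)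
      (s', pre @ two_sided [] (rev l @ a # c # r) # post)"
    by (rule relpowp_Suc_left)
  then show ?case
    using Cons.prems by (simp del: relpowp.simps)
qed

text \<open>The head starts on the blank behind the word. One unconditional move to the left keeps
  this blank from being mistaken for the one in front.\<close>

lemma rewind:
  assumes "host.move (s0, pre @ two_sided l [] # post) (s, pre @ two_sided (tl l) [first l] # post)"
    and "\<And>c r l. c \<noteq> Blank \<Longrightarrow> host.move (s, pre @ two_sided l (c # r) # post)
      (s, pre @ two_sided (tl l) (first l # c # r) # post)"
    and "\<And>r. host.move (s, pre @ two_sided [] (Blank # r) # post) (s', pre @ two_sided [] r # post)"
    and "Blank \<notin> set l"
  shows "(host.move ^^ (length l + 2)) (s0, pre @ two_sided l [] # post)
    (s', pre @ two_sided [] (rev l) # post)"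
proof (cases l)
  case Nil
  then show ?thesis
    using relpowp_twoI[of host.move, OF assms(1)] assms(3)[of "[]"] Nil by (simp add: numeral_2_eq_2 del: relpowp.simps)
next
  case (Cons a l')
  then show ?thesis
    using relpowp_Suc_left[OF assms(1) rewind_loop[OF assms(2,3), of "tl l" "first l" "[]"]] assms(4)
    by auto
qed

lemma rewind1:
  assumes "length pre = 1" "length post = tm_tapes M1 - 1 + tm_tapes M2"
  shows "(host.move ^^ (length ys + 2)) (Rw1 False, pre @ two_sided (code1 (rev ys)) [] # post)
    (Run1 (tm_start M1), pre @ two_sided [] (code1 ys) # post)"
proof -
  have nth: "reads (pre @ t # post) ! 1 = t 0" for t :: "'x ctape"
    using assms by (cases pre) auto
  note m = move_at[of _ _ pre _ post]
  have ab: "Rw1 b \<in> fstates" "Run1 (tm_start M1) \<in> fstates" for b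
    using tms by (auto simp: turing_machine_def)
  have "host.move (Rw1 False, pre @ two_sided l [] # post) (Rw1 True, pre @ two_sided (tl l) [first l] # post)" for l
    using m[of "Rw1 False" "Rw1 True" "two_sided l []" "(Blank, Go_Left)"] ab assms tapes_pos nth[of "two_sided l []"]
    by (simp add: two_sided_append_Blank(2)[of _ "[_]", simplified] del: map_append)
  moreover have "host.move (Rw1 True, pre @ two_sided l (c # r) # post)
      (Rw1 True, pre @ two_sided (tl l) (first l # c # r) # post)" if "c \<noteq> Blank" for c r l
    using m[of "Rw1 True" "Rw1 True" "two_sided l (c # r)" "(c, Go_Left)"] ab assms tapes_pos that
      nth[of "two_sided l (c # r)"]
    by (simp del: map_append)
  moreover have "host.move (Rw1 True, pre @ two_sided [] (Blank # r) # post)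
     (Run1 (tm_start M1), pre @ two_sided [] r # post)" for r
    using m[of "Rw1 True" "Run1 (tm_start M1)" "two_sided [] (Blank # r)" "(Blank, Go_Right)"] ab assms tapes_pos
      nth[of "two_sided [] (Blank # r)"]
    by (simp del: map_append)
  ultimately have "(host.move ^^ (length (code1 (rev ys)) + 2))
      (Rw1 False, pre @ two_sided (code1 (rev ys)) [] # post)
      (Run1 (tm_start M1), pre @ two_sided [] (rev (code1 (rev ys))) # post)"
    by (rule rewind[of "Rw1 False" pre _ post "Rw1 True"]) auto
  then show ?thesis by (simp only: rev_map rev_rev_ident length_map length_rev)
qed

lemma rewind2:
  assumes "length pre = 1 + tm_tapes M1" "length post = tm_tapes M2 - 1"
  shows "(host.move ^^ (length ys + 2)) (Rw2 False, pre @ two_sided (code2 (rev ys)) [] # post)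
    (Run2 (tm_start M2), pre @ two_sided [] (code2 ys) # post)"
proof -
  have nth: "reads (pre @ t # post) ! Suc (tm_tapes M1) = t 0" for t :: "'x ctape"
    using assms by (simp add: nth_append)
  note m = move_at[of _ _ pre _ post]
  have ab: "Rw2 b \<in> fstates" "Run2 (tm_start M2) \<in> fstates" for b
    using tms by (auto simp: turing_machine_def)
  have "host.move (Rw2 False, pre @ two_sided l [] # post) (Rw2 True, pre @ two_sided (tl l) [first l] # post)" for l
    using m[of "Rw2 False" "Rw2 True" "two_sided l []" "(Blank, Go_Left)"] ab assms tapes_pos nth[of "two_sided l []"]
    by (simp add: two_sided_append_Blank(2)[of _ "[_]", simplified] del: map_append)
  moreover have "host.move (Rw2 True, pre @ two_sided l (c # r) # post)
      (Rw2 True, pre @ two_sided (tl l) (first l # c # r) # post)" if "c \<noteq> Blank" for c r l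
    using m[of "Rw2 True" "Rw2 True" "two_sided l (c # r)" "(c, Go_Left)"] ab assms tapes_pos that
      nth[of "two_sided l (c # r)"]
    by (simp del: map_append)
  moreover have "host.move (Rw2 True, pre @ two_sided [] (Blank # r) # post)
     (Run2 (tm_start M2), pre @ two_sided [] r # post)" for r
    using m[of "Rw2 True" "Run2 (tm_start M2)" "two_sided [] (Blank # r)" "(Blank, Go_Right)"] ab assms tapes_pos
      nth[of "two_sided [] (Blank # r)"]
    by (simp del: map_append)
  ultimately have "(host.move ^^ (length (code2 (rev ys)) + 2))
      (Rw2 False, pre @ two_sided (code2 (rev ys)) [] # post)
      (Run2 (tm_start M2), pre @ two_sided [] (rev (code2 (rev ys))) # post)"
    by (rule rewind[of "Rw2 False" pre _ post "Rw2 True"]) auto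
  then show ?thesis by (simp only: rev_map rev_rev_ident length_map length_rev)
qed

lemma code_cinit: "map ((\<circ>) code_symbol) (cinit k (map Letter w))
    = two_sided [] (map (\<lambda>y. code_symbol (Letter y)) w) # blanks (k - 1)"
  by (simp add: cinit_def code_two_sided[unfolded comp_def] comp_def)

lemma run1:
  assumes ys: "ys \<in> lists Y1" and pre: "length pre = 1" and post: "length post = tm_tapes M2"
  obtains ts where "length ts = tm_tapes M1"
    "(host.move ^^ (tm_time M1 ys + 1))
      (Run1 (tm_start M1), pre @ two_sided [] (code1 ys) # blanks (tm_tapes M1 - 1) @ post)
      (if ys \<in> D1 then Rw2 False else Rej, pre @ ts @ post)"
proof -
  obtain ts where ts: "length ts = tm_tapes M1"
    "(host.move ^^ tm_time M1 ys)
      (Run1 (tm_start M1), pre @ map ((\<circ>) code_symbol) (cinit (tm_tapes M1) (map Letter ys)) @ post)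
      (Run1 (if ys \<in> D1 then tm_accept M1 else tm_reject M1), pre @ ts @ post)"
    by (rule host.embedded_run[OF D1 ys, of 1 post pre Run1])
      (use pre post in \<open>auto simp: fsymbols_def\<close>)
  have "host.move (Run1 (if ys \<in> D1 then tm_accept M1 else tm_reject M1), pre @ ts @ post)
      (if ys \<in> D1 then Rw2 False else Rej, pre @ ts @ post)"
    by (rule move_keep) (use ts pre post tms in \<open>auto simp: turing_machine_def\<close>)
  then show ?thesis
    using that[OF ts(1)] relpowp_trans[OF ts(2) relpowp_oneI[of host.move]]
    by (simp add: code_cinit del: relpowp.simps)
qed

lemma run2:
  assumes zs: "zs \<in> lists Y2" and pre: "length pre = 1 + tm_tapes M1"
  shows "\<exists>ts. (host.move ^^ (tm_time M2 zs + 1))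
      (Run2 (tm_start M2), pre @ two_sided [] (code2 zs) # blanks (tm_tapes M2 - 1))
      (if zs \<in> D2 then Acc else Rej, ts)"
proof -
  obtain ts where ts: "length ts = tm_tapes M2"
    "(host.move ^^ tm_time M2 zs)
      (Run2 (tm_start M2), pre @ map ((\<circ>) code_symbol) (cinit (tm_tapes M2) (map Letter zs)) @ [])
      (Run2 (if zs \<in> D2 then tm_accept M2 else tm_reject M2), pre @ ts @ [])"
    by (rule host.embedded_run[OF D2 zs, of "1 + tm_tapes M1" "[]" pre Run2])
      (use pre in \<open>auto simp: fsymbols_def\<close>)
  have "host.move (Run2 (if zs \<in> D2 then tm_accept M2 else tm_reject M2), pre @ ts @ [])
      (if zs \<in> D2 then Acc else Rej, pre @ ts @ [])"
    by (rule move_keep) (use ts pre tms in \<open>auto simp: turing_machine_def\<close>)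
  from relpowp_trans[OF ts(2) relpowp_oneI[of host.move, OF this]]
  have "(host.move ^^ (tm_time M2 zs + 1))
      (Run2 (tm_start M2), pre @ two_sided [] (code2 zs) # blanks (tm_tapes M2 - 1))
      (if zs \<in> D2 then Acc else Rej, pre @ ts @ [])"
    by (simp only: code_cinit append_Nil2)
  then show ?thesis ..
qed

abbreviation "o1 \<equiv> transduce nxt out1 i0"
abbreviation "o2 \<equiv> transduce nxt out2 i0"

lemma transduce_in: "i \<in> I \<Longrightarrow> w \<in> lists X \<Longrightarrow>
  transduce nxt out1 i w \<in> lists Y1 \<and> transduce nxt out2 i w \<in> lists Y2 \<and> foldl nxt i w \<in> I
  \<and> length (transduce nxt out1 i w) \<le> bound * length w
  \<and> length (transduce nxt out2 i w) \<le> bound * length w"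
proof (induction w arbitrary: i)
  case (Cons x w)
  then have x: "x \<in> X" "w \<in> lists X" by auto
  show ?case
    using Cons.IH[OF I(3)[OF Cons.prems(1) x(1)] x(2)] out[OF Cons.prems(1) x(1)]
      length_out[OF Cons.prems(1) x(1)]
    by auto
qed simp

text \<open>Reading takes at most \<open>2 + bound\<close> moves per letter and each of the two
  rewinds at most \<open>bound\<close> per letter plus two; \<open>4 * bound + 8\<close> absorbs
  these together with the constantly many changes of phase.\<close>

lemma filter_run:
  assumes w: "w \<in> lists X"
  shows "\<exists>n\<le>(4 * bound + 8) * (length w + 1) + tm_time M1 (o1 w) +
      (if foldl nxt i0 w \<in> F \<and> o1 w \<in> D1 then tm_time M2 (o2 w) else 0).
    \<exists>ts. (host.move ^^ n) (Rd i0, cinit (1 + tm_tapes M1 + tm_tapes M2) (map Letter w))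
      (if foldl nxt i0 w \<in> F \<and> o1 w \<in> D1 \<and> o2 w \<in> D2 then Acc else Rej, ts)"
proof -
  let ?f = "foldl nxt i0 w"
  have o: "o1 w \<in> lists Y1" "o2 w \<in> lists Y2" "?f \<in> I"
    "length (o1 w) \<le> bound * length w" "length (o2 w) \<le> bound * length w"
    using transduce_in[OF I(2) w] by auto
  let ?t = "ftapes (rev w) [] (rev (o1 w)) (rev (o2 w))"
  have "cinit (1 + tm_tapes M1 + tm_tapes M2) (map Letter w) = ftapes [] w [] []"
  proof -
    have "1 + tm_tapes M1 + tm_tapes M2 - 1 = Suc (tm_tapes M1 - 1) + Suc (tm_tapes M2 - 1)"
      using tapes_pos by linarith
    then have "blanks (1 + tm_tapes M1 + tm_tapes M2 - 1)
        = two_sided [] [] # blanks (tm_tapes M1 - 1) @ two_sided [] [] # blanks (tm_tapes M2 - 1)"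
      by (simp only: replicate_add replicate_Suc append_Cons)
    then show ?thesis
      by (simp only: cinit_def) simp
  qed
  moreover obtain n where n: "n \<le> (2 + bound) * length w"
    "(host.move ^^ n) (Rd i0, ftapes [] w [] []) (Rd ?f, ?t)"
    using read_word[OF I(2) w, of "[]" "[]" "[]"] by auto
  ultimately have n': "(host.move ^^ n) (Rd i0, cinit (1 + tm_tapes M1 + tm_tapes M2) (map Letter w)) (Rd ?f, ?t)"
    by simp
  have s1: "host.move (Rd ?f, ?t) (if ?f \<in> F then Rw1 False else Rej, ?t)"
    by (rule move_keep) (use o tapes_pos in \<open>auto\<close>)
  have nb: "n + 1 \<le> (4 * bound + 8) * (length w + 1)"
    using n(1) by (simp add: algebra_simps)
  show ?thesis
  proof (cases "?f \<in> F")
    case False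
    then show ?thesis
      using relpowp_trans[OF n' relpowp_oneI[of host.move, OF s1]] nb
      by (intro exI[of _ "n + 1"] conjI exI[of _ ?t]) (auto simp del: relpowp.simps)
  next
    case True
    let ?pre = "[two_sided (map Letter (rev w)) ([] :: 'x symbol list)]"
    let ?post2 = "two_sided (code2 (rev (o2 w))) [] # blanks (tm_tapes M2 - 1)"
    have r1: "(host.move ^^ (length (o1 w) + 2)) (Rw1 False, ?t)
      (Run1 (tm_start M1), ?pre @ two_sided [] (code1 (o1 w)) # blanks (tm_tapes M1 - 1) @ ?post2)"
      using rewind1[of ?pre "blanks (tm_tapes M1 - 1) @ ?post2" "o1 w"] tapes_pos by simp
    obtain ts where ts: "length ts = tm_tapes M1"
      "(host.move ^^ (tm_time M1 (o1 w) + 1))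
        (Run1 (tm_start M1), ?pre @ two_sided [] (code1 (o1 w)) # blanks (tm_tapes M1 - 1) @ ?post2)
        (if o1 w \<in> D1 then Rw2 False else Rej, ?pre @ ts @ ?post2)"
      by (rule run1[OF o(1), of ?pre ?post2]) (use tapes_pos in auto)
    have s1': "(host.move ^^ 1) (Rd ?f, ?t) (Rw1 False, ?t)"
      using relpowp_oneI[of host.move, OF s1] True by (simp del: relpowp.simps)
    define N where "N = n + 1 + (length (o1 w) + 2) + (tm_time M1 (o1 w) + 1)"
    have a: "(host.move ^^ N) (Rd i0, cinit (1 + tm_tapes M1 + tm_tapes M2) (map Letter w))
      (if o1 w \<in> D1 then Rw2 False else Rej, ?pre @ ts @ ?post2)"
      unfolding N_def by (rule relpowp_trans[OF relpowp_trans[OF relpowp_trans[OF n' s1'] r1] ts(2)])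
    have Nb: "N + length (o2 w) + 3 \<le> (4 * bound + 8) * (length w + 1) + tm_time M1 (o1 w)"
      using n(1) o(4,5) by (simp add: N_def algebra_simps)
    show ?thesis
    proof (cases "o1 w \<in> D1")
      case False
      then show ?thesis
        using a Nb by (intro exI[of _ N] conjI exI[of _ "?pre @ ts @ ?post2"]) auto
    next
      case T1: True
      have r2: "(host.move ^^ (length (o2 w) + 2)) (Rw2 False, ?pre @ ts @ ?post2)
        (Run2 (tm_start M2), (?pre @ ts) @ two_sided [] (code2 (o2 w)) # blanks (tm_tapes M2 - 1))"
        using rewind2[of "?pre @ ts" "blanks (tm_tapes M2 - 1)" "o2 w"] ts(1) by simp
      obtain us where us: "(host.move ^^ (tm_time M2 (o2 w) + 1))
        (Run2 (tm_start M2), (?pre @ ts) @ two_sided [] (code2 (o2 w)) # blanks (tm_tapes M2 - 1))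
        (if o2 w \<in> D2 then Acc else Rej, us)"
        using run2[OF o(2), of "?pre @ ts"] ts(1) by auto
      have a': "(host.move ^^ N) (Rd i0, cinit (1 + tm_tapes M1 + tm_tapes M2) (map Letter w))
        (Rw2 False, ?pre @ ts @ ?post2)"
        using a T1 by simp
      show ?thesis
        using relpowp_trans[OF relpowp_trans[OF a' r2] us] Nb True T1
        by (intro exI[of _ "N + (length (o2 w) + 2) + (tm_time M2 (o2 w) + 1)"] conjI exI[of _ us]) auto
    qed
  qed
qed

text \<open>The conditional in the bound is the point of the construction: \<open>M2\<close> costs
  nothing on the words that are filtered out.\<close>

theorem filter_realisable:
  "\<exists>M. decides M X {w. foldl nxt i0 w \<in> F \<and> o1 w \<in> D1 \<and> o2 w \<in> D2} \<and>
    (\<forall>w\<in>lists X. tm_time M w \<le> (4 * bound + 8) * (length w + 1) + tm_time M1 (o1 w) +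
      (if foldl nxt i0 w \<in> F \<and> o1 w \<in> D1 then tm_time M2 (o2 w) else 0))"
  using filter_run by (intro host.realisable) simp

end

section \<open>Word metrics\<close>

lemma (in group) inv_mult_cancel [simp]:
  "\<lbrakk>g \<in> carrier G; y \<in> carrier G\<rbrakk> \<Longrightarrow> inv g \<otimes> (g \<otimes> y) = y"
  "\<lbrakk>g \<in> carrier G; y \<in> carrier G\<rbrakk> \<Longrightarrow> g \<otimes> (inv g \<otimes> y) = y"
  by (simp_all add: m_assoc[symmetric])

definition inv_word :: "('a + 'a) list \<Rightarrow> ('a + 'a) list"
  where "inv_word w = rev (map formal_inv w)"

lemma formal_inv_in [simp]: "formal_inv x \<in> signed_letters A \<longleftrightarrow> x \<in> signed_letters A"
  by (cases x) auto

lemma formal_inv_formal_inv [simp]: "formal_inv (formal_inv x) = x"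
  by (cases x) auto

lemma inv_word_in [simp]: "inv_word w \<in> lists (signed_letters A) \<longleftrightarrow> w \<in> lists (signed_letters A)"
  by (induction w) (auto simp: inv_word_def)

lemma length_inv_word [simp]: "length (inv_word w) = length w"
  by (simp add: inv_word_def)

lemma inv_word_inv_word [simp]: "inv_word (inv_word w) = w"
  by (simp add: inv_word_def rev_map comp_def)

locale fg_group = group G for G :: "('g, 'm) monoid_scheme" (structure) +
  fixes B :: "'b set" and \<pi> :: "'b \<Rightarrow> 'g"
  assumes gen: "finite_generating_set G B \<pi>"
begin

abbreviation "X \<equiv> signed_letters B"
abbreviation "val \<equiv> word_val G \<pi>"

lemma finite_X: "finite X"
  using gen by (simp add: finite_generating_set_def)

lemma letter_closed [simp]: "x \<in> X \<Longrightarrow> letter_val G \<pi> x \<in> carrier G"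
  using gen by (auto simp: finite_generating_set_def)

lemma letter_formal_inv: "x \<in> X \<Longrightarrow> letter_val G \<pi> (formal_inv x) = inv (letter_val G \<pi> x)"
  using gen by (auto simp: finite_generating_set_def)

lemma val_closed [simp]: "w \<in> lists X \<Longrightarrow> val w \<in> carrier G"
  by (induction w) (auto simp del: in_lists_conv_set)

lemma val_append: "v \<in> lists X \<Longrightarrow> w \<in> lists X \<Longrightarrow> val (v @ w) = val v \<otimes> val w"
  by (induction v) (auto simp: m_assoc simp del: in_lists_conv_set)

lemma val_inv_word: "w \<in> lists X \<Longrightarrow> val (inv_word w) = inv (val w)"
proof (induction w)
  case (Cons x w)
  then have w: "x \<in> X" "w \<in> lists X" by auto
  have "val (inv_word (x # w)) = val (inv_word w @ [formal_inv x])"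
    by (simp add: inv_word_def)
  also have "\<dots> = inv (val w) \<otimes> inv (letter_val G \<pi> x)"
    using Cons.IH w by (subst val_append) (auto simp: letter_formal_inv simp del: in_lists_conv_set)
  also have "\<dots> = inv (val (x # w))"
    using w by (simp add: inv_mult_group del: in_lists_conv_set)
  finally show ?case .
qed (simp add: inv_word_def)

lemma val_surj:
  assumes "g \<in> carrier G"
  obtains w where "w \<in> lists X" "val w = g"
proof -
  have "g \<in> generate G (\<pi> ` B)"
    using assms gen by (simp add: finite_generating_set_def)
  then have "\<exists>w\<in>lists X. val w = g"
  proof (induction rule: generate.induct)
    case one
    show ?case by (intro bexI[of _ "[]"]) auto
  next
    case (incl h)
    then obtain b where b: "b \<in> B" "h = \<pi> b" by auto
    then have "\<pi> b \<in> carrier G" using letter_closed[of "Inl b"] by auto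
    then show ?case using b by (intro bexI[of _ "[Inl b]"]) auto
  next
    case (inv h)
    then obtain b where b: "b \<in> B" "h = \<pi> b" by auto
    then have "\<pi> b \<in> carrier G" using letter_closed[of "Inl b"] by auto
    then show ?case using b by (intro bexI[of _ "[Inr b]"]) auto
  next
    case (eng h1 h2)
    then obtain v w where "v \<in> lists X" "w \<in> lists X" "val v = h1" "val w = h2" by blast
    then show ?case by (intro bexI[of _ "v @ w"]) (auto simp: val_append simp del: in_lists_conv_set)
  qed
  then show ?thesis using that by blast
qed

definition len :: "'g \<Rightarrow> nat" where "len g = word_length G B \<pi> g"

lemma len_le: "w \<in> lists X \<Longrightarrow> len (val w) \<le> length w"
  unfolding len_def word_length_def by (rule Least_le) blast

lemma len_word:
  assumes "g \<in> carrier G"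
  obtains w where "w \<in> lists X" "length w = len g" "val w = g"
proof -
  obtain v where "v \<in> lists X" "val v = g" using val_surj[OF assms] .
  then have "\<exists>w\<in>lists X. length w = length v \<and> val w = g" by blast
  then have "\<exists>w\<in>lists X. length w = len g \<and> val w = g"
    unfolding len_def word_length_def by (rule LeastI)
  then show ?thesis using that by blast
qed

lemma len_one [simp]: "len \<one> = 0"
  using len_le[of "[]"] by simp

lemma len_inv_le: "g \<in> carrier G \<Longrightarrow> len (inv g) \<le> len g"
  by (metis len_le len_word length_inv_word inv_word_in val_inv_word)

lemma len_inv [simp]: "g \<in> carrier G \<Longrightarrow> len (inv g) = len g"
  by (metis inv_closed inv_inv len_inv_le antisym)

lemma len_mult: "g \<in> carrier G \<Longrightarrow> h \<in> carrier G \<Longrightarrow> len (g \<otimes> h) \<le> len g + len h"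
proof -
  assume g: "g \<in> carrier G" "h \<in> carrier G"
  obtain v w where "v \<in> lists X" "length v = len g" "val v = g"
    "w \<in> lists X" "length w = len h" "val w = h"
    using len_word[OF g(1)] len_word[OF g(2)] by metis
  then show ?thesis using len_le[of "v @ w"] by (simp add: val_append del: in_lists_conv_set)
qed

lemma finite_ball: "finite {g \<in> carrier G. len g \<le> n}"
proof (rule finite_subset)
  show "{g \<in> carrier G. len g \<le> n} \<subseteq> val ` {w. set w \<subseteq> X \<and> length w \<le> n}"
  proof
    fix g assume "g \<in> {g \<in> carrier G. len g \<le> n}"
    then have "g \<in> carrier G" "len g \<le> n" by auto
    moreover obtain w where "w \<in> lists X" "length w = len g" "val w = g"
      using len_word[OF \<open>g \<in> carrier G\<close>] .
    ultimately show "g \<in> val ` {w. set w \<subseteq> X \<and> length w \<le> n}"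
      by (intro image_eqI[of _ _ w]) auto
  qed
qed (use finite_lists_length_le[OF finite_X] in simp)

definition d :: "'g \<Rightarrow> 'g \<Rightarrow> real" where "d g h = real (len (inv g \<otimes> h))"

lemma d_word_dist: "d = word_dist G B \<pi>"
  by (auto simp: d_def word_dist_def len_def fun_eq_iff)

lemma d_nonneg [simp]: "0 \<le> d g h" by (simp add: d_def)

lemma d_self [simp]: "g \<in> carrier G \<Longrightarrow> d g g = 0" by (simp add: d_def)

lemma d_sym: "g \<in> carrier G \<Longrightarrow> h \<in> carrier G \<Longrightarrow> d g h = d h g"
  using len_inv[of "inv g \<otimes> h"] by (simp add: d_def inv_mult_group)

lemma d_one: "g \<in> carrier G \<Longrightarrow> d \<one> g = real (len g)"
  by (simp add: d_def)

lemma d_left: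
  "\<lbrakk>x \<in> carrier G; g \<in> carrier G; h \<in> carrier G\<rbrakk> \<Longrightarrow> d (x \<otimes> g) (x \<otimes> h) = d g h"
  by (simp add: d_def inv_mult_group m_assoc)

lemma d_right: "\<lbrakk>g \<in> carrier G; x \<in> carrier G\<rbrakk> \<Longrightarrow> d g (g \<otimes> x) = real (len x)"
  by (simp add: d_def)

lemma d_tri:
  assumes "g \<in> carrier G" "h \<in> carrier G" "k \<in> carrier G"
  shows "d g k \<le> d g h + d h k"
proof -
  have "inv g \<otimes> k = (inv g \<otimes> h) \<otimes> (inv h \<otimes> k)"
    using assms by (simp add: m_assoc)
  then show ?thesis
    using len_mult[of "inv g \<otimes> h" "inv h \<otimes> k"] assms by (simp add: d_def)
qed

definition gp :: "'g \<Rightarrow> 'g \<Rightarrow> 'g \<Rightarrow> real" where "gp p x y = (d p x + d p y - d x y) / 2"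

lemma gp_left: "\<lbrakk>g \<in> carrier G; p \<in> carrier G; x \<in> carrier G; y \<in> carrier G\<rbrakk>
    \<Longrightarrow> gp (g \<otimes> p) (g \<otimes> x) (g \<otimes> y) = gp p x y"
  by (simp add: gp_def d_left)

lemma gp_sym: "x \<in> carrier G \<Longrightarrow> y \<in> carrier G \<Longrightarrow> gp p x y = gp p y x"
  by (simp add: gp_def d_sym)

lemma gp_nonneg: "p \<in> carrier G \<Longrightarrow> x \<in> carrier G \<Longrightarrow> y \<in> carrier G \<Longrightarrow> 0 \<le> gp p x y"
  using d_tri[of x p y] by (simp add: gp_def d_sym)

text \<open>The Gromov products at the two ends of a side of a triangle add up to its length; this
  converts a small product at one end into a large one at the other.\<close>

lemma gp_swap: "p \<in> carrier G \<Longrightarrow> q \<in> carrier G \<Longrightarrow> x \<in> carrier G \<Longrightarrow>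
    gp p q x = d p q - gp q p x"
  using d_sym[of p q] by (simp add: gp_def field_simps)

end

locale hyp_group = fg_group G B \<pi> for G :: "('g, 'm) monoid_scheme" (structure) and B :: "'b set" and \<pi> +
  fixes \<delta> :: real
  assumes \<delta>: "0 \<le> \<delta>"
    and four_point: "\<And>p x y z. \<lbrakk>p \<in> carrier G; x \<in> carrier G; y \<in> carrier G; z \<in> carrier G\<rbrakk>
      \<Longrightarrow> min (gp p x y) (gp p y z) - \<delta> \<le> gp p x z"

lemma (in group) hyp_groupI:
  assumes gen: "finite_generating_set G B \<pi>"
    and hyp: "gromov_hyperbolic (carrier G) (word_dist G B \<pi>)"
  shows "\<exists>\<delta>. hyp_group G B \<pi> \<delta>"
proof -
  interpret fg_group G B \<pi> by unfold_locales (rule gen)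
  have gp: "gromov_product (word_dist G B \<pi>) p x y = gp p x y" for p x y
    by (simp add: gromov_product_def gp_def d_word_dist)
  obtain \<delta> where \<delta>: "\<And>p x y z. \<lbrakk>p \<in> carrier G; x \<in> carrier G; y \<in> carrier G; z \<in> carrier G\<rbrakk>
      \<Longrightarrow> min (gp p x y) (gp p y z) - \<delta> \<le> gp p x z"
    using hyp unfolding gromov_hyperbolic_def gp by blast
  have "hyp_group G B \<pi> (max \<delta> 0)"
  proof unfold_locales
    fix p x y z assume "p \<in> carrier G" "x \<in> carrier G" "y \<in> carrier G" "z \<in> carrier G"
    from \<delta>[OF this] show "min (gp p x y) (gp p y z) - max \<delta> 0 \<le> gp p x z" by linarith
  qed simp
  then show ?thesis ..
qed

context hyp_group
begin

text \<open>A chain of three comparisons takes two uses of the four-point inequality, each costing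
  \<open>\<delta>\<close>.\<close>

lemma four_point3:
  assumes "p \<in> carrier G" "x \<in> carrier G" "y \<in> carrier G" "z \<in> carrier G" "u \<in> carrier G"
    and "c \<le> gp p x y" "c \<le> gp p y z" "c \<le> gp p z u"
  shows "c - 2 * \<delta> \<le> gp p x u"
proof -
  have "c - \<delta> \<le> gp p x z"
    using four_point[of p x y z] assms by linarith
  then show ?thesis
    using four_point[of p x z u] assms \<delta> by linarith
qed

text \<open>The four-point inequality in the form without a base point, where only the three ways of
  pairing four points enter.\<close>

lemma four_point_dist:
  assumes "p \<in> carrier G" "x \<in> carrier G" "y \<in> carrier G" "z \<in> carrier G"
  shows "d p y + d x z \<le> max (d p x + d y z) (d p z + d y x) + 2 * \<delta>"
  using four_point[of p x y z] assms unfolding gp_def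
  by (simp add: d_sym min_def max_def field_simps split: if_splits)

section \<open>Local geodesics\<close>

definition geodesic :: "('b + 'b) list \<Rightarrow> bool"
  where "geodesic w \<longleftrightarrow> w \<in> lists X \<and> len (val w) = length w"

lemma geodesic_sub:
  assumes "geodesic (u @ v @ w)"
  shows "geodesic v"
proof -
  have in': "u \<in> lists X" "v \<in> lists X" "w \<in> lists X"
    using assms by (auto simp: geodesic_def)
  have "len (val (u @ v @ w)) \<le> len (val u) + (len (val v) + len (val w))"
    using in' len_mult[of "val u" "val v \<otimes> val w"] len_mult[of "val v" "val w"]
    by (simp add: val_append del: in_lists_conv_set)
  moreover have "len (val (u @ v @ w)) = length u + length v + length w"
    using assms by (simp add: geodesic_def)
  ultimately have "len (val v) = length v"
    using len_le[OF in'(1)] len_le[OF in'(2)] len_le[OF in'(3)] by linarith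
  then show ?thesis using in' by (simp add: geodesic_def)
qed

definition local_geodesic :: "nat \<Rightarrow> ('b + 'b) list \<Rightarrow> bool"
  where "local_geodesic k w \<longleftrightarrow> w \<in> lists X \<and>
    (\<forall>u v z. w = u @ v @ z \<longrightarrow> length v \<le> k \<longrightarrow> geodesic v)"

text \<open>Induction in steps of \<open>K\<close>. Little backtracking at position
  \<open>n - K\<close> becomes, by \<open>gp_swap\<close> and \<open>2 * \<delta> < K\<close>, a
  product above \<open>\<delta>\<close> at \<open>n\<close> between position \<open>n - K\<close>
  and the start. The subword from \<open>n - K\<close> to \<open>n + K\<close> is geodesic, so its
  product at \<open>n\<close> is 0, and the four-point inequality leaves at most
  \<open>\<delta>\<close> for the start and \<open>n + K\<close>.\<close>

lemma local_geodesic_gp: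
  assumes w: "local_geodesic (2 * K) w" and K: "2 * \<delta> < real K" and n: "n + K \<le> length w"
  shows "gp (val (take n w)) \<one> (val (take (n + K) w)) \<le> \<delta>"
  using n
proof (induction n rule: less_induct)
  case (less n)
  have wX: "w \<in> lists X" using w by (simp add: local_geodesic_def)
  have tk: "take m w \<in> lists X" "take m (drop j w) \<in> lists X" for m j
    using wX by (auto dest: in_set_takeD in_set_dropD)
  have split: "val (take (i + j) w) = val (take i w) \<otimes> val (take j (drop i w))" for i j
    using tk by (simp add: take_add val_append)
  have dist: "d (val (take i w)) (val (take (i + j) w)) = j"
    if "j \<le> 2 * K" "i + j \<le> length w" for i j
  proof -
    have "w = take i w @ take j (drop i w) @ drop (i + j) w"
      by (metis append_assoc append_take_drop_id take_add)
    then have "geodesic (take j (drop i w))"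
      using w that unfolding local_geodesic_def by (metis length_take min.cobounded1 min.cobounded2 order_trans)
    then show ?thesis
      using that tk by (simp add: split d_right geodesic_def del: in_lists_conv_set)
  qed
  let ?x = "\<lambda>i. val (take i w)"
  have x: "?x i \<in> carrier G" for i using tk by (metis val_closed)
  show ?case
  proof (cases "n < K")
    case True
    have "d (?x 0) (?x n) = n" "d (?x 0) (?x (n + K)) = n + K" "d (?x n) (?x (n + K)) = K"
      using dist[of n 0] dist[of "n + K" 0] dist[of K n] True less.prems by simp_all
    then show ?thesis
      using \<delta> d_sym[of "?x n" \<one>] x[of n] by (simp add: gp_def)
  next
    case False
    define m where "m = n - K"
    have nm: "n = m + K" using False by (simp add: m_def)
    have "gp (?x m) \<one> (?x n) \<le> \<delta>"
      using less.IH[of m] less.prems nm K \<delta> by (cases "K = 0") auto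
    moreover have e: "d (?x m) (?x n) = K"
      using dist[of K m] less.prems nm by simp
    moreover have e': "d (?x n) (?x m) = K"
      using e d_sym[OF x x, of n m] by simp
    moreover have "gp (?x n) (?x m) \<one> = d (?x n) (?x m) - gp (?x m) (?x n) \<one>"
      by (intro gp_swap x one_closed)
    ultimately have a: "\<delta> < gp (?x n) (?x m) \<one>"
      using K gp_sym[OF one_closed x, of "?x m" n] by linarith
    have "gp (?x n) (?x m) (?x (n + K)) = 0"
    proof -
      have "m + 2 * K = n + K" using nm by simp
      moreover have "d (?x m) (?x (m + 2 * K)) = (2 * K :: nat)"
        by (rule dist) (use nm less.prems in simp_all)
      ultimately have "d (?x m) (?x (n + K)) = 2 * K"
        by (simp only:)
      moreover have "d (?x n) (?x (n + K)) = K"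
        using dist[of K n] less.prems by simp
      ultimately show ?thesis
        using e' by (simp add: gp_def)
    qed
    then show ?thesis
      using four_point[of "?x n" "?x m" \<one> "?x (n + K)"] x a by auto
  qed
qed

text \<open>Words of length at most \<open>2 * K\<close> are geodesic. In a longer one the last
  \<open>K\<close> letters lead away from the start by at least \<open>K - 2 * \<delta>\<close>, as
  the backtracking where they begin is at most \<open>\<delta>\<close>.\<close>

lemma local_geodesic_nontrivial:
  assumes w: "local_geodesic (2 * K) w" and K: "2 * \<delta> < real K" and ne: "w \<noteq> []"
  shows "val w \<noteq> \<one>"
proof (cases "length w \<le> 2 * K")
  case True
  then have "geodesic w"
    using w unfolding local_geodesic_def by (metis append_Nil append_Nil2)
  then show ?thesis using ne by (auto simp: geodesic_def)
next
  case False
  have wX: "w \<in> lists X" using w by (simp add: local_geodesic_def)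
  define n where "n = length w - K"
  have n: "n + K = length w" using False by (simp add: n_def)
  let ?v = "take n w" and ?z = "drop n w"
  have z: "?v \<in> lists X" "?z \<in> lists X"
    using wX by (auto dest: in_set_takeD in_set_dropD)
  have "geodesic ?z"
    using w n unfolding local_geodesic_def
    by (metis append_Nil2 append_take_drop_id length_drop add_diff_cancel_left' le_add1 mult_2)
  then have "d (val ?v) (val w) = K"
    using z n val_append[OF z] d_right[of "val ?v" "val ?z"] by (simp add: geodesic_def del: in_lists_conv_set)
  moreover have "gp (val ?v) \<one> (val w) \<le> \<delta>"
    using local_geodesic_gp[OF w K, of n] n by simp
  ultimately have "d (val ?v) \<one> + K - 2 * \<delta> \<le> d \<one> (val w)"
    by (simp add: gp_def field_simps)
  then have "0 < d \<one> (val w)"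
    using K d_nonneg[of "val ?v" \<one>] by linarith
  then show ?thesis by auto
qed

end

section \<open>Amenable hyperbolic groups are virtually cyclic\<close>

context hyp_group
begin

text \<open>The half-space of points that are at least as close to \<open>g\<close> as to \<open>\<one>\<close>. Since left
  multiplication by \<open>g\<close> maps the complement of \<open>shadow (inv g)\<close> into \<open>shadow g\<close>,
  an invariant mean gives these two sets total measure at least 1.\<close>

definition shadow :: "'g \<Rightarrow> 'g set"
  where "shadow g = {x \<in> carrier G. len (inv g \<otimes> x) \<le> len x}"

lemma shadow_sub: "shadow g \<subseteq> carrier G"
  by (auto simp: shadow_def)

lemma shadow_translate:
  assumes g: "g \<in> carrier G"
  shows "g <# (carrier G - shadow (inv g)) \<subseteq> shadow g"
  using g by (auto simp: l_coset_def shadow_def)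

lemma shadow_gp:
  assumes g: "g \<in> carrier G" and x: "x \<in> shadow g"
  shows "real (len g) / 2 \<le> gp \<one> g x"
proof -
  have "x \<in> carrier G" "len (inv g \<otimes> x) \<le> len x"
    using x by (auto simp: shadow_def)
  then show ?thesis using g by (simp add: gp_def d_one) (simp add: d_def)
qed

text \<open>A common point has product at least \<open>c / 2\<close> with both elements, which
  passes to the elements themselves at the cost of \<open>\<delta>\<close>.\<close>

lemma shadows_disjoint:
  assumes "g \<in> carrier G" "h \<in> carrier G" "(c :: real) \<le> len g" "c \<le> len h"
    and "gp \<one> g h < c / 2 - \<delta>"
  shows "shadow g \<inter> shadow h = {}"
proof (rule ccontr)
  assume "shadow g \<inter> shadow h \<noteq> {}"
  then obtain x where x: "x \<in> shadow g" "x \<in> shadow h" by blast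
  then have xc: "x \<in> carrier G" using shadow_sub by blast
  have "c / 2 \<le> gp \<one> g x" "c / 2 \<le> gp \<one> x h"
    using shadow_gp[OF assms(1) x(1)] shadow_gp[OF assms(2) x(2)] gp_sym[OF assms(2) xc] assms(3,4)
    by simp_all
  then show False
    using four_point[of \<one> g x h] assms xc by simp
qed

section \<open>Existence of loxodromic elements\<close>

definition loxodromic :: "'g \<Rightarrow> bool"
  where "loxodromic a \<longleftrightarrow> a \<in> carrier G \<and> real (len a) + 3 * \<delta> + 1 \<le> real (len (a \<otimes> a))"

lemma not_loxodromic_gp:
  assumes "g \<in> carrier G" "\<not> loxodromic g"
  shows "(real (len g) - (3 * \<delta> + 1)) / 2 \<le> gp \<one> g (inv g)"
proof -
  have "d g (inv g) = len (g \<otimes> g)"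
    using assms len_inv[of "g \<otimes> g"] by (simp add: d_def inv_mult_group)
  then show ?thesis
    using assms by (simp add: gp_def d_one loxodromic_def)
qed

text \<open>Infinite groups have arbitrarily long geodesic words; the first two segments of length
  \<open>n\<close> of such a word serve as \<open>g\<close> and \<open>h\<close>.\<close>

lemma long_elements:
  assumes inf: "infinite (carrier G)"
  obtains g h where "g \<in> carrier G" "h \<in> carrier G" "len g = n" "len h = n" "len (g \<otimes> h) = 2 * n"
proof -
  have "\<exists>k\<in>carrier G. 2 * n \<le> len k"
  proof (rule ccontr)
    assume "\<not> ?thesis"
    then have "carrier G \<subseteq> {g \<in> carrier G. len g \<le> 2 * n}" by auto
    then show False using inf finite_ball finite_subset by blast
  qed
  then obtain k where k: "k \<in> carrier G" "2 * n \<le> len k" by blast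
  obtain w where w: "w \<in> lists X" "length w = len k" "val w = k"
    using len_word[OF k(1)] .
  have tk: "take m w \<in> lists X" "take m (drop j w) \<in> lists X" for m j
    using w(1) by (auto dest: in_set_takeD in_set_dropD)
  have geo: "geodesic w" using w by (simp add: geodesic_def)
  have "w = [] @ take n w @ drop n w" "w = take n w @ take n (drop n w) @ drop (n + n) w"
    "w = [] @ take (2 * n) w @ drop (2 * n) w"
    by (auto simp: append_take_drop_id[symmetric] take_add[symmetric] simp flip: append_assoc)
  then have "geodesic (take n w)" "geodesic (take n (drop n w))" "geodesic (take (2 * n) w)"
    using geo geodesic_sub by metis+
  moreover have "val (take (2 * n) w) = val (take n w) \<otimes> val (take n (drop n w))"
    using tk by (simp add: mult_2 take_add val_append)
  ultimately show ?thesis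
    using that[of "val (take n w)" "val (take n (drop n w))"] tk k w(2)
    by (simp add: geodesic_def del: in_lists_conv_set)
qed

text \<open>If no element were loxodromic, each would point in nearly the same direction as its
  inverse. When lengths add up in \<open>g \<otimes> h\<close>, this links \<open>inv g\<close> to
  \<open>g\<close>, to \<open>g \<otimes> h\<close>, to its inverse, to \<open>inv h\<close> and
  finally to \<open>h\<close>, although \<open>inv g\<close> and \<open>h\<close> have product
  0.\<close>

lemma exists_loxodromic:
  assumes inf: "infinite (carrier G)"
  shows "\<exists>a. loxodromic a"
proof (rule ccontr)
  assume "\<not> ?thesis"
  then have no: "\<not> loxodromic a" for a by blast
  define c where "c = 3 * \<delta> + 1"
  obtain n :: nat where n: "c + 8 * \<delta> < real n" using reals_Archimedean2 by blast
  obtain g h where gh: "g \<in> carrier G" "h \<in> carrier G" "len g = n" "len h = n"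
    "len (g \<otimes> h) = 2 * n"
    using long_elements[OF inf] .
  have c0: "0 \<le> c" using \<delta> by (simp add: c_def)
  let ?k = "g \<otimes> h"
  have k: "?k \<in> carrier G" using gh by simp
  have "(real n - c) / 2 \<le> gp \<one> g (inv g)" "(real n - c) / 2 \<le> gp \<one> h (inv h)"
    and kk: "real n - c / 2 \<le> gp \<one> ?k (inv ?k)"
    using not_loxodromic_gp[OF gh(1) no] not_loxodromic_gp[OF gh(2) no]
      not_loxodromic_gp[OF k no] gh by (simp_all add: c_def field_simps)
  moreover have "gp \<one> g ?k = n"
    using gh by (simp add: gp_def d_one d_right)
  moreover have "gp \<one> (inv ?k) (inv h) = n"
  proof -
    have "d (inv ?k) (inv h) = len (inv (inv ?k) \<otimes> inv h)" by (simp add: d_def)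
    moreover have "inv (inv ?k) \<otimes> inv h = g"
      using gh by (simp add: m_assoc)
    ultimately show ?thesis
      using gh by (simp add: gp_def d_one)
  qed
  ultimately have "(real n - c / 2) - 2 * \<delta> \<le> gp \<one> g (inv h)"
    using gh c0 by (intro four_point3[of \<one> g ?k "inv ?k" "inv h"]) auto
  then have "(real n - c) / 2 - 2 * \<delta> \<le> gp \<one> g (inv h)"
    by (simp add: field_simps)
  moreover have "gp \<one> (inv g) g = gp \<one> g (inv g)" "gp \<one> (inv h) h = gp \<one> h (inv h)"
    using gh by (simp_all add: gp_sym)
  ultimately have "((real n - c) / 2 - 2 * \<delta>) - 2 * \<delta> \<le> gp \<one> (inv g) h"
    using gh \<delta> \<open>(real n - c) / 2 \<le> gp \<one> g (inv g)\<close> \<open>(real n - c) / 2 \<le> gp \<one> h (inv h)\<close>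
    by (intro four_point3[of \<one> "inv g" g "inv h" h]; (simp; fail)?) linarith+
  moreover have "gp \<one> (inv g) h = 0"
    using gh by (simp add: gp_def d_one) (simp add: d_def)
  ultimately show False
    using n by (simp add: field_simps)
qed

end

section \<open>Powers of a loxodromic element as a quasi-geodesic\<close>

locale loxodromic_element = hyp_group G B \<pi> \<delta>
  for G :: "('g, 'm) monoid_scheme" (structure) and B :: "'b set" and \<pi> and \<delta> +
  fixes a :: 'g
  assumes a: "loxodromic a"
begin

lemma a_closed [simp]: "a \<in> carrier G"
  using a by (simp add: loxodromic_def)

text \<open>The backtracking at \<open>\<one>\<close> of the path through \<open>inv a\<close>,
  \<open>\<one>\<close> and \<open>a\<close>.\<close>

definition \<alpha> :: real where "\<alpha> = gp \<one> (inv a) a"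

text \<open>The backtracking that remains possible along the whole sequence of powers; see
  \<open>quasi_geodesic\<close>.\<close>

definition \<kappa> :: real where "\<kappa> = \<alpha> + 2 * \<delta>"

lemma d_inv_a: "d (inv a) a = len (a \<otimes> a)"
  by (simp add: d_def)

lemma \<alpha>_bound: "2 * \<alpha> + 3 * \<delta> + 1 \<le> len a" and \<alpha>_nonneg: "0 \<le> \<alpha>"
  using a gp_nonneg[of \<one> "inv a" a]
  by (simp_all add: \<alpha>_def gp_def d_one d_inv_a loxodromic_def field_simps)

lemma \<kappa>_nonneg: "0 \<le> \<kappa>"
  using \<alpha>_nonneg \<delta> by (simp add: \<kappa>_def)

abbreviation pw :: "int \<Rightarrow> 'g" where "pw i \<equiv> a [^] i"

lemma pw_add: "pw (i + j) = pw i \<otimes> pw j"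
  by (simp add: int_pow_mult)

lemma d_pw: "d (pw i) (pw (i + j)) = len (pw j)"
  by (simp add: pw_add d_right)

lemma len_pw_neg: "len (pw (- i)) = len (pw i)"
  by (simp add: int_pow_neg)

lemma gp_pw: "gp (pw (k + i)) (pw (k + j)) (pw (k + l)) = gp (pw i) (pw j) (pw l)"
  by (simp add: pw_add gp_left)

text \<open>Translating by \<open>a\<close> and applying \<open>gp_swap\<close> turns the bound for
  \<open>n\<close> into a product above \<open>\<alpha> + 2 * \<delta>\<close> between
  \<open>pw (- int (Suc n))\<close> and \<open>inv a\<close>; this consumes the margin
  \<open>3 * \<delta> + 1\<close> in \<open>loxodromic\<close>. Since \<open>inv a\<close> and
  \<open>a\<close> have product \<open>\<alpha>\<close>, the four-point inequality closes the
  induction.\<close>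

lemma gp_step: "gp \<one> (pw (- int n)) a \<le> \<alpha> + \<delta>"
proof (induction n)
  case 0
  then show ?case using \<alpha>_nonneg \<delta> by (simp add: gp_def)
next
  case (Suc n)
  have e: "a \<otimes> pw (- int (Suc n)) = pw (- int n)"
    using pw_add[of 1 "- int (Suc n)"] by simp
  have "gp \<one> (pw (- int (Suc n))) (inv a) = gp a (pw (- int n)) \<one>"
    using gp_left[of a \<one> "pw (- int (Suc n))" "inv a"] e by simp
  moreover have "gp a \<one> (pw (- int n)) = d a \<one> - gp \<one> a (pw (- int n))"
    by (intro gp_swap) auto
  moreover have "d a \<one> = len a"
    by (simp add: d_def)
  ultimately have 1: "\<alpha> + 2 * \<delta> < gp \<one> (pw (- int (Suc n))) (inv a)"
    using Suc \<alpha>_bound \<delta> gp_sym[of a "pw (- int n)" \<one>] gp_sym[of "pw (- int n)" \<one> a] by simp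
  then show ?case
    using four_point[of \<one> "inv a" "pw (- int (Suc n))" a] \<delta>
      gp_sym[of "inv a" "pw (- int (Suc n))" \<one>] by (simp add: \<alpha>_def)
qed

lemma loxodromic_inv: "loxodromic_element G B \<pi> \<delta> (inv a)"
proof unfold_locales
  have "len (inv a \<otimes> inv a) = len (a \<otimes> a)"
    using len_inv[of "a \<otimes> a"] by (simp add: inv_mult_group)
  then show "loxodromic (inv a)" using a by (simp add: loxodromic_def)
qed

lemma gp_step_inv: "gp \<one> (pw (int n)) (inv a) \<le> \<alpha> + \<delta>"
proof -
  interpret inv: loxodromic_element G B \<pi> \<delta> "inv a" by (rule loxodromic_inv)
  have "(inv a) [^] (- int n) = pw (int n)"
    by (simp add: int_pow_inv int_pow_neg)
  moreover have "inv.\<alpha> = \<alpha>"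
    using gp_sym[of a "inv a" \<one>] by (simp add: inv.\<alpha>_def \<alpha>_def)
  ultimately show ?thesis using inv.gp_step[of n] by simp
qed

text \<open>A further factor \<open>a\<close> loses at most \<open>2 * (\<alpha> + \<delta>)\<close>
  of its length to backtracking, so it gains at least 1.\<close>

lemma len_pw_ge: "\<bar>i\<bar> \<le> int (len (pw i))"
proof -
  have shrink: "x + 1 \<le> z" if "x + y - 2 * (u + v) \<le> z" "2 * u + 3 * v + 1 \<le> y" "0 \<le> v"
    for u v x y z :: real
    using that by simp
  have nat: "n \<le> len (pw (int n))" for n
  proof (induction n)
    case (Suc n)
    define k where "k = int n + 1"
    have "gp (pw (int n)) \<one> (pw k) = gp \<one> (pw (- int n)) a"
      using gp_pw[of "int n" 0 "- int n" 1] by (simp add: k_def)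
    then have "gp (pw (int n)) \<one> (pw k) \<le> \<alpha> + \<delta>"
      using gp_step by simp
    moreover have "d (pw (int n)) (pw k) = len a"
      using d_pw[of "int n" 1] by (simp add: k_def)
    moreover have "d (pw (int n)) \<one> = len (pw (int n))" "d \<one> (pw k) = len (pw k)"
      by (simp_all add: d_one d_sym[of _ \<one>])
    ultimately have "real (len (pw (int n))) + len a - 2 * (\<alpha> + \<delta>) \<le> len (pw k)"
      by (simp add: gp_def field_simps)
    then have "real (len (pw (int n))) + 1 \<le> len (pw k)"
      using \<alpha>_bound \<delta> shrink by blast
    moreover have "int (Suc n) = k" by (simp add: k_def)
    ultimately show ?case using Suc by simp
  qed simp
  show ?thesis
    using nat[of "nat \<bar>i\<bar>"] len_pw_neg[of i] by (cases "0 \<le> i") auto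
qed

lemma len_pw_le: "len (pw (int n)) \<le> n * len a"
proof (induction n)
  case (Suc n)
  have "pw (int (Suc n)) = pw (int n) \<otimes> a"
    using pw_add[of "int n" 1] by (simp add: add.commute)
  then show ?case using Suc len_mult[of "pw (int n)" a] by simp
qed simp

text \<open>For positive exponents the powers have a product above
  \<open>\<alpha> + 2 * \<delta>\<close> with \<open>a\<close>, whereas \<open>gp_step\<close>
  bounds that of the negative ones by \<open>\<alpha> + \<delta>\<close>; the four-point inequality
  separates the two.\<close>

lemma gp_opposite: "gp \<one> (pw (- int m)) (pw (int n)) \<le> \<kappa>"
proof (cases n)
  case 0
  then show ?thesis
    using \<kappa>_nonneg by (simp add: gp_def d_sym[of _ \<one>])
next
  case (Suc k)
  have "a \<otimes> pw (int k) = pw (int n)" using Suc pw_add[of 1 "int k"] by simp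
  then have "gp a \<one> (pw (int n)) = gp \<one> (inv a) (pw (int k))"
    using gp_left[of a \<one> "inv a" "pw (int k)"] by simp
  moreover have "gp \<one> (inv a) (pw (int k)) \<le> \<alpha> + \<delta>"
    using gp_step_inv[of k] gp_sym[of "pw (int k)" "inv a" \<one>] by simp
  moreover have "gp \<one> a (pw (int n)) = d \<one> a - gp a \<one> (pw (int n))"
    by (intro gp_swap) auto
  ultimately have "\<alpha> + 2 * \<delta> < gp \<one> (pw (int n)) a"
    using \<alpha>_bound gp_sym[of "pw (int n)" a \<one>] by (simp add: d_one)
  then show ?thesis
    using four_point[of \<one> "pw (- int m)" "pw (int n)" a] gp_step[of m] by (simp add: \<kappa>_def)
qed

lemma quasi_geodesic:
  assumes "i \<le> j" "j \<le> k"
  shows "gp (pw j) (pw i) (pw k) \<le> \<kappa>"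
  using gp_pw[of j 0 "i - j" "k - j"] gp_opposite[of "nat (j - i)" "nat (k - j)"] assms by simp

text \<open>A discrete intermediate value argument along the powers from \<open>pw l\<close> to
  \<open>pw r\<close> finds one that is as far from \<open>pw l\<close> as \<open>p\<close> is, up
  to one step \<open>len a\<close> and the slack \<open>2 * c\<close>. Then
  \<open>four_point_dist\<close> bounds its distance to \<open>p\<close>, uniformly in
  \<open>p\<close>, \<open>l\<close> and \<open>r\<close>.\<close>

lemma near_axis:
  assumes p: "p \<in> carrier G" and lr: "l \<le> r" and c: "gp p (pw l) (pw r) \<le> c"
  shows "\<exists>j. d p (pw j) \<le> 4 * c + len a + 2 * \<kappa> + 2 * \<delta>"
proof -
  let ?s = "pw l" and ?e = "pw r"
  have c0: "0 \<le> c" using c gp_nonneg[of p ?s ?e] p by simp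
  have split: "d ?s p + d p ?e \<le> d ?s ?e + 2 * c"
    using c p by (simp add: gp_def d_sym[of p ?s])
  have "\<exists>j. l \<le> j \<and> j \<le> r \<and> \<bar>d ?s (pw j) - d ?s p\<bar> \<le> len a + 2 * c"
  proof (cases "d ?s p \<le> d ?s ?e")
    case True
    let ?P = "\<lambda>n. d ?s p \<le> d ?s (pw (l + int n))"
    define n where "n = (LEAST n. ?P n)"
    have P: "?P (nat (r - l))" using True lr by simp
    have n: "?P n" "n \<le> nat (r - l)"
      unfolding n_def using LeastI[of ?P, OF P] Least_le[of ?P, OF P] by auto
    show ?thesis
    proof (cases n)
      case 0
      then show ?thesis using n c0 lr by (intro exI[of _ l]) auto
    next
      case (Suc m)
      then have "\<not> ?P m" using not_less_Least[of m ?P] by (simp add: n_def)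
      moreover have "d ?s (pw (l + int n)) \<le> d ?s (pw (l + int m)) + d (pw (l + int m)) (pw (l + int n))"
        by (intro d_tri) auto
      moreover have "d (pw (l + int m)) (pw (l + int n)) = len a"
        using d_pw[of "l + int m" 1] Suc by (simp add: algebra_simps)
      ultimately show ?thesis
        using n c0 lr by (intro exI[of _ "l + int n"]) auto
    qed
  next
    case False
    then show ?thesis
      using split c0 lr d_nonneg[of p ?e] by (intro exI[of _ r] conjI; linarith)
  qed
  then obtain j where j: "l \<le> j" "j \<le> r" "\<bar>d ?s (pw j) - d ?s p\<bar> \<le> len a + 2 * c" by blast
  have "d (pw j) ?s + d (pw j) ?e - d ?s ?e \<le> 2 * \<kappa>"
    using quasi_geodesic[OF j(1,2)] by (simp add: gp_def)
  moreover have "d p (pw j) + d ?s ?e \<le> max (d p ?s + d (pw j) ?e) (d p ?e + d (pw j) ?s) + 2 * \<delta>"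
    using p by (intro four_point_dist) auto
  moreover have "d p ?s = d ?s p" "d (pw j) ?s = d ?s (pw j)"
    using p by (auto intro: d_sym)
  ultimately have "d p (pw j) \<le> 4 * c + len a + 2 * \<kappa> + 2 * \<delta>"
    using split j(3) c0 \<kappa>_nonneg by (simp add: max_def split: if_splits)
  then show ?thesis ..
qed

section \<open>Elements that commensurate a loxodromic element\<close>

abbreviation conj :: "'g \<Rightarrow> int \<Rightarrow> 'g" where "conj x i \<equiv> x \<otimes> pw i \<otimes> inv x"

lemma inv_conj: "x \<in> carrier G \<Longrightarrow> inv (conj x i) = conj x (- i)"
  by (simp add: inv_mult_group m_assoc int_pow_neg)

lemma len_conj:
  assumes x: "x \<in> carrier G"
  shows "len (pw i) \<le> len (conj x i) + 2 * len x"
proof -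
  have "pw i = inv x \<otimes> (conj x i \<otimes> x)"
    using x by (simp add: m_assoc)
  moreover have "len (inv x \<otimes> (conj x i \<otimes> x)) \<le> len (inv x) + (len (conj x i) + len x)"
    using x len_mult[of "inv x" "conj x i \<otimes> x"] len_mult[of "conj x i" x] by simp
  ultimately show ?thesis using x by simp
qed

lemma conj_mult:
  assumes x: "x \<in> carrier G"
  shows "conj x (i + j) = conj x i \<otimes> conj x j"
  using x by (simp add: pw_add m_assoc)

lemma conj_power:
  assumes x: "x \<in> carrier G" and pq: "conj x p = pw q"
  shows "conj x (p * int n) = pw (q * int n)"
proof (induction n)
  case (Suc n)
  have "conj x (p * int (Suc n)) = conj x (p + p * int n)"
    by (simp add: algebra_simps)
  also have "\<dots> = conj x p \<otimes> conj x (p * int n)"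
    by (rule conj_mult[OF x])
  also have "\<dots> = pw (q + q * int n)"
    by (simp only: pq Suc pw_add)
  finally show ?case by (simp add: algebra_simps)
qed (use x in simp)

text \<open>What matters is that the bound does not depend on \<open>x\<close>. By the relation,
  corresponding points of the translated axis and of the axis stay at distance \<open>len x\<close>
  in both directions. Far out they are indistinguishable from \<open>x\<close>, so the small product
  at \<open>x\<close> of the two ends of the translated axis carries over to the axis at the cost of
  \<open>2 * \<delta>\<close>, and \<open>near_axis\<close> applies.\<close>

lemma close_to_axis:
  assumes x: "x \<in> carrier G" and pq: "conj x p = pw q" and p: "p \<noteq> 0"
  shows "\<exists>j. d x (pw j) \<le> 4 * (\<kappa> + 2 * \<delta>) + len a + 2 * \<kappa> + 2 * \<delta>"
proof -
  have q: "q \<noteq> 0"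
  proof
    assume "q = 0"
    then have "inv x \<otimes> (conj x p \<otimes> x) = \<one>" using pq x by simp
    then have "pw p = \<one>" using x by (simp add: m_assoc)
    then show False using len_pw_ge[of p] p by simp
  qed
  obtain n :: nat where n: "\<kappa> + 2 * \<delta> + len x < real n" using reals_Archimedean2 by blast
  have pair: "real n - len x \<le> gp x (x \<otimes> pw (s * p * int n)) (pw (s * q * int n))"
    if s: "s = 1 \<or> s = -1" for s
  proof -
    have "conj x (s * p) = pw (s * q)"
      using s pq inv_conj[OF x, of p] by (auto simp: int_pow_neg)
    then have "conj x (s * p * int n) = pw (s * q * int n)"
      by (rule conj_power[OF x])
    then have e: "x \<otimes> pw (s * p * int n) = pw (s * q * int n) \<otimes> x"
      using x by (metis int_pow_closed a_closed inv_solve_right m_closed)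
    have "d (x \<otimes> pw (s * p * int n)) (pw (s * q * int n)) = len x"
      using x d_right[of "pw (s * q * int n)" x] by (simp add: e d_sym)
    moreover have "d x (x \<otimes> pw (s * p * int n)) = len (pw (s * p * int n))"
      using x by (simp add: d_right)
    moreover have "d \<one> (pw (s * q * int n)) \<le> d \<one> x + d x (pw (s * q * int n))"
      using x by (intro d_tri) auto
    moreover have "int n \<le> int (len (pw (s * p * int n)))" "int n \<le> int (len (pw (s * q * int n)))"
    proof -
      have "1 * int n \<le> \<bar>s * p\<bar> * int n" "1 * int n \<le> \<bar>s * q\<bar> * int n"
        using s p q by (intro mult_right_mono; auto)+
      then show "int n \<le> int (len (pw (s * p * int n)))" "int n \<le> int (len (pw (s * q * int n)))"
        using len_pw_ge[of "s * p * int n"] len_pw_ge[of "s * q * int n"]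
        by (auto simp: abs_mult)
    qed
    ultimately show ?thesis
      using x by (simp add: gp_def d_one)
  qed
  let ?u = "x \<otimes> pw (p * int n)" and ?v = "pw (q * int n)"
    and ?u' = "x \<otimes> pw (- (p * int n))" and ?v' = "pw (- (q * int n))"
  have "gp x ?u' ?u = gp \<one> (pw (- (p * int n))) (pw (p * int n))"
    using x gp_left[of x \<one> "pw (- (p * int n))" "pw (p * int n)"] by simp
  also have "\<dots> \<le> \<kappa>"
    using quasi_geodesic[of "- (p * int n)" 0 "p * int n"] quasi_geodesic[of "p * int n" 0 "- (p * int n)"]
      gp_sym[of "pw (- (p * int n))" "pw (p * int n)" \<one>] by (cases "0 \<le> p * int n") auto
  finally have small: "gp x ?u' ?u \<le> \<kappa>" .
  have "gp x ?v' ?v \<le> \<kappa> + 2 * \<delta>"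
  proof (rule ccontr)
    assume "\<not> ?thesis"
    moreover define c where "c = min (gp x ?v' ?v) (real n - len x)"
    ultimately have c: "\<kappa> + 2 * \<delta> < c" using n by simp
    have "c - 2 * \<delta> \<le> gp x ?u' ?u"
      using pair[of 1] pair[of "-1"] x gp_sym[of ?u ?v x]
      by (intro four_point3[of x ?u' ?v' ?v ?u]) (auto simp: c_def)
    then show False using c small by simp
  qed
  then show ?thesis
    using near_axis[OF x, of "- (q * int n)" "q * int n" "\<kappa> + 2 * \<delta>"]
      near_axis[OF x, of "q * int n" "- (q * int n)" "\<kappa> + 2 * \<delta>"]
      x gp_sym[of ?v ?v' x] by (cases "0 \<le> q * int n") auto
qed

text \<open>Every element is a power of \<open>a\<close> times an element of the ball of radius
  \<open>D\<close>, so finitely many representatives meet all cosets of the cyclic subgroup.\<close>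

lemma virtually_cyclic_if_close:
  assumes "\<And>x. x \<in> carrier G \<Longrightarrow> \<exists>j. d x (pw j) \<le> D"
  shows "virtually_cyclic G"
proof -
  let ?C = "carrier (subgroup_generated G {a})"
  have C: "?C = range pw"
    by (simp add: carrier_subgroup_generated_by_singleton)
  have sub: "subgroup ?C G" by (rule subgroup_subgroup_generated)
  have "rcosets ?C \<subseteq> (\<lambda>h. ?C #> h) ` {g \<in> carrier G. len g \<le> nat \<lfloor>D\<rfloor>}"
  proof
    fix c assume "c \<in> rcosets ?C"
    then obtain x where x: "x \<in> carrier G" "c = ?C #> x" by (auto simp: RCOSETS_def)
    obtain j where j: "d x (pw j) \<le> D" using assms[OF x(1)] by blast
    define h where "h = inv (pw j) \<otimes> x"
    have h: "h \<in> carrier G" "x = pw j \<otimes> h" using x(1) by (simp_all add: h_def)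
    have "real (len h) \<le> D"
      using j x(1) d_sym[of x "pw j"] by (simp add: d_def h_def)
    then have "len h \<le> nat \<lfloor>D\<rfloor>" by linarith
    moreover have "c = ?C #> h"
    proof -
      have "?C #> x = (?C #> pw j) #> h"
        using h sub by (simp add: coset_mult_assoc subgroup.subset)
      also have "?C #> pw j = ?C"
        by (rule coset_join2[OF _ sub]) (auto simp: C)
      finally show ?thesis using x(2) by simp
    qed
    ultimately show "c \<in> (\<lambda>h. ?C #> h) ` {g \<in> carrier G. len g \<le> nat \<lfloor>D\<rfloor>}"
      using h(1) by blast
  qed
  then have "finite (rcosets ?C)"
    using finite_ball finite_surj by blast
  moreover have "G\<lparr>carrier := ?C\<rparr> = subgroup_generated G {a}"
    by (simp add: subgroup_generated_def)
  ultimately show ?thesis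
    using sub cyclic_group_generated[of a]
    unfolding virtually_cyclic_def finite_index_subgroup_def by metis
qed

end

section \<open>Invariant means force commensuration\<close>

locale mean = group G for G (structure) +
  fixes m :: "'g set \<Rightarrow> real"
  assumes m_nonneg: "U \<subseteq> carrier G \<Longrightarrow> 0 \<le> m U" and m_carrier: "m (carrier G) = 1"
    and m_Un: "U \<subseteq> carrier G \<Longrightarrow> V \<subseteq> carrier G \<Longrightarrow> U \<inter> V = {} \<Longrightarrow> m (U \<union> V) = m U + m V"
    and m_left: "g \<in> carrier G \<Longrightarrow> U \<subseteq> carrier G \<Longrightarrow> m (g <# U) = m U"

lemma (in group) amenable_mean: "amenable G \<longleftrightarrow> (\<exists>m. mean G m)"
  unfolding amenable_def mean_def mean_axioms_def
  by (intro arg_cong[of _ _ Ex] ext) (simp add: group_axioms Ball_def imp_conjL)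

lemma (in mean) m_mono: "U \<subseteq> V \<Longrightarrow> V \<subseteq> carrier G \<Longrightarrow> m U \<le> m V"
proof -
  assume UV: "U \<subseteq> V" "V \<subseteq> carrier G"
  then have "m (U \<union> (V - U)) = m U + m (V - U)" by (intro m_Un) auto
  moreover have "U \<union> (V - U) = V" using UV by auto
  moreover have "0 \<le> m (V - U)" using UV by (intro m_nonneg) auto
  ultimately show ?thesis by simp
qed

context loxodromic_element
begin

lemma mean_shadow:
  assumes m: "mean G m" and g: "g \<in> carrier G"
  shows "1 \<le> m (shadow g) + m (shadow (inv g))"
proof -
  interpret mean G m by (rule m)
  let ?U = "carrier G - shadow (inv g)"
  have "m (?U \<union> shadow (inv g)) = m ?U + m (shadow (inv g))"
    using shadow_sub by (intro m_Un) auto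
  moreover have "?U \<union> shadow (inv g) = carrier G" using shadow_sub by auto
  moreover have "m ?U = m (g <# ?U)" using m_left[OF g, of ?U] by simp
  moreover have "m (g <# ?U) \<le> m (shadow g)"
    using shadow_translate[OF g] shadow_sub by (rule m_mono)
  ultimately show ?thesis using m_carrier by simp
qed

text \<open>Otherwise the two shadows of a power of \<open>a\<close>, which already have total measure 1, and the
  two shadows of the conjugate power would have total measure at least \<open>3 / 2\<close>.\<close>

lemma shadows_meet:
  assumes m: "mean G m" and x: "x \<in> carrier G" and N: "2 * (\<kappa> + \<delta>) < real N"
  shows "\<exists>s t. (s = 1 \<or> s = -1) \<and> (t = 1 \<or> t = -1) \<and>
    shadow (pw (s * int N)) \<inter> shadow (conj x (t * int N)) \<noteq> {}"
proof (rule ccontr)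
  assume "\<not> ?thesis"
  then have dis: "shadow (pw (s * int N)) \<inter> shadow (conj x (t * int N)) = {}"
    if "s = 1 \<or> s = -1" "t = 1 \<or> t = -1" for s t using that by blast
  interpret mean G m by (rule m)
  let ?A = "shadow (pw (int N))" and ?A' = "shadow (pw (- int N))"
    and ?B = "shadow (conj x (int N))" and ?B' = "shadow (conj x (- int N))"
  have "?A' \<inter> ?A = {}"
  proof (rule shadows_disjoint)
    show "real N \<le> len (pw (- int N))" "real N \<le> len (pw (int N))"
      using len_pw_ge[of "- int N"] len_pw_ge[of "int N"] by auto
    show "gp \<one> (pw (- int N)) (pw (int N)) < real N / 2 - \<delta>"
      using gp_opposite[of N N] N by simp
  qed auto
  then have A: "m (?A \<union> ?A') = m ?A + m ?A'"
    using shadow_sub by (intro m_Un) auto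
  have A1: "1 \<le> m ?A + m ?A'"
    using mean_shadow[OF m, of "pw (int N)"] by (simp add: int_pow_neg)
  have B1: "1 \<le> m ?B + m ?B'"
    using mean_shadow[OF m, of "conj x (int N)"] x inv_conj[OF x, of "int N"] by simp
  have "m (?A \<union> ?A') + m S \<le> 1" if "S = ?B \<or> S = ?B'" for S
  proof -
    have S: "S \<subseteq> carrier G" "(?A \<union> ?A') \<inter> S = {}"
      using shadow_sub dis[of 1 1] dis[of 1 "-1"] dis[of "-1" 1] dis[of "-1" "-1"] that
      by auto
    then have "m (?A \<union> ?A' \<union> S) = m (?A \<union> ?A') + m S"
      using shadow_sub by (intro m_Un) auto
    moreover have "m (?A \<union> ?A' \<union> S) \<le> m (carrier G)"
      using S(1) shadow_sub by (intro m_mono) auto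
    ultimately show ?thesis using m_carrier by simp
  qed
  from this[of ?B] this[of ?B'] show False
    using A A1 B1 by simp
qed

text \<open>Meeting shadows make the ray of powers translated by \<open>x\<close> and the axis run
  close together at first, up to the signs \<open>s\<close> and \<open>t\<close>. So
  \<open>I + 1\<close> points of the translated ray lie within \<open>D\<close> of the axis, two of
  them with the same displacement, and comparing these two gives the relation.\<close>

lemma commensurates:
  assumes m: "mean G m" and x: "x \<in> carrier G"
  shows "\<exists>p q. p \<noteq> 0 \<and> conj x p = pw q"
proof -
  define c where "c = \<kappa> + len x + \<delta>"
  define D where "D = 4 * c + len a + 2 * \<kappa> + 2 * \<delta>"
  let ?ball = "{g \<in> carrier G. len g \<le> nat \<lfloor>D\<rfloor>}"
  define I where "I = card ?ball"
  \<comment> \<open>The term \<open>2 * (\<kappa> + \<delta>)\<close> is what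
    \<open>shadows_meet\<close> asks for; the others keep the first \<open>I + 1\<close> points of
    the ray in the stretch that is close to the axis.\<close>
  obtain N0 :: nat where N0: "2 * (\<kappa> + \<delta>) + 6 * len x + 2 * \<delta> + 2 * (real I * len a) < real N0"
    using reals_Archimedean2 by blast
  define N where "N = N0 + I"
  have N: "2 * (\<kappa> + \<delta>) + 6 * len x + 2 * \<delta> + 2 * (real I * len a) < real N" "I \<le> N"
    using N0 by (simp_all add: N_def)
  have N': "2 * (\<kappa> + \<delta>) < real N"
    using N(1) \<delta> mult_nonneg_nonneg[of "real I" "real (len a)"] by linarith
  obtain s t where st: "s = 1 \<or> s = -1" "t = 1 \<or> t = -1"
    and meet: "shadow (pw (s * int N)) \<inter> shadow (conj x (t * int N)) \<noteq> {}"
    using shadows_meet[OF m x N'] by blast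
  let ?y = "pw (s * int N)" and ?z = "x \<otimes> pw (t * int N)" and ?b = "conj x (t * int N)"
  have ly: "real N \<le> len ?y" and lt: "real N \<le> len (pw (t * int N))"
    using st len_pw_ge[of "s * int N"] len_pw_ge[of "t * int N"] by (auto simp: abs_mult)
  have "real N - 2 * len x \<le> len ?b"
    using len_conj[OF x, of "t * int N"] lt by linarith
  then have "(real N - 2 * len x) / 2 - \<delta> \<le> gp \<one> ?y ?b"
    using shadows_disjoint[of ?y ?b "real N - 2 * len x"] meet ly x by (force simp: not_le)
  moreover have "d ?b ?z = len x"
  proof -
    have "?b \<otimes> x = ?z" using x by (simp add: m_assoc)
    then show ?thesis using x d_right[of ?b x] by simp
  qed
  moreover have "d ?y ?z \<le> d ?y ?b + d ?b ?z" "d \<one> ?b \<le> d \<one> ?z + d ?z ?b" "d ?z ?b = d ?b ?z"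
    using x by (auto intro!: d_tri d_sym)
  ultimately have yz: "real N / 2 - 2 * len x - \<delta> \<le> gp \<one> ?z ?y"
    using x gp_sym[of ?z ?y \<one>] by (simp add: gp_def field_simps)
  have "\<exists>j. d (x \<otimes> pw (t * int i)) (pw j) \<le> D" if i: "i \<le> I" for i
  proof -
    let ?p = "x \<otimes> pw (t * int i)"
    have lp: "len (pw (t * int i)) \<le> i * len a"
      using st len_pw_le[of i] by (auto simp: len_pw_neg)
    have "real (i * len a) \<le> real I * len a" using i by (simp add: mult_right_mono)
    moreover have "len ?p \<le> len x + i * len a"
      using len_mult[of x "pw (t * int i)"] lp x by simp
    then have "real (len ?p) \<le> real (len x) + real (i * len a)"
      by (metis of_nat_add of_nat_mono)
    ultimately have p: "real (len ?p) \<le> real N / 2 - 2 * len x - \<delta>"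
      using N(1) \<delta> \<kappa>_nonneg by simp
    have "gp (pw (t * int i)) \<one> (pw (t * int N)) \<le> \<kappa>"
      using st quasi_geodesic[of 0 "int i" "int N"] quasi_geodesic[of "- int N" "- int i" 0] i N(2)
        gp_sym[of \<one> "pw (- int N)" "pw (- int i)"] by auto
    then have "gp ?p x ?z \<le> \<kappa>"
      using x gp_left[of x "pw (t * int i)" \<one> "pw (t * int N)"] by simp
    moreover have "d ?p \<one> \<le> d ?p x + d x \<one>" "d x ?z \<le> d x \<one> + d \<one> ?z" "d x \<one> = len x"
      using x by (auto intro!: d_tri) (simp add: d_def)
    ultimately have "gp ?p \<one> ?z \<le> \<kappa> + len x"
      by (simp add: gp_def)
    moreover have "gp \<one> ?p ?z = d \<one> ?p - gp ?p \<one> ?z"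
      using x by (intro gp_swap) auto
    ultimately have "len ?p - (\<kappa> + len x) \<le> gp \<one> ?p ?z"
      using x by (simp add: d_one)
    then have "len ?p - (\<kappa> + len x) - \<delta> \<le> gp \<one> ?p ?y"
      using four_point[of \<one> ?p ?z ?y] x p yz \<kappa>_nonneg by simp
    moreover have "gp ?p \<one> ?y = d ?p \<one> - gp \<one> ?p ?y"
      using x by (intro gp_swap) auto
    ultimately have "gp ?p \<one> ?y \<le> c"
      using x d_sym[of ?p \<one>] by (simp add: d_one c_def)
    then show ?thesis
      using near_axis[of ?p 0 "int N" c] near_axis[of ?p "- int N" 0 c] st x
        gp_sym[of \<one> "pw (- int N)" ?p] by (auto simp: D_def)
  qed
  then obtain j where j: "\<And>i. i \<le> I \<Longrightarrow> d (x \<otimes> pw (t * int i)) (pw (j i)) \<le> D" by metis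
  \<comment> \<open>The displacement from a point of the translated ray to the nearby power. Its
    values lie in a ball with \<open>I\<close> elements, while the index takes \<open>I + 1\<close>
    values.\<close>
  define u where "u i = inv (x \<otimes> pw (t * int i)) \<otimes> pw (j i)" for i
  have "u ` {..I} \<subseteq> ?ball"
    using j x by (auto simp: u_def d_def le_nat_floor)
  then have "card (u ` {..I}) \<le> I"
    unfolding I_def by (intro card_mono finite_ball)
  then have "\<not> inj_on u {..I}"
    by (auto dest!: card_image)
  then obtain i i' where ii: "i < i'" "u i = u i'"
    unfolding inj_on_def by (metis nat_neq_iff)
  let ?p = "x \<otimes> pw (t * int i)" and ?p' = "x \<otimes> pw (t * int i')"
  have "?p' \<otimes> inv ?p = pw (j i') \<otimes> inv (pw (j i))"
  proof -
    have "inv ?p = u i \<otimes> inv (pw (j i))" "?p' \<otimes> u i' = pw (j i')"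
      using x by (simp_all add: u_def m_assoc del: int_pow_neg)
    then have "?p' \<otimes> inv ?p = ?p' \<otimes> (u i' \<otimes> inv (pw (j i)))" using ii(2) by simp
    also have "\<dots> = (?p' \<otimes> u i') \<otimes> inv (pw (j i))"
      using x by (simp add: u_def m_assoc)
    finally show ?thesis using \<open>?p' \<otimes> u i' = pw (j i')\<close> by simp
  qed
  moreover have "?p' \<otimes> inv ?p = conj x (t * int i' + - (t * int i))"
    using x by (simp only: pw_add) (simp add: inv_mult_group m_assoc int_pow_neg)
  moreover have "pw (j i') \<otimes> inv (pw (j i)) = pw (j i' + - j i)"
    by (simp only: pw_add) (simp add: int_pow_neg)
  moreover have "t * int i' + - (t * int i) \<noteq> 0"
    using ii(1) st by auto
  ultimately show ?thesis by metis
qed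

lemma virtually_cyclic_if_amenable: "amenable G \<Longrightarrow> virtually_cyclic G"
  unfolding amenable_mean using commensurates close_to_axis virtually_cyclic_if_close by metis

end

theorem (in hyp_group) amenable_imp_virtually_cyclic:
  assumes "amenable G"
  shows "virtually_cyclic G"
proof (cases "finite (carrier G)")
  case True
  let ?C = "carrier (subgroup_generated G {\<one>})"
  have "rcosets ?C \<subseteq> Pow (carrier G)"
    using rcosets_subset_PowG[OF subgroup_subgroup_generated] .
  then have "finite (rcosets ?C)" using True by (simp add: finite_subset)
  moreover have "G\<lparr>carrier := ?C\<rparr> = subgroup_generated G {\<one>}"
    by (simp add: subgroup_generated_def)
  ultimately show ?thesis
    using subgroup_subgroup_generated[of "{\<one>}"] cyclic_group_generated[of \<one>]
    unfolding virtually_cyclic_def finite_index_subgroup_def by metis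
next
  case False
  then obtain a where "loxodromic a" using exists_loxodromic by blast
  then interpret loxodromic_element G B \<pi> \<delta> a by unfold_locales
  show ?thesis using virtually_cyclic_if_amenable assms by blast
qed

section \<open>Dehn's algorithm on a stack machine\<close>

datatype 'l dstate = Win "'l list" | Back "'l list" | DAcc | DRej

context hyp_group
begin

text \<open>Some shortest word for the same element, chosen once for each word so that the finite
  control can look it up.\<close>

definition shorten :: "('b + 'b) list \<Rightarrow> ('b + 'b) list"
  where "shorten v = (SOME t. t \<in> lists X \<and> length t = len (val v) \<and> val t = val v)"

lemma shorten:
  assumes "v \<in> lists X"
  shows "shorten v \<in> lists X" "length (shorten v) = len (val v)" "val (shorten v) = val v"
proof -
  have "\<exists>t. t \<in> lists X \<and> length t = len (val v) \<and> val t = val v"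
    using len_word[OF val_closed[OF assms]] by metis
  from someI_ex[OF this] show "shorten v \<in> lists X" "length (shorten v) = len (val v)"
    "val (shorten v) = val v"
    by (auto simp: shorten_def)
qed

lemma length_shorten:
  assumes "v \<in> lists X" "\<not> geodesic v"
  shows "length (shorten v) < length v"
  using shorten[OF assms(1)] len_le[OF assms(1)] assms by (simp add: geodesic_def)

lemma val_append3:
  "u \<in> lists X \<Longrightarrow> v \<in> lists X \<Longrightarrow> w \<in> lists X \<Longrightarrow> val (u @ v @ w) = val u \<otimes> (val v \<otimes> val w)"
  by (subst val_append, assumption) (auto simp: val_append simp del: in_lists_conv_set)

lemma local_geodesic_prefix: "local_geodesic k (u @ s) \<Longrightarrow> local_geodesic k u"
  unfolding local_geodesic_def by (metis append.assoc append_in_lists_conv)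

lemma local_geodesic_Nil: "local_geodesic k []"
  by (simp add: local_geodesic_def geodesic_def)

text \<open>A subword that uses the new letter is a suffix, and if its length is at most
  \<open>k\<close> it lies inside \<open>s @ [b]\<close>.\<close>

lemma local_geodesic_snoc:
  assumes u: "local_geodesic k (u @ s)" and s: "geodesic (s @ [b])"
    and len: "k \<le> length s + 1 \<or> u = []"
  shows "local_geodesic k (u @ s @ [b])"
  unfolding local_geodesic_def
proof (intro conjI allI impI)
  show "u @ s @ [b] \<in> lists X"
    using u s by (auto simp: local_geodesic_def geodesic_def)
  fix p v z assume e: "u @ s @ [b] = p @ v @ z" and v: "length v \<le> k"
  show "geodesic v"
  proof (cases z rule: rev_cases)
    case Nil
    then have "p @ v = u @ (s @ [b])" using e by simp
    then obtain us where "p = u @ us \<and> us @ v = s @ [b] \<or> p @ us = u \<and> v = us @ s @ [b]"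
      by (auto simp: append_eq_append_conv2)
    then have "\<exists>us. us @ v = s @ [b]"
    proof
      assume "p @ us = u \<and> v = us @ s @ [b]"
      then have "us = []" using len v by (cases us) auto
      then show ?thesis using \<open>p @ us = u \<and> v = us @ s @ [b]\<close> by auto
    qed blast
    then obtain us where "s @ [b] = us @ v @ []" by (metis append_Nil2)
    then show ?thesis using s geodesic_sub by metis
  next
    case (snoc z' b')
    then have "u @ s = p @ v @ z'" using e by auto
    then show ?thesis using u v unfolding local_geodesic_def by blast
  qed
qed

end

section \<open>The machine for the word problem of a hyperbolic group\<close>

locale dehn = hyp_group G B \<pi> \<delta> for G :: "('g, 'm) monoid_scheme" (structure)
  and B :: "'b set" and \<pi> \<delta> +
  fixes K :: nat
  assumes K: "2 * \<delta> < real K"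
begin

text \<open>Together with the next letter a full window has length \<open>2 * K\<close>, the scale
  of the local geodesics.\<close>

definition win :: nat where "win = 2 * K - 1"

lemma K_pos: "0 < K" using K \<delta> by (cases K) auto

lemma win: "win + 1 = 2 * K" "0 < win" using K_pos by (auto simp: win_def)

text \<open>The word read so far has been rewritten to a local geodesic, of which the state \<open>Win s\<close>
  keeps the last letters \<open>s\<close> and the second stack the rest. A replacement for a window that
  has ceased to be geodesic goes back onto the input.\<close>

fun dtrans :: "('b + 'b) dstate \<Rightarrow> (('b + 'b) + nat) option list \<Rightarrow>
    ('b + 'b) dstate \<times> (('b + 'b) + nat) stack_op list" where
  "dtrans (Win s) tops =
    (if length s < win \<and> tops ! 1 \<noteq> None then (Win (projl (the (tops ! 1)) # s), [Keep, Pop])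
     else case tops ! 0 of
       None \<Rightarrow> (if s = [] \<and> tops ! 1 = None then DAcc else DRej, [Keep, Keep])
     | Some c \<Rightarrow>
        (if geodesic (s @ [projl c]) then
           (if length s < win then (Win (s @ [projl c]), [Pop, Keep])
            else (Win (tl s @ [projl c]), [Pop, Push (Inl (hd s))]))
         else (Back (rev (shorten (s @ [projl c]))), [Pop, Keep])))"
| "dtrans (Back (x # xs)) tops = (Back xs, [Push (Inl x), Keep])"
| "dtrans (Back []) tops = (Win [], [Keep, Keep])"
| "dtrans DAcc tops = (DAcc, [Keep, Keep])"
| "dtrans DRej tops = (DRej, [Keep, Keep])"

definition dstates :: "('b + 'b) dstate set"
  where "dstates = Win ` {s. set s \<subseteq> X \<and> length s \<le> win} \<union> Back ` {s. set s \<subseteq> X \<and> length s \<le> win}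
    \<union> {DAcc, DRej}"

lemma in_dstates [simp]:
  "Win s \<in> dstates \<longleftrightarrow> set s \<subseteq> X \<and> length s \<le> win"
  "Back s \<in> dstates \<longleftrightarrow> set s \<subseteq> X \<and> length s \<le> win"
  "DAcc \<in> dstates" "DRej \<in> dstates"
  by (auto simp: dstates_def image_iff)

sublocale sm: stack_machine X 2 dstates "Inl ` X" "Win []" DAcc DRej dtrans
proof
  show "finite dstates"
    using finite_X by (auto simp: dstates_def intro!: finite_imageI finite_lists_length_le)
qed (use finite_X in auto)

abbreviation stacks :: "('b + 'b) list \<Rightarrow> ('b + 'b) list \<Rightarrow> (('b + 'b) + nat) list list"
  where "stacks inp st \<equiv> [map Inl inp, map Inl st]"

lemma back_run:
  assumes "set t \<subseteq> X" "length t \<le> win"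
  shows "(sm.smove ^^ (length t + 1)) (Back (rev t), stacks inp st) (Win [], stacks (t @ inp) st)"
  using assms
proof (induction t arbitrary: inp rule: rev_induct)
  case Nil
  have "sm.smove (Back [], stacks inp st) (Win [], stacks inp st)"
    by (rule sm.smoveI) auto
  then show ?case by (simp add: eq_OO)
next
  case (snoc x t)
  have "sm.smove (Back (rev (t @ [x])), stacks inp st) (Back (rev t), stacks (x # inp) st)"
    by (rule sm.smoveI) (use snoc.prems in \<open>auto simp: inj_image_mem_iff\<close>)
  moreover have "(sm.smove ^^ (length t + 1)) (Back (rev t), stacks (x # inp) st)
      (Win [], stacks (t @ x # inp) st)"
    using snoc.IH[of "x # inp"] snoc.prems by (simp del: relpowp.simps)
  ultimately have "(sm.smove ^^ Suc (length t + 1)) (Back (rev (t @ [x])), stacks inp st)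
      (Win [], stacks (t @ x # inp) st)"
    by (rule relpowp_Suc_left)
  then show ?case by (simp del: relpowp.simps)
qed

text \<open>Consuming an input letter lowers it, and so does pulling a letter back from the stack. A
  shortening lowers the total number of letters and thereby releases \<open>3 * win + 2\<close>,
  enough for 2 per letter returned to the input and for the \<open>length t + 2\<close> moves that
  return them.\<close>

definition potential :: "('b + 'b) list \<Rightarrow> ('b + 'b) list \<Rightarrow> ('b + 'b) list \<Rightarrow> nat"
  where "potential s inp st =
    (3 * win + 2) * (length s + length inp + length st) + 2 * length inp + length st"

text \<open>Stack and window always form a \<open>2 * K\<close>-local geodesic, and together with
  the input they represent a fixed element. Once the input is used up,
  \<open>local_geodesic_nontrivial\<close> leaves the empty word as the only trivial case.\<close>

lemma dehn_run:
  assumes "local_geodesic (2 * K) (rev st @ s)" "inp \<in> lists X" "length s \<le> win"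
  shows "\<exists>n\<le>potential s inp st + 1. \<exists>out. (sm.smove ^^ n) (Win s, stacks inp st)
    (if val (rev st @ s @ inp) = \<one> then DAcc else DRej, out)"
  using assms
proof (induction "potential s inp st" arbitrary: s inp st rule: less_induct)
  case less
  note lg = less.prems(1) and inp = less.prems(2) and ls = less.prems(3)
  have in': "st \<in> lists X" "s \<in> lists X"
    using lg by (auto simp: local_geodesic_def)
  have step: ?case
    if m: "(sm.smove ^^ m) (Win s, stacks inp st) (Win s', stacks inp' st')"
      and p: "m + potential s' inp' st' \<le> potential s inp st" "0 < m"
      and l: "local_geodesic (2 * K) (rev st' @ s')" "inp' \<in> lists X" "length s' \<le> win"
      and v: "val (rev st' @ s' @ inp') = val (rev st @ s @ inp)" for m s' inp' st'
  proof -
    obtain n out where n: "n \<le> potential s' inp' st' + 1"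
      "(sm.smove ^^ n) (Win s', stacks inp' st') (if val (rev st' @ s' @ inp') = \<one> then DAcc else DRej, out)"
      using less.hyps[OF _ l] p by auto
    have "(sm.smove ^^ (m + n)) (Win s, stacks inp st) (if val (rev st @ s @ inp) = \<one> then DAcc else DRej, out)"
      using relpowp_trans[OF m n(2)] v by simp
    moreover have "m + n \<le> potential s inp st + 1" using n(1) p by simp
    ultimately show ?thesis by blast
  qed
  show ?case
  proof (cases "length s < win \<and> st \<noteq> []")
    case True
    then obtain b st' where st: "st = b # st'" by (cases st) auto
    have "sm.smove (Win s, stacks inp st) (Win (b # s), stacks inp st')"
      by (rule sm.smoveI) (use True st in' in auto)
    from relpowp_oneI[of sm.smove, OF this] show ?thesis
      by (rule step) (use lg inp True in \<open>auto simp: st potential_def algebra_simps\<close>)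
  next
    case pop: False
    show ?thesis
    proof (cases inp)
      case Nil
      have "rev st @ s = [] \<longleftrightarrow> val (rev st @ s) = \<one>"
        using local_geodesic_nontrivial[OF lg K] by auto
      then have acc: "s = [] \<and> st = [] \<longleftrightarrow> val (rev st @ s @ inp) = \<one>"
        using Nil by auto
      have "sm.smove (Win s, stacks inp st)
          (if s = [] \<and> st = [] then DAcc else DRej, stacks inp st)"
        by (rule sm.smoveI) (use pop in' ls Nil in \<open>cases st; auto\<close>)+
      then show ?thesis
        unfolding acc by (intro exI[of _ 1]) (auto simp: eq_OO)
    next
      case (Cons b inp')
      have b: "b \<in> X" "inp' \<in> lists X" using inp Cons by auto
      have full: "length s = win \<or> st = []" using pop ls by auto
      show ?thesis
      proof (cases "geodesic (s @ [b])")
        case geo: True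
        have l: "local_geodesic (2 * K) (rev st @ s @ [b])"
          by (rule local_geodesic_snoc[OF lg geo]) (use full win in auto)
        show ?thesis
        proof (cases "length s < win")
          case True
          then have st: "st = []" using full by auto
          have "sm.smove (Win s, stacks inp st) (Win (s @ [b]), stacks inp' st)"
            by (rule sm.smoveI) (use True st in' b geo Cons in auto)
          from relpowp_oneI[of sm.smove, OF this] show ?thesis
            by (rule step) (use l b True in \<open>auto simp: Cons potential_def algebra_simps\<close>)
        next
          case False
          then have lw: "length s = win" using ls by simp
          then obtain c s' where s: "s = c # s'" using win by (cases s) auto
          have "sm.smove (Win s, stacks inp st) (Win (s' @ [b]), stacks inp' (c # st))"
            by (rule sm.smoveI) (use False s in' b geo Cons lw in \<open>auto simp: inj_image_mem_iff\<close>)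
          from relpowp_oneI[of sm.smove, OF this] show ?thesis
            by (rule step) (use l b lw in \<open>auto simp: Cons s potential_def algebra_simps\<close>)
        qed
      next
        case ngeo: False
        let ?v = "s @ [b]"
        define t where "t = shorten ?v"
        have v: "?v \<in> lists X" using in' b by auto
        have t: "t \<in> lists X" "val t = val ?v" "length t \<le> length s"
          using shorten[OF v] length_shorten[OF v ngeo] by (auto simp: t_def)
        have "sm.smove (Win s, stacks inp st) (Back (rev t), stacks inp' st)"
          by (rule sm.smoveI) (use in' b ngeo Cons t ls pop in \<open>auto simp: t_def\<close>)
        moreover have "(sm.smove ^^ (length t + 1)) (Back (rev t), stacks inp' st) (Win [], stacks (t @ inp') st)"
          by (rule back_run) (use t ls in auto)
        ultimately have "(sm.smove ^^ Suc (length t + 1)) (Win s, stacks inp st) (Win [], stacks (t @ inp') st)"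
          by (rule relpowp_Suc_left)
        then show ?thesis
        proof (rule step)
          show "Suc (length t + 1) + potential [] (t @ inp') st \<le> potential s inp st"
          proof -
            have "potential [] (t @ inp') st + (3 * win + 2)
                \<le> (3 * win + 2) * (length s + length inp + length st) + 2 * length (t @ inp') + length st"
              using t(3) mult_le_mono2[of "length t + length inp' + length st + 1"
                  "length s + length inp + length st" "3 * win + 2"]
              by (simp add: potential_def Cons algebra_simps)
            then show ?thesis
              using t(3) ls by (simp add: potential_def Cons)
          qed
          have rst: "rev st \<in> lists X" using in' by auto
          have "val (rev st @ t @ inp') = val (rev st) \<otimes> (val t \<otimes> val inp')"
            by (rule val_append3[OF rst t(1) b(2)])
          also have "\<dots> = val (rev st @ ?v @ inp')"
            unfolding t(2) by (rule val_append3[OF rst v b(2), symmetric])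
          finally show "val (rev st @ [] @ t @ inp') = val (rev st @ s @ inp)"
            using Cons by simp
        qed (use lg local_geodesic_prefix t b in auto)
      qed
    qed
  qed
qed

end

theorem (in hyp_group) linear_time_decider:
  "\<exists>M c. decides M X (WP G B \<pi>) \<and> (\<forall>w\<in>lists X. tm_time M w \<le> c * (length w + 1))"
proof -
  obtain K :: nat where K: "2 * \<delta> < real K" using reals_Archimedean2 by blast
  interpret dehn G B \<pi> \<delta> K by unfold_locales (rule K)
  define c where "c = 2 * (3 * win + 5)"
  have "\<exists>M. decides M X (WP G B \<pi>) \<and>
    (\<forall>w\<in>lists X. tm_time M w \<le> 2 * ((3 * win + 5) * (length w + 1)))"
  proof (rule sm.stack_realisable)
    fix w assume w: "w \<in> lists X"
    obtain n out where n: "n \<le> potential [] w [] + 1"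
      "(sm.smove ^^ n) (Win [], stacks w []) (if val w = \<one> then DAcc else DRej, out)"
      using dehn_run[of "[]" "[]" w] w local_geodesic_Nil by auto
    have "n \<le> (3 * win + 5) * (length w + 1)"
      using n(1) by (simp add: potential_def algebra_simps)
    moreover have st: "map Inl w # replicate (2 - 1) [] = stacks w []" by simp
    moreover have wp: "w \<in> WP G B \<pi> \<longleftrightarrow> val w = \<one>" using w by (simp add: WP_def)
    ultimately show "\<exists>n\<le>(3 * win + 5) * (length w + 1). \<exists>st.
        (sm.smove ^^ n) (Win [], map Inl w # replicate (2 - 1) []) (if w \<in> WP G B \<pi> then DAcc else DRej, st)"
      using n(2) unfolding st wp by blast
  qed
  then show ?thesis unfolding mult.assoc[symmetric] by blast
qed

section \<open>Multiplication in an automatic group on a stack machine\<close>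

lemma pad_pair_simps [simp]:
  "pad_pair [] [] = []"
  "pad_pair (a # u) (b # v) = (Some a, Some b) # pad_pair u v"
  "pad_pair (a # u) [] = (Some a, None) # pad_pair u []"
  "pad_pair [] (b # v) = (None, Some b) # pad_pair [] v"
  by (simp_all add: pad_pair_def map_upt_Suc del: upt_Suc)

definition left_word :: "('l option \<times> 'l option) list \<Rightarrow> 'l list"
  where "left_word z = List.map_filter fst z"

definition right_word :: "('l option \<times> 'l option) list \<Rightarrow> 'l list"
  where "right_word z = List.map_filter snd z"

lemma map_filter_append: "List.map_filter f (xs @ ys) = List.map_filter f xs @ List.map_filter f ys"
  by (simp add: List.map_filter_def)

lemma words_pad_pair [simp]: "left_word (pad_pair u v) = u" "right_word (pad_pair u v) = v"
  by (induction u v rule: list_induct2')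
    (auto simp: left_word_def right_word_def map_filter_simps intro: list.induct)

abbreviation some_words :: "'l list \<Rightarrow> 'l option list \<Rightarrow> ('l option \<times> 'l option) list"
  where "some_words u yos \<equiv> zip (map Some u) yos"

abbreviation tail_word :: "'l list \<Rightarrow> ('l option \<times> 'l option) list"
  where "tail_word ys \<equiv> map (\<lambda>y. (None, Some y)) ys"

lemma left_word_run: "length yos = length u \<Longrightarrow> left_word (some_words u yos @ tail_word ys) = u"
proof (induction u yos rule: list_induct2')
  case 1
  show ?case by (induction ys) (auto simp: left_word_def map_filter_simps)
qed (auto simp: left_word_def map_filter_simps)

lemma right_word_run: "length yos = length u \<Longrightarrow>
    right_word (some_words u yos @ tail_word ys) = List.map_filter id yos @ ys"
proof (induction u yos rule: list_induct2')
  case 1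
  show ?case by (induction ys) (auto simp: right_word_def map_filter_simps)
qed (auto simp: right_word_def map_filter_simps split: option.splits)

text \<open>Separates the part of the padded pair that a sweep over \<open>u\<close> can see from
  the overhang of \<open>v\<close>, which has to be supplied from the finite control.\<close>

lemma pad_pair_run:
  "\<exists>yos. length yos = length u \<and> set yos \<subseteq> insert None (Some ` set v) \<and>
     pad_pair u v = some_words u yos @ tail_word (drop (length u) v)"
proof (induction u v rule: list_induct2')
  case (2 x xs)
  have "pad_pair xs [] = some_words xs (replicate (length xs) None)" for xs :: "'a list"
    by (induction xs) auto
  then show ?case by (intro exI[of _ "replicate (length (x # xs)) None"]) auto
next
  case (3 y ys)
  have "pad_pair [] ys = tail_word ys" for ys :: "'a list"
    by (induction ys) auto
  then show ?case by simp
next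
  case (4 x xs y ys)
  then obtain yos where "length yos = length xs" "set yos \<subseteq> insert None (Some ` set ys)"
    "pad_pair xs ys = some_words xs yos @ tail_word (drop (length xs) ys)" by blast
  then show ?case by (intro exI[of _ "Some y # yos"]) auto
qed simp

section \<open>The machine for the word problem of an automatic group\<close>

datatype 'l astate = Ini "'l list" | Rdy | Fwd 'l "nat set" | Tl 'l nat "'l list" | Bk 'l nat
  | Chk nat "'l list" | AAcc | ARej

locale automatic = fg_group G B \<pi> for G :: "('g, 'm) monoid_scheme" (structure)
  and B :: "'b::countable set" and \<pi> +
  fixes W :: "('b + 'b) list set" and Q :: "('b + 'b) list \<Rightarrow> nat set"
    and q0 :: "('b + 'b) list \<Rightarrow> nat" and F :: "('b + 'b) list \<Rightarrow> nat set"
    and \<delta> :: "('b + 'b) list \<Rightarrow> nat \<Rightarrow> ('b + 'b) option \<times> ('b + 'b) option \<Rightarrow> nat"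
  assumes W: "W \<subseteq> lists X" "val ` W = carrier G"
    and Q: "\<And>s. s \<in> insert [] ((\<lambda>x. [x]) ` X) \<Longrightarrow> finite (Q s) \<and> q0 s \<in> Q s"
    and \<delta>: "\<And>s q z. s \<in> insert [] ((\<lambda>x. [x]) ` X) \<Longrightarrow> q \<in> Q s \<Longrightarrow>
      z \<in> padded_letters X \<Longrightarrow> \<delta> s q z \<in> Q s"
    and L: "\<And>s. s \<in> insert [] ((\<lambda>x. [x]) ` X) \<Longrightarrow>
      {pad_pair u v | u v. u \<in> W \<and> v \<in> W \<and> val (u @ s) = val v}
        = {z \<in> lists (padded_letters X). foldl (\<delta> s) (q0 s) z \<in> F s}"
begin

abbreviation "Xo \<equiv> insert None (Some ` X)"

text \<open>The subset construction for the multiplier automaton with a guessed second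
  track.\<close>

definition succ :: "'b + 'b \<Rightarrow> nat set \<Rightarrow> 'b + 'b \<Rightarrow> nat set"
  where "succ x S c = {\<delta> [x] q (Some c, yo) | q yo. q \<in> S \<and> yo \<in> Xo}"

abbreviation reach :: "'b + 'b \<Rightarrow> nat set \<Rightarrow> ('b + 'b) list \<Rightarrow> nat set"
  where "reach x S cs \<equiv> foldl (succ x) S cs"

definition tail_ok :: "'b + 'b \<Rightarrow> nat \<Rightarrow> ('b + 'b) list \<Rightarrow> bool"
  where "tail_ok x q ys \<longleftrightarrow> ys \<in> lists X \<and> foldl (\<delta> [x]) q (tail_word ys) \<in> F [x]"

text \<open>One overhang is fixed for each letter and state; as these are finitely many, the lengths
  are bounded by \<open>tl_bound\<close>.\<close>

definition tail :: "'b + 'b \<Rightarrow> nat \<Rightarrow> ('b + 'b) list"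
  where "tail x q = (SOME ys. tail_ok x q ys)"

definition tail_state :: "'b + 'b \<Rightarrow> nat set \<Rightarrow> nat"
  where "tail_state x S = (SOME q. q \<in> S \<and> (\<exists>ys. tail_ok x q ys))"

text \<open>Auxiliary stack symbols are numbers, so a letter and a set of states are packed into
  one. The sorted list turns a finite set into countable data.\<close>

definition code :: "'b + 'b \<Rightarrow> nat set \<Rightarrow> nat"
  where "code c S = to_nat (c, sorted_list_of_set S)"

definition decode :: "nat \<Rightarrow> ('b + 'b) \<times> nat set"
  where "decode n = (let (c, l) = from_nat n in (c, set l))"

lemma decode_code [simp]: "finite S \<Longrightarrow> decode (code c S) = (c, S)"
  by (simp add: decode_def code_def)

text \<open>One step of the subset construction read backwards: some predecessor in the recorded
  set, with the guess that leads to \<open>q\<close>.\<close>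

definition pull :: "'b + 'b \<Rightarrow> nat \<Rightarrow> ('b + 'b) \<times> nat set \<Rightarrow> nat \<times> ('b + 'b) option"
  where "pull x q = (\<lambda>(c, S). SOME (q', yo). q' \<in> S \<and> yo \<in> Xo \<and> \<delta> [x] q' (Some c, yo) = q)"

lemma pull:
  assumes "q \<in> succ x S c" "pull x q (c, S) = (q', yo)"
  shows "q' \<in> S \<and> yo \<in> Xo \<and> \<delta> [x] q' (Some c, yo) = q"
proof -
  let ?P = "\<lambda>p. case p of (q', yo) \<Rightarrow> q' \<in> S \<and> yo \<in> Xo \<and> \<delta> [x] q' (Some c, yo) = q"
  have "\<exists>p. ?P p" using assms(1) by (auto simp: succ_def)
  then have "?P (Eps ?P)" by (rule someI_ex)
  then show ?thesis using assms(2) by (simp add: pull_def)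
qed

definition u0 :: "('b + 'b) list" where "u0 = (SOME u. u \<in> W \<and> val u = \<one>)"

lemma u0: "u0 \<in> W" "val u0 = \<one>"
proof -
  have "\<exists>u. u \<in> W \<and> val u = \<one>" using W(2) by (metis image_iff one_closed)
  from someI_ex[OF this] show "u0 \<in> W" "val u0 = \<one>" by (simp_all add: u0_def)
qed

text \<open>Stacks: the input, and the parts of the current normal form on the left and on the right of
  a sweep. The sweep to the right records the possible states of the multiplier automaton, the
  sweep to the left picks an accepting run and replaces the normal form by its other track.\<close>

fun atrans :: "('b + 'b) astate \<Rightarrow> (('b + 'b) + nat) option list \<Rightarrow>
    ('b + 'b) astate \<times> (('b + 'b) + nat) stack_op list" where
  "atrans (Ini (y # ys)) tops = (Ini ys, [Keep, Keep, Push (Inl y)])"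
| "atrans (Ini []) tops = (Rdy, [Keep, Keep, Keep])"
| "atrans Rdy tops = (case tops ! 0 of
      None \<Rightarrow> (Chk (q0 []) u0, [Keep, Keep, Keep])
    | Some c \<Rightarrow> (Fwd (projl c) {q0 [projl c]}, [Pop, Keep, Keep]))"
| "atrans (Fwd x S) tops = (case tops ! 2 of
      None \<Rightarrow> (let q = tail_state x S in (Tl x q (rev (tail x q)), [Keep, Keep, Keep]))
    | Some c \<Rightarrow> (Fwd x (succ x S (projl c)), [Keep, Push (Inr (code (projl c) S)), Pop]))"
| "atrans (Tl x q (y # ys)) tops = (Tl x q ys, [Keep, Keep, Push (Inl y)])"
| "atrans (Tl x q []) tops = (Bk x q, [Keep, Keep, Keep])"
| "atrans (Bk x q) tops = (case tops ! 1 of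
      None \<Rightarrow> (Rdy, [Keep, Keep, Keep])
    | Some n \<Rightarrow> (let (q', yo) = pull x q (decode (projr n))
        in (Bk x q', [Keep, Pop, case yo of None \<Rightarrow> Keep | Some y \<Rightarrow> Push (Inl y)])))"
| "atrans (Chk q us) tops = (case tops ! 2 of
      None \<Rightarrow> (if foldl (\<delta> []) q (pad_pair us []) \<in> F [] then AAcc else ARej, [Keep, Keep, Keep])
    | Some c \<Rightarrow> (Chk (\<delta> [] q (top_of us, Some (projl c))) (tl us), [Keep, Keep, Pop]))"
| "atrans AAcc tops = (AAcc, [Keep, Keep, Keep])"
| "atrans ARej tops = (ARej, [Keep, Keep, Keep])"

definition tl_bound :: nat
  where "tl_bound = Max (insert 0 ((\<lambda>(x, q). length (tail x q)) ` (SIGMA x:X. Q [x])))"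

definition astates :: "('b + 'b) astate set"
  where "astates = {Rdy, AAcc, ARej} \<union> Ini ` {ys. set ys \<subseteq> X \<and> length ys \<le> length u0} \<union> (\<lambda>(x, S). Fwd x S) ` (SIGMA x:X. Pow (Q [x]))
    \<union> (\<lambda>(x, q, ys). Tl x q ys) ` (SIGMA x:X. Q [x] \<times> {ys. set ys \<subseteq> X \<and> length ys \<le> tl_bound})
    \<union> (\<lambda>(x, q). Bk x q) ` (SIGMA x:X. Q [x])
    \<union> (\<lambda>(q, us). Chk q us) ` (Q [] \<times> {us. set us \<subseteq> X \<and> length us \<le> length u0})"

lemma in_astates [simp]:
  "Rdy \<in> astates" "AAcc \<in> astates" "ARej \<in> astates"
  "Ini ys \<in> astates \<longleftrightarrow> set ys \<subseteq> X \<and> length ys \<le> length u0"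
  "Fwd x S \<in> astates \<longleftrightarrow> x \<in> X \<and> S \<subseteq> Q [x]"
  "Tl x q ys \<in> astates \<longleftrightarrow> x \<in> X \<and> q \<in> Q [x] \<and> set ys \<subseteq> X \<and> length ys \<le> tl_bound"
  "Bk x q \<in> astates \<longleftrightarrow> x \<in> X \<and> q \<in> Q [x]"
  "Chk q us \<in> astates \<longleftrightarrow> q \<in> Q [] \<and> set us \<subseteq> X \<and> length us \<le> length u0"
  by (auto simp: astates_def image_iff)

definition asymbols :: "(('b + 'b) + nat) set"
  where "asymbols = Inl ` X \<union> Inr ` (\<Union>x\<in>X. \<Union>c\<in>X. code c ` Pow (Q [x]))"

lemma in_asymbols:
  "Inl c \<in> asymbols \<longleftrightarrow> c \<in> X"
  "x \<in> X \<Longrightarrow> c \<in> X \<Longrightarrow> S \<subseteq> Q [x] \<Longrightarrow> Inr (code c S) \<in> asymbols"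
proof -
  show "Inl c \<in> asymbols \<longleftrightarrow> c \<in> X" by (auto simp: asymbols_def)
  show "x \<in> X \<Longrightarrow> c \<in> X \<Longrightarrow> S \<subseteq> Q [x] \<Longrightarrow> Inr (code c S) \<in> asymbols"
    unfolding asymbols_def by blast
qed

declare in_asymbols(1) [simp]

lemma finite_Q: "x \<in> X \<Longrightarrow> finite (Q [x])" "finite (Q [])"
  using Q by auto

lemma q0_in: "x \<in> X \<Longrightarrow> q0 [x] \<in> Q [x]" "q0 [] \<in> Q []"
  using Q by auto

lemma padded: "c \<in> X \<Longrightarrow> yo \<in> Xo \<Longrightarrow> (Some c, yo) \<in> padded_letters X"
  "c \<in> X \<Longrightarrow> yo \<in> Xo \<Longrightarrow> (yo, Some c) \<in> padded_letters X"
  by (auto simp: padded_letters_def)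

lemma some_words_padded:
  assumes "set u \<subseteq> X" "set yos \<subseteq> Xo"
  shows "set (some_words u yos) \<subseteq> padded_letters X"
proof
  fix t assume t: "t \<in> set (some_words u yos)"
  then have "fst t \<in> set (map Some u)" "snd t \<in> set yos"
    using set_zip_leftD[of "fst t" "snd t" "map Some u" yos]
      set_zip_rightD[of "fst t" "snd t" "map Some u" yos] by simp_all
  moreover from this obtain c where "c \<in> set u" "fst t = Some c" by auto
  ultimately have "c \<in> X" "fst t = Some c" "snd t \<in> Xo"
    using assms by blast+
  then show "t \<in> padded_letters X"
    using padded(1)[of c "snd t"] by (metis prod.collapse)
qed

lemma succ_sub: "x \<in> X \<Longrightarrow> c \<in> X \<Longrightarrow> S \<subseteq> Q [x] \<Longrightarrow> succ x S c \<subseteq> Q [x]"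
proof
  fix p assume x: "x \<in> X" and c: "c \<in> X" and S: "S \<subseteq> Q [x]" and "p \<in> succ x S c"
  then obtain q yo where q: "q \<in> S" "yo \<in> Xo" "p = \<delta> [x] q (Some c, yo)"
    unfolding succ_def by blast
  have "[x] \<in> insert [] ((\<lambda>x. [x]) ` X)" using x by (rule insertI2[OF imageI])
  then show "p \<in> Q [x]" unfolding q(3) using q(1) S by (intro \<delta> padded(1)[OF c q(2)]) blast+
qed

lemma reach_sub: "x \<in> X \<Longrightarrow> cs \<in> lists X \<Longrightarrow> S \<subseteq> Q [x] \<Longrightarrow> reach x S cs \<subseteq> Q [x]"
  by (induction cs arbitrary: S) (auto simp: succ_sub)

lemma length_tail: "x \<in> X \<Longrightarrow> q \<in> Q [x] \<Longrightarrow> length (tail x q) \<le> tl_bound"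
  unfolding tl_bound_def by (rule Max_ge) (use finite_X finite_Q in \<open>auto intro!: finite_SigmaI\<close>)

sublocale sm: stack_machine X 3 astates asymbols "Ini (rev u0)" AAcc ARej atrans
proof
  show "finite astates"
    unfolding astates_def
    using finite_X finite_Q
    by (intro finite_UnI finite_imageI finite_SigmaI finite_lists_length_le) auto
  show "finite asymbols"
    unfolding asymbols_def using finite_X finite_Q by (auto intro!: finite_imageI)
qed (use finite_X u0(1) W(1) in auto)

lemma reach_run:
  assumes "length yos = length cs" "set yos \<subseteq> Xo" "q \<in> S"
  shows "foldl (\<delta> [x]) q (some_words cs yos) \<in> reach x S cs"
  using assms
proof (induction cs yos arbitrary: q S rule: list_induct2')
  case (4 c cs yo yos)
  then have "\<delta> [x] q (Some c, yo) \<in> succ x S c" by (auto simp: succ_def)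
  then show ?case using 4 by simp
qed auto

text \<open>The marks left by the sweep to the right: each letter with the set of states reachable
  before it is read.\<close>

primrec trail :: "'b + 'b \<Rightarrow> nat set \<Rightarrow> ('b + 'b) list \<Rightarrow> (('b + 'b) + nat) list" where
  "trail x S [] = []"
| "trail x S (c # cs) = Inr (code c S) # trail x (succ x S c) cs"

lemma trail_snoc: "trail x S (cs @ [c]) = trail x S cs @ [Inr (code c (reach x S cs))]"
  by (induction cs arbitrary: S) auto

lemma forward:
  assumes "x \<in> X" "S \<subseteq> Q [x]" "cs \<in> lists X"
  shows "(sm.smove ^^ length cs) (Fwd x S, [inp, lf, map Inl cs])
    (Fwd x (reach x S cs), [inp, rev (trail x S cs) @ lf, []])"
  using assms
proof (induction cs arbitrary: S lf)
  case (Cons c cs)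
  then have c: "c \<in> X" "cs \<in> lists X" by auto
  note sym = in_asymbols(2)[OF Cons.prems(1) c(1) Cons.prems(2)]
  have "sm.smove (Fwd x S, [inp, lf, map Inl (c # cs)])
      (Fwd x (succ x S c), [inp, Inr (code c S) # lf, map Inl cs])"
    by (rule sm.smoveI) (use Cons.prems c succ_sub sym in auto)
  moreover have "(sm.smove ^^ length cs) (Fwd x (succ x S c), [inp, Inr (code c S) # lf, map Inl cs])
      (Fwd x (reach x (succ x S c) cs), [inp, rev (trail x (succ x S c) cs) @ Inr (code c S) # lf, []])"
    by (rule Cons.IH) (use Cons.prems c succ_sub in auto)
  ultimately have "(sm.smove ^^ Suc (length cs)) (Fwd x S, [inp, lf, map Inl (c # cs)])
      (Fwd x (reach x (succ x S c) cs), [inp, rev (trail x (succ x S c) cs) @ Inr (code c S) # lf, []])"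
    by (rule relpowp_Suc_left)
  then show ?case by (simp del: relpowp.simps)
qed simp

lemma tail_write:
  assumes "x \<in> X" "q \<in> Q [x]" "set ys \<subseteq> X" "length ys \<le> tl_bound"
  shows "(sm.smove ^^ (length ys + 1)) (Tl x q (rev ys), [inp, lf, r]) (Bk x q, [inp, lf, map Inl ys @ r])"
  using assms(3,4)
proof (induction ys arbitrary: r rule: rev_induct)
  case Nil
  have "sm.smove (Tl x q [], [inp, lf, r]) (Bk x q, [inp, lf, r])"
    by (rule sm.smoveI) (use assms in auto)
  then show ?case by (simp add: eq_OO)
next
  case (snoc y ys)
  have "sm.smove (Tl x q (rev (ys @ [y])), [inp, lf, r]) (Tl x q (rev ys), [inp, lf, Inl y # r])"
    by (rule sm.smoveI) (use assms snoc.prems in auto)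
  moreover have "(sm.smove ^^ (length ys + 1)) (Tl x q (rev ys), [inp, lf, Inl y # r])
      (Bk x q, [inp, lf, map Inl ys @ Inl y # r])"
    by (rule snoc.IH) (use snoc.prems in auto)
  ultimately have "(sm.smove ^^ Suc (length ys + 1)) (Tl x q (rev (ys @ [y])), [inp, lf, r])
      (Bk x q, [inp, lf, map Inl ys @ Inl y # r])"
    by (rule relpowp_Suc_left)
  then show ?case by (simp del: relpowp.simps)
qed

text \<open>Popping the trail builds a run of the multiplier automaton from its end; the guesses of
  this run are the letters that get pushed.\<close>

lemma backward:
  assumes x: "x \<in> X" and S: "S \<subseteq> Q [x]" and cs: "cs \<in> lists X" and q: "q \<in> reach x S cs"
  shows "\<exists>p\<in>S. \<exists>yos. length yos = length cs \<and> set yos \<subseteq> Xo \<and>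
    foldl (\<delta> [x]) p (some_words cs yos) = q \<and>
    (sm.smove ^^ length cs) (Bk x q, [inp, rev (trail x S cs), r])
      (Bk x p, [inp, [], map Inl (List.map_filter id yos) @ r])"
  using cs q
proof (induction cs arbitrary: q r rule: rev_induct)
  case Nil
  then show ?case by (auto simp: map_filter_simps)
next
  case (snoc c cs)
  then have c: "c \<in> X" "cs \<in> lists X" by auto
  let ?S = "reach x S cs"
  have S': "?S \<subseteq> Q [x]" using reach_sub[OF x c(2) S] .
  obtain q' yo where b: "pull x q (c, ?S) = (q', yo)" by force
  have q': "q' \<in> ?S" "yo \<in> Xo" "\<delta> [x] q' (Some c, yo) = q"
    using pull[OF _ b] snoc.prems(2) by auto
  have qQ: "q \<in> Q [x]" using reach_sub[OF x snoc.prems(1) S] snoc.prems(2) by blast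
  let ?r = "(case yo of None \<Rightarrow> r | Some y \<Rightarrow> Inl y # r)"
  have fin: "finite ?S" using S' finite_Q(1)[OF x] finite_subset by blast
  have mv: "sm.smove (Bk x q, [inp, rev (trail x S (cs @ [c])), r]) (Bk x q', [inp, rev (trail x S cs), ?r])"
    by (rule sm.smoveI)
      (use x qQ q' S' b fin in \<open>auto simp: trail_snoc split: option.splits\<close>)
  obtain p yos where p: "p \<in> S" "length yos = length cs" "set yos \<subseteq> Xo"
    "foldl (\<delta> [x]) p (some_words cs yos) = q'"
    "(sm.smove ^^ length cs) (Bk x q', [inp, rev (trail x S cs), ?r])
      (Bk x p, [inp, [], map Inl (List.map_filter id yos) @ ?r])"
    using snoc.IH[OF c(2) q'(1), of ?r] by blast
  have "map Inl (List.map_filter id yos) @ ?r = map Inl (List.map_filter id (yos @ [yo])) @ r"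
    by (auto simp: map_filter_append map_filter_simps split: option.splits)
  then have run: "(sm.smove ^^ length (cs @ [c])) (Bk x q, [inp, rev (trail x S (cs @ [c])), r])
      (Bk x p, [inp, [], map Inl (List.map_filter id (yos @ [yo])) @ r])"
    using relpowp_Suc_left[of sm.smove, OF mv p(5)] by (simp del: relpowp.simps)
  show ?case
  proof (intro bexI exI conjI)
    show "length (yos @ [yo]) = length (cs @ [c])" "set (yos @ [yo]) \<subseteq> Xo"
      "foldl (\<delta> [x]) p (some_words (cs @ [c]) (yos @ [yo])) = q"
      using p(2-4) q' by auto
  qed (rule run p(1))+
qed

lemma write_initial:
  assumes "set ys \<subseteq> X" "length ys \<le> length u0"
  shows "(sm.smove ^^ (length ys + 1)) (Ini (rev ys), [inp, lf, r]) (Rdy, [inp, lf, map Inl ys @ r])"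
  using assms
proof (induction ys arbitrary: r rule: rev_induct)
  case Nil
  have "sm.smove (Ini [], [inp, lf, r]) (Rdy, [inp, lf, r])"
    by (rule sm.smoveI) auto
  then show ?case by (simp add: eq_OO)
next
  case (snoc y ys)
  have "sm.smove (Ini (rev (ys @ [y])), [inp, lf, r]) (Ini (rev ys), [inp, lf, Inl y # r])"
    by (rule sm.smoveI) (use snoc.prems in auto)
  moreover have "(sm.smove ^^ (length ys + 1)) (Ini (rev ys), [inp, lf, Inl y # r])
      (Rdy, [inp, lf, map Inl ys @ Inl y # r])"
    by (rule snoc.IH) (use snoc.prems in auto)
  ultimately have "(sm.smove ^^ Suc (length ys + 1)) (Ini (rev (ys @ [y])), [inp, lf, r])
      (Rdy, [inp, lf, map Inl ys @ Inl y # r])"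
    by (rule relpowp_Suc_left)
  then show ?case by (simp del: relpowp.simps)
qed

text \<open>Since \<open>W\<close> represents every group element, some run is accepting, so a tail
  state exists. Whichever run the machine picks, its label is accepted and is therefore the padding
  of a pair from \<open>W\<close>; its first word is \<open>u\<close>, so its second word is a
  normal form of the product.\<close>

lemma multiply:
  assumes x: "x \<in> X" and u: "u \<in> W"
  shows "\<exists>v\<in>W. \<exists>n\<le>2 * length u + tl_bound + 4. val v = val u \<otimes> letter_val G \<pi> x \<and>
    length v \<le> length u + tl_bound \<and>
    (sm.smove ^^ n) (Rdy, [Inl x # inp, [], map Inl u]) (Rdy, [inp, [], map Inl v])"
proof -
  have s: "[x] \<in> insert [] ((\<lambda>x. [x]) ` X)" using x by auto
  have uX: "u \<in> lists X" using u W(1) by blast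
  have vx: "val (w @ [x]) = val w \<otimes> letter_val G \<pi> x" if "w \<in> lists X" for w
    using that x by (subst val_append) auto
  define S where "S = reach x {q0 [x]} u"
  have q0: "{q0 [x]} \<subseteq> Q [x]" using q0_in x by auto
  have SQ: "S \<subseteq> Q [x]" unfolding S_def by (rule reach_sub[OF x uX q0])
  have "\<exists>q. q \<in> S \<and> (\<exists>ys. tail_ok x q ys)"
  proof -
    have "val (u @ [x]) \<in> val ` W" using uX x W(2) by (simp add: vx del: in_lists_conv_set)
    then obtain v where v: "v \<in> W" "val (u @ [x]) = val v" by auto
    then have acc: "pad_pair u v \<in> lists (padded_letters X)"
      "foldl (\<delta> [x]) (q0 [x]) (pad_pair u v) \<in> F [x]"
      using L[OF s] u by blast+
    obtain yos where yos: "length yos = length u" "set yos \<subseteq> insert None (Some ` set v)"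
      "pad_pair u v = some_words u yos @ tail_word (drop (length u) v)"
      using pad_pair_run[of u v] by blast
    have vX: "v \<in> lists X" using v W(1) by blast
    then have "set yos \<subseteq> Xo" using yos(2) by auto
    then have "foldl (\<delta> [x]) (q0 [x]) (some_words u yos) \<in> S"
      unfolding S_def using yos by (intro reach_run) auto
    moreover have "drop (length u) v \<in> lists X" using vX by (auto dest: in_set_dropD)
    ultimately show ?thesis
      using acc(2) yos(3) by (auto simp: tail_ok_def)
  qed
  then have ts: "tail_state x S \<in> S \<and> (\<exists>ys. tail_ok x (tail_state x S) ys)"
    unfolding tail_state_def by (rule someI_ex)
  define q where "q = tail_state x S"
  define ys where "ys = tail x q"
  have q: "q \<in> S" "q \<in> Q [x]" using ts SQ by (auto simp: q_def)
  have ys: "tail_ok x q ys" unfolding ys_def tail_def using ts by (auto simp: q_def intro: someI_ex)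
  then have ysX: "set ys \<subseteq> X" by (auto simp: tail_ok_def)
  have lys: "length ys \<le> tl_bound" unfolding ys_def by (rule length_tail[OF x q(2)])
  obtain p yos where p: "p \<in> {q0 [x]}" "length yos = length u" "set yos \<subseteq> Xo"
    "foldl (\<delta> [x]) p (some_words u yos) = q"
    "(sm.smove ^^ length u) (Bk x q, [inp, rev (trail x {q0 [x]} u), map Inl ys])
      (Bk x p, [inp, [], map Inl (List.map_filter id yos) @ map Inl ys])"
    using backward[OF x q0 uX, of q inp "map Inl ys"] q(1) unfolding S_def by blast
  define z where "z = some_words u yos @ tail_word ys"
  define v where "v = List.map_filter id yos @ ys"
  have "foldl (\<delta> [x]) (q0 [x]) z \<in> F [x]"
    using p(1,4) ys by (simp add: z_def tail_ok_def)
  moreover have "z \<in> lists (padded_letters X)"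
  proof -
    have "t \<in> padded_letters X" if t: "t \<in> set (some_words u yos)" for t
      using some_words_padded[of u yos] t p(3) uX by auto
    moreover have "t \<in> padded_letters X" if t: "t \<in> set (tail_word ys)" for t
      using t ysX padded(2)[of _ None] by auto
    ultimately show ?thesis by (auto simp: z_def simp del: set_zip)
  qed
  ultimately obtain u' v' where uv: "z = pad_pair u' v'" "u' \<in> W" "v' \<in> W" "val (u' @ [x]) = val v'"
    using L[OF s] by blast
  have "u' = u" using left_word_run[OF p(2), of ys] uv(1) by (metis words_pad_pair(1) z_def)
  moreover have v': "v' = v"
    using right_word_run[OF p(2), of ys] uv(1) by (metis words_pad_pair(2) z_def v_def)
  ultimately have val: "val v = val u \<otimes> letter_val G \<pi> x" "v \<in> W"
    using uv vx[OF uX] by auto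
  have "length (List.map_filter id yos) \<le> length yos"
    by (simp add: List.map_filter_def)
  then have lv: "length v \<le> length u + tl_bound" using lys p(2) by (simp add: v_def)
  have "sm.smove (Rdy, [Inl x # inp, [], map Inl u]) (Fwd x {q0 [x]}, [inp, [], map Inl u])"
    by (rule sm.smoveI) (use x q0 in auto)
  note m1 = relpowp_oneI[of sm.smove, OF this]
  have m2: "(sm.smove ^^ length u) (Fwd x {q0 [x]}, [inp, [], map Inl u])
    (Fwd x S, [inp, rev (trail x {q0 [x]} u), []])"
    using forward[OF x q0 uX, of inp "[]"] by (simp add: S_def)
  have "sm.smove (Fwd x S, [inp, rev (trail x {q0 [x]} u), []]) (Tl x q (rev ys), [inp, rev (trail x {q0 [x]} u), []])"
    by (rule sm.smoveI) (use x SQ q ysX lys in \<open>auto simp: q_def ys_def Let_def\<close>)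
  note m3 = relpowp_oneI[of sm.smove, OF this]
  have m4: "(sm.smove ^^ (length ys + 1)) (Tl x q (rev ys), [inp, rev (trail x {q0 [x]} u), []])
      (Bk x q, [inp, rev (trail x {q0 [x]} u), map Inl ys])"
    using tail_write[OF x q(2) ysX lys, of inp _ "[]"] by simp
  have "sm.smove (Bk x p, [inp, [], map Inl v]) (Rdy, [inp, [], map Inl v])"
    by (rule sm.smoveI) (use x p q0 in auto)
  note m6 = relpowp_oneI[of sm.smove, OF this]
  have m5: "(sm.smove ^^ length u) (Bk x q, [inp, rev (trail x {q0 [x]} u), map Inl ys]) (Bk x p, [inp, [], map Inl v])"
    using p(5) by (simp add: v_def)
  have "(sm.smove ^^ (1 + length u + 1 + (length ys + 1) + length u + 1))
      (Rdy, [Inl x # inp, [], map Inl u]) (Rdy, [inp, [], map Inl v])"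
    by (rule relpowp_trans[OF relpowp_trans[OF relpowp_trans[OF relpowp_trans[OF relpowp_trans[OF m1 m2] m3] m4] m5] m6])
  moreover have "1 + length u + 1 + (length ys + 1) + length u + 1 \<le> 2 * length u + tl_bound + 4"
    using lys by simp
  ultimately show ?thesis using val lv by blast
qed

text \<open>Each multiplication lengthens the normal form by at most \<open>tl_bound\<close>, so a
  sweep takes time linear in \<open>length u + length w\<close> and the total is quadratic.\<close>

lemma multiply_word:
  assumes "w \<in> lists X" "u \<in> W"
  shows "\<exists>v\<in>W. \<exists>n\<le>length w * (2 * (length u + length w * tl_bound) + tl_bound + 4).
    val v = val u \<otimes> val w \<and> length v \<le> length u + length w * tl_bound \<and>
    (sm.smove ^^ n) (Rdy, [map Inl w, [], map Inl u]) (Rdy, [[], [], map Inl v])"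
  using assms
proof (induction w arbitrary: u rule: list.induct)
  case Nil
  then have "val u \<in> carrier G" using W(1) val_closed by blast
  then show ?case using Nil by (intro bexI[of _ u] exI[of _ 0]) auto
next
  case (Cons x w)
  then have x: "x \<in> X" "w \<in> lists X" by auto
  obtain v m where v: "v \<in> W" "m \<le> 2 * length u + tl_bound + 4" "val v = val u \<otimes> letter_val G \<pi> x"
    "length v \<le> length u + tl_bound"
    "(sm.smove ^^ m) (Rdy, [Inl x # map Inl w, [], map Inl u]) (Rdy, [map Inl w, [], map Inl v])"
    using multiply[OF x(1) Cons.prems(2)] by blast
  let ?L = "length u + (length w + 1) * tl_bound"
  obtain v' n where v': "v' \<in> W" "n \<le> length w * (2 * (length v + length w * tl_bound) + tl_bound + 4)"
    "val v' = val v \<otimes> val w" "length v' \<le> length v + length w * tl_bound"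
    "(sm.smove ^^ n) (Rdy, [map Inl w, [], map Inl v]) (Rdy, [[], [], map Inl v'])"
    using Cons.IH[OF x(2) v(1)] by blast
  have lv: "length v + length w * tl_bound \<le> ?L" using v(4) by simp
  have "length w * (2 * (length v + length w * tl_bound) + tl_bound + 4) \<le> length w * (2 * ?L + tl_bound + 4)"
    using lv by (intro mult_le_mono2) simp
  then have "n \<le> length w * (2 * ?L + tl_bound + 4)" using v'(2) by (rule order_trans[rotated])
  moreover have "m \<le> 2 * ?L + tl_bound + 4" using v(2) by simp
  ultimately have "m + n \<le> (length w + 1) * (2 * ?L + tl_bound + 4)"
    by (simp only: add_mult_distrib mult_1)
  moreover have "val v' = val u \<otimes> val (x # w)"
    using v(3) v'(3) x Cons.prems(2) W(1) by (auto simp: m_assoc subset_iff simp del: in_lists_conv_set)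
  moreover have "length v' \<le> ?L" using v'(4) lv by linarith
  ultimately show ?case
    using v'(1) relpowp_trans[OF v(5) v'(5)] by (intro bexI[of _ v'] exI[of _ "m + n"]) auto
qed

text \<open>The unread part of \<open>u0\<close> is kept in the state, so that the padding after the
  end of \<open>v\<close> is evaluated in a single move.\<close>

lemma check:
  assumes "q \<in> Q []" "us \<in> lists X" "length us \<le> length u0" "v \<in> lists X"
  shows "(sm.smove ^^ (length v + 1)) (Chk q us, [[], [], map Inl v])
    (if foldl (\<delta> []) q (pad_pair us v) \<in> F [] then AAcc else ARej, [[], [], []])"
  using assms
proof (induction v arbitrary: q us)
  case Nil
  have "sm.smove (Chk q us, [[], [], map Inl []])
      (if foldl (\<delta> []) q (pad_pair us []) \<in> F [] then AAcc else ARej, [[], [], []])"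
    by (rule sm.smoveI) (use Nil in auto)
  then show ?case by (simp add: eq_OO)
next
  case (Cons c v)
  then have c: "c \<in> X" "v \<in> lists X" by auto
  let ?q = "\<delta> [] q (top_of us, Some c)"
  have "top_of us \<in> Xo" using Cons.prems(2) by (cases us) auto
  have tl: "set (tl us) \<subseteq> X" "length (tl us) \<le> length u0" using Cons.prems by (cases us; auto)+
  have q: "?q \<in> Q []" using \<open>top_of us \<in> Xo\<close> \<delta>[of "[]"] Cons.prems(1) padded(2)[OF c(1)] by auto
  have "sm.smove (Chk q us, [[], [], map Inl (c # v)]) (Chk ?q (tl us), [[], [], map Inl v])"
    by (rule sm.smoveI) (use Cons.prems q tl in auto)
  moreover have "(sm.smove ^^ (length v + 1)) (Chk ?q (tl us), [[], [], map Inl v])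
    (if foldl (\<delta> []) ?q (pad_pair (tl us) v) \<in> F [] then AAcc else ARej, [[], [], []])"
    using Cons.prems tl by (intro Cons.IH[OF q]) auto
  moreover have "foldl (\<delta> []) ?q (pad_pair (tl us) v) = foldl (\<delta> []) q (pad_pair us (c # v))"
    by (cases us) auto
  ultimately show ?case
    using relpowp_Suc_left[of sm.smove] by (simp del: relpowp.simps)
qed

text \<open>Normal forms need not be unique, so triviality is tested by the equality recogniser and
  not by comparison with \<open>u0\<close>. A padded pair determines both of its words, which makes
  membership in the language equivalent to equal values.\<close>

lemma accepts_iff:
  assumes "v \<in> W"
  shows "foldl (\<delta> []) (q0 []) (pad_pair u0 v) \<in> F [] \<longleftrightarrow> val v = \<one>"
proof -
  have "pad_pair u0 v \<in> lists (padded_letters X)"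
  proof -
    obtain yos where yos: "length yos = length u0" "set yos \<subseteq> insert None (Some ` set v)"
      "pad_pair u0 v = some_words u0 yos @ tail_word (drop (length u0) v)"
      using pad_pair_run[of u0 v] by blast
    have X: "set v \<subseteq> X" "set u0 \<subseteq> X" using assms u0(1) W(1) by auto
    have yX: "set yos \<subseteq> Xo" using yos(2) X(1) by blast
    have "t \<in> padded_letters X" if t: "t \<in> set (some_words u0 yos)" for t
      using subsetD[OF some_words_padded[OF X(2) yX] t] .
    moreover have "t \<in> padded_letters X" if t: "t \<in> set (tail_word (drop (length u0) v))" for t
    proof -
      obtain y where y: "y \<in> set (drop (length u0) v)" "t = (None, Some y)" using t by auto
      have "y \<in> X" using X(1) in_set_dropD[OF y(1)] by blast
      then show ?thesis using padded(2)[of y None] y(2) by blast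
    qed
    ultimately show ?thesis by (auto simp: yos(3) simp del: set_zip)
  qed
  then have "foldl (\<delta> []) (q0 []) (pad_pair u0 v) \<in> F [] \<longleftrightarrow>
      pad_pair u0 v \<in> {pad_pair u v | u v. u \<in> W \<and> v \<in> W \<and> val (u @ []) = val v}"
    using L[of "[]"] by blast
  also have "\<dots> \<longleftrightarrow> val u0 = val v"
  proof
    assume "pad_pair u0 v \<in> {pad_pair u v | u v. u \<in> W \<and> v \<in> W \<and> val (u @ []) = val v}"
    then obtain u' v' where "pad_pair u0 v = pad_pair u' v'" "val u' = val v'" by auto
    then show "val u0 = val v" by (metis words_pad_pair)
  qed (use assms u0 in auto)
  finally show ?thesis using u0(2) by auto
qed

theorem quadratic_time:
  "\<exists>M c. decides M X (WP G B \<pi>) \<and> (\<forall>w\<in>lists X. tm_time M w \<le> c * (length w + 1) ^ 2)"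
proof -
  define t where "t = tl_bound"
  define c where "c = 2 * length u0 + 2 * t + 4"
  have "\<exists>M. decides M X (WP G B \<pi>) \<and> (\<forall>w\<in>lists X. tm_time M w \<le> 2 * (c * (length w + 1) ^ 2))"
  proof (rule sm.stack_realisable)
    fix w assume w: "w \<in> lists X"
    have u0X: "u0 \<in> lists X" using u0(1) W(1) by blast
    obtain v n where v: "v \<in> W" "n \<le> length w * (2 * (length u0 + length w * t) + t + 4)"
      "val v = val u0 \<otimes> val w" "length v \<le> length u0 + length w * t"
      "(sm.smove ^^ n) (Rdy, [map Inl w, [], map Inl u0]) (Rdy, [[], [], map Inl v])"
      using multiply_word[OF w u0(1)] unfolding t_def by blast
    have vX: "v \<in> lists X" using v(1) W(1) by blast
    have m1: "(sm.smove ^^ (length u0 + 1)) (Ini (rev u0), [map Inl w, [], []]) (Rdy, [map Inl w, [], map Inl u0])"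
      using write_initial[of u0 "map Inl w" "[]" "[]"] u0X by (simp del: relpowp.simps) auto
    have "sm.smove (Rdy, [[], [], map Inl v]) (Chk (q0 []) u0, [[], [], map Inl v])"
      by (rule sm.smoveI) (use q0_in u0X in auto)
    note m3 = relpowp_oneI[of sm.smove, OF this]
    have m4: "(sm.smove ^^ (length v + 1)) (Chk (q0 []) u0, [[], [], map Inl v])
        (if w \<in> WP G B \<pi> then AAcc else ARej, [[], [], []])"
    proof -
      have "val v = val w" using v(3) u0(2) w by simp
      then have "w \<in> WP G B \<pi> \<longleftrightarrow> foldl (\<delta> []) (q0 []) (pad_pair u0 v) \<in> F []"
        using accepts_iff[OF v(1)] w by (simp add: WP_def)
      then show ?thesis using check[OF q0_in(2) u0X order_refl vX] by (simp only:)
    qed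
    have "length u0 + 1 + n + 1 + (length v + 1) \<le> c * (length w + 1) ^ 2"
    proof -
      have "length u0 + 1 + n + 1 + (length v + 1) \<le>
          2 * length u0 + 3 + length w * t + length w * (2 * (length u0 + length w * t) + t + 4)"
        using v(2,4) by linarith
      also have "\<dots> \<le> c * (length w + 1) ^ 2"
        by (simp add: c_def power2_eq_square algebra_simps)
      finally show ?thesis .
    qed
    moreover have "map Inl w # replicate (3 - 1) [] = [map Inl w, [], []]"
      by (simp add: numeral_2_eq_2)
    ultimately show "\<exists>n\<le>c * (length w + 1) ^ 2. \<exists>st. (sm.smove ^^ n)
        (Ini (rev u0), map Inl w # replicate (3 - 1) []) (if w \<in> WP G B \<pi> then AAcc else ARej, st)"
      using relpowp_trans[OF relpowp_trans[OF relpowp_trans[OF m1 v(5)] m3] m4] by metis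
  qed
  then show ?thesis unfolding mult.assoc[symmetric] by blast
qed

end

section \<open>Return probabilities and amenability\<close>

lemma sum_card_fibres:
  assumes W: "finite W" "finite W'" and S: "finite S" "f ` W \<subseteq> S"
  shows "(\<Sum>c\<in>S. card {w \<in> W. f w = c} * card {w \<in> W'. g w = c})
    = card {(w, w'). w \<in> W \<and> w' \<in> W' \<and> f w = g w'}"
proof -
  have "{(w, w'). w \<in> W \<and> w' \<in> W' \<and> f w = g w'}
      = (\<Union>c\<in>S. {w \<in> W. f w = c} \<times> {w \<in> W'. g w = c})"
    using S(2) by auto
  also have "card \<dots> = (\<Sum>c\<in>S. card ({w \<in> W. f w = c} \<times> {w \<in> W'. g w = c}))"
    using W S(1) by (intro card_UN_disjoint) auto
  finally show ?thesis by (simp add: card_cartesian_product)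
qed

lemma (in group) coset_eq_iff:
  assumes "subgroup N G" "x \<in> carrier G" "y \<in> carrier G"
  shows "N #> x = N #> y \<longleftrightarrow> x \<otimes> inv y \<in> N"
proof -
  have "x \<in> N #> y \<longleftrightarrow> x \<otimes> inv y \<in> N"
    using assms by (intro subgroup.rcos_module) (auto simp: is_group)
  then show ?thesis
    using assms rcos_self repr_independence by blast
qed

text \<open>Compactness of a product of unit intervals provides a cluster point, and a cluster point
  lies in every closed set that eventually contains the sequence. It takes the place of a limit
  along an ultrafilter.\<close>

lemma cluster_function:
  fixes \<nu> :: "nat \<Rightarrow> 'a \<Rightarrow> real"
  assumes "\<And>n U. \<nu> n U \<in> {0..1}"
  shows "\<exists>m. \<forall>C. closed C \<longrightarrow> eventually (\<lambda>n. \<nu> n \<in> C) sequentially \<longrightarrow> m \<in> C"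
proof -
  define F where "F = filtermap \<nu> sequentially"
  define P where "P = PiE (UNIV :: 'a set) (\<lambda>_. {0..1 :: real})"
  have "compactin (product_topology (\<lambda>_. euclidean :: real topology) (UNIV :: 'a set)) P"
    unfolding P_def by (subst compactin_PiE) auto
  then have "compact P"
    by (simp add: euclidean_product_topology)
  moreover have "F \<noteq> bot" by (simp add: F_def filtermap_bot_iff)
  moreover have "eventually (\<lambda>f. f \<in> P) F"
    using assms by (auto simp: F_def P_def eventually_filtermap PiE_UNIV_domain)
  ultimately obtain m where m: "inf (nhds m) F \<noteq> bot"
    unfolding compact_filter by blast
  have "m \<in> C" if C: "closed C" "eventually (\<lambda>n. \<nu> n \<in> C) sequentially" for C
  proof (rule ccontr)
    assume "m \<notin> C"
    then have "eventually (\<lambda>f. f \<in> - C) (nhds m)"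
      using C(1) by (intro eventually_nhds_in_open) (simp_all add: open_Compl)
    then have "eventually (\<lambda>f. f \<in> - C) (inf (nhds m) F)"
      by (rule filter_leD[OF inf_le1])
    moreover have "eventually (\<lambda>f. f \<in> C) F"
      using C(2) by (simp add: F_def eventually_filtermap)
    then have "eventually (\<lambda>f. f \<in> C) (inf (nhds m) F)"
      by (rule filter_leD[OF inf_le2])
    ultimately have "eventually (\<lambda>f. False) (inf (nhds m) F)"
      by eventually_elim auto
    then show False using m by (simp add: trivial_limit_def)
  qed
  then show ?thesis by blast
qed

section \<open>Closed paths in the Schreier graph of a subgroup\<close>

locale schreier = fg_group G A \<pi> for G :: "('g, 'm) monoid_scheme" (structure)
  and A :: "'b set" and \<pi> +
  fixes N :: "'g set"
  assumes N: "subgroup N G"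
begin

definition words :: "nat \<Rightarrow> ('b + 'b) list set"
  where "words n = {w. set w \<subseteq> X \<and> length w = n}"

abbreviation "lv \<equiv> letter_val G \<pi>"

lemma words_lists: "w \<in> words n \<Longrightarrow> w \<in> lists X"
  by (auto simp: words_def)

lemma finite_words: "finite (words n)"
  unfolding words_def by (rule finite_lists_length_eq[OF finite_X])

lemma card_words: "card (words n) = card X ^ n"
  unfolding words_def by (rule card_lists_length_eq[OF finite_X])

definition cnt :: "nat \<Rightarrow> nat" where "cnt n = card {w \<in> words n. val w \<in> N}"

text \<open>The coset at the end of the path \<open>w\<close> from the base point, moved by
  \<open>g\<close>; the factor \<open>g\<close> lets the walk be compared with its
  translates.\<close>

definition ends :: "'g \<Rightarrow> ('b + 'b) list \<Rightarrow> 'g set" where "ends g w = N #> (val w \<otimes> g)"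

text \<open>Its cardinality is the inner product of the end-point counts \<open>freq n g\<close> and
  \<open>freq n h\<close>, see \<open>sum_freq\<close>.\<close>

definition pairs :: "nat \<Rightarrow> 'g \<Rightarrow> 'g \<Rightarrow> (('b + 'b) list \<times> ('b + 'b) list) set"
  where "pairs n g h = {(w, w'). w \<in> words n \<and> w' \<in> words n \<and> ends g w = ends h w'}"

definition freq :: "nat \<Rightarrow> 'g \<Rightarrow> 'g set \<Rightarrow> real"
  where "freq n g c = real (card {w \<in> words n. ends g w = c})"

lemma finite_pairs: "finite (pairs n g h)"
  by (rule finite_subset[of _ "words n \<times> words n"]) (auto simp: pairs_def finite_words)

lemma ends_eq_iff:
  assumes "w \<in> lists X" "w' \<in> lists X" "g \<in> carrier G" "h \<in> carrier G"
  shows "ends g w = ends h w' \<longleftrightarrow> val w \<otimes> g \<otimes> inv h \<otimes> inv (val w') \<in> N"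
  using assms by (simp add: ends_def coset_eq_iff[OF N] inv_mult_group m_assoc del: in_lists_conv_set)

lemma ends_translate:
  assumes "w \<in> lists X" "g \<in> carrier G" "k \<in> carrier G"
  shows "ends (g \<otimes> k) w = ends g w #> k"
  using assms subgroup.subset[OF N]
  by (simp add: ends_def coset_mult_assoc m_assoc del: in_lists_conv_set)

text \<open>Right multiplication by \<open>k\<close> permutes the right cosets of
  \<open>N\<close>.\<close>

lemma pairs_translate:
  assumes "g \<in> carrier G" "h \<in> carrier G" "k \<in> carrier G"
  shows "pairs n (g \<otimes> k) (h \<otimes> k) = pairs n g h"
proof -
  have "ends (g \<otimes> k) w = ends (h \<otimes> k) w' \<longleftrightarrow> ends g w = ends h w'"
    if "w \<in> lists X" "w' \<in> lists X" for w w'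
    using that assms by (simp add: ends_eq_iff inv_mult_group m_assoc del: in_lists_conv_set)
  then have "p \<in> pairs n (g \<otimes> k) (h \<otimes> k) \<longleftrightarrow> p \<in> pairs n g h" for p
    unfolding pairs_def mem_Collect_eq case_prod_unfold by (metis words_lists)
  then show ?thesis by blast
qed

lemma sum_freq:
  assumes "finite S" "ends g ` words n \<subseteq> S"
  shows "(\<Sum>c\<in>S. freq n g c * freq n h c) = card (pairs n g h)"
proof -
  have "(\<Sum>c\<in>S. card {w \<in> words n. ends g w = c} * card {w \<in> words n. ends h w = c}) = card (pairs n g h)"
    unfolding pairs_def by (rule sum_card_fibres[OF finite_words finite_words assms])
  then show ?thesis by (simp add: freq_def flip: of_nat_mult of_nat_sum)
qed

lemma append_in_words: "w \<in> words n \<Longrightarrow> w' \<in> words m \<Longrightarrow> w @ w' \<in> words (n + m)"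
  by (auto simp: words_def)

lemma inv_word_words [simp]: "inv_word w \<in> words n \<longleftrightarrow> w \<in> words n"
  by (simp add: words_def inv_word_def image_subset_iff subset_eq)

text \<open>Cutting a closed path in the middle and inverting its second half gives two paths with a
  common end, and conversely. Thus \<open>cnt (2 * n)\<close> is the squared norm of
  \<open>freq n \<one>\<close>.\<close>

lemma cnt_even: "cnt (2 * n) = card (pairs n \<one> \<one>)"
proof -
  have "bij_betw (\<lambda>(w, w'). w @ inv_word w') (pairs n \<one> \<one>) {w \<in> words (2 * n). val w \<in> N}"
  proof (rule bij_betw_byWitness[of _ "\<lambda>w. (take n w, inv_word (drop n w))"])
    show "\<forall>p\<in>pairs n \<one> \<one>. (\<lambda>w. (take n w, inv_word (drop n w))) ((\<lambda>(w, w'). w @ inv_word w') p) = p"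
      by (auto simp: pairs_def words_def)
    show "\<forall>w\<in>{w \<in> words (2 * n). val w \<in> N}. (\<lambda>(w, w'). w @ inv_word w') (take n w, inv_word (drop n w)) = w"
      by simp
    show "(\<lambda>(w, w'). w @ inv_word w') ` pairs n \<one> \<one> \<subseteq> {w \<in> words (2 * n). val w \<in> N}"
    proof clarify
      fix w w' assume "(w, w') \<in> pairs n \<one> \<one>"
      then have w: "w \<in> words n" "w' \<in> words n" "ends \<one> w = ends \<one> w'" by (auto simp: pairs_def)
      note l = words_lists[OF w(1)] words_lists[OF w(2)]
      have l': "inv_word w' \<in> lists X" unfolding inv_word_in by (rule l(2))
      have "val w \<otimes> inv (val w') \<in> N"
        using w(3) ends_eq_iff[OF l one_closed one_closed] val_closed[OF l(1)] by simp
      then show "w @ inv_word w' \<in> words (2 * n) \<and> val (w @ inv_word w') \<in> N"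
        using w append_in_words[of w n "inv_word w'" n]
        by (simp add: mult_2 val_append[OF l(1) l'] val_inv_word[OF l(2)])
    qed
    show "(\<lambda>w. (take n w, inv_word (drop n w))) ` {w \<in> words (2 * n). val w \<in> N} \<subseteq> pairs n \<one> \<one>"
    proof clarify
      fix w assume w: "w \<in> words (2 * n)" "val w \<in> N"
      let ?u = "take n w" and ?v = "drop n w"
      have u: "?u \<in> words n" "?v \<in> words n"
        using w(1) by (auto simp: words_def dest: in_set_takeD in_set_dropD)
      note l = words_lists[OF u(1)] words_lists[OF u(2)]
      have l': "inv_word ?v \<in> lists X" unfolding inv_word_in by (rule l(2))
      have "val w = val ?u \<otimes> val ?v"
        using val_append[OF l(1,2)] by simp
      then have "ends \<one> ?u = ends \<one> (inv_word ?v)"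
        using w(2) ends_eq_iff[OF l(1) l' one_closed one_closed] val_closed[OF l(1)] val_closed[OF l(2)]
        by (simp add: val_inv_word[OF l(2)])
      then show "(?u, inv_word ?v) \<in> pairs n \<one> \<one>"
        using u by (simp add: pairs_def)
    qed
  qed
  then show ?thesis
    unfolding cnt_def by (rule bij_betw_same_card[symmetric])
qed

lemma card_pairs_diag: "g \<in> carrier G \<Longrightarrow> card (pairs n g g) = cnt (2 * n)"
  using pairs_translate[of \<one> \<one> g n] by (simp add: cnt_even)

text \<open>Both counts have squared norm \<open>cnt (2 * n)\<close>, so it suffices to expand the
  sum of the squares of their differences.\<close>

lemma card_pairs_le:
  assumes "g \<in> carrier G" "h \<in> carrier G"
  shows "card (pairs n g h) \<le> cnt (2 * n)"
proof -
  let ?S = "ends g ` words n \<union> ends h ` words n"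
  have fin: "finite ?S" using finite_words by auto
  have "0 \<le> (\<Sum>c\<in>?S. (freq n g c - freq n h c)\<^sup>2)"
    by (intro sum_nonneg) simp
  also have "\<dots> = (\<Sum>c\<in>?S. freq n g c * freq n g c) + (\<Sum>c\<in>?S. freq n h c * freq n h c)
      - 2 * (\<Sum>c\<in>?S. freq n g c * freq n h c)"
    by (simp add: power2_eq_square algebra_simps sum.distrib sum_subtractf sum_distrib_left)
  also have "\<dots> = real (cnt (2 * n)) + real (cnt (2 * n)) - 2 * real (card (pairs n g h))"
    using sum_freq[OF fin, of g n g] sum_freq[OF fin, of h n h] sum_freq[OF fin, of g n h]
      card_pairs_diag assms by simp
  finally show ?thesis by simp
qed

text \<open>The last letter of a word acts on the end of the remaining path as a
  translation.\<close>

lemma pairs_Suc: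
  "card (pairs (Suc n) \<one> \<one>) = (\<Sum>x\<in>X. \<Sum>y\<in>X. card (pairs n (lv x) (lv y)))"
proof -
  have ends_snoc: "ends \<one> (w @ [x]) = ends (lv x) w" if "w \<in> words n" "x \<in> X" for w x
    using that words_lists[OF that(1)] by (simp add: ends_def val_append[of w "[x]"])
  have "pairs (Suc n) \<one> \<one> = (\<Union>p\<in>X \<times> X.
      (\<lambda>(w, w'). (w @ [fst p], w' @ [snd p])) ` pairs n (lv (fst p)) (lv (snd p)))" (is "_ = ?U")
  proof (intro equalityI subsetI)
    fix q assume "q \<in> pairs (Suc n) \<one> \<one>"
    then obtain w w' where q: "q = (w, w')" "w \<in> words (Suc n)" "w' \<in> words (Suc n)"
      "ends \<one> w = ends \<one> w'" by (auto simp: pairs_def)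
    obtain u x where w: "w = u @ [x]" "u \<in> words n" "x \<in> X"
      using q(2) by (cases w rule: rev_cases) (auto simp: words_def)
    obtain u' x' where w': "w' = u' @ [x']" "u' \<in> words n" "x' \<in> X"
      using q(3) by (cases w' rule: rev_cases) (auto simp: words_def)
    have "(u, u') \<in> pairs n (lv x) (lv x')"
      using q(4) w w' ends_snoc by (simp add: pairs_def)
    then show "q \<in> ?U" using q(1) w w' by force
  next
    fix q assume "q \<in> ?U"
    then obtain x y w w' where "x \<in> X" "y \<in> X" "(w, w') \<in> pairs n (lv x) (lv y)" "q = (w @ [x], w' @ [y])"
      by force
    moreover from this have "w @ [x] \<in> words (Suc n)" "w' @ [y] \<in> words (Suc n)"
      "w \<in> words n" "w' \<in> words n" "ends (lv x) w = ends (lv y) w'"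
      by (simp_all add: pairs_def words_def)
    ultimately show "q \<in> pairs (Suc n) \<one> \<one>" using ends_snoc by (simp add: pairs_def)
  qed
  also have "card \<dots> = (\<Sum>p\<in>X \<times> X. card ((\<lambda>(w, w'). (w @ [fst p], w' @ [snd p])) `
      pairs n (lv (fst p)) (lv (snd p))))"
    using finite_X finite_pairs by (intro card_UN_disjoint) auto
  also have "\<dots> = (\<Sum>p\<in>X \<times> X. card (pairs n (lv (fst p)) (lv (snd p))))"
    by (intro sum.cong refl card_image inj_onI) auto
  also have "\<dots> = (\<Sum>x\<in>X. \<Sum>y\<in>X. card (pairs n (lv x) (lv y)))"
    by (simp add: sum.cartesian_product case_prod_unfold)
  finally show ?thesis .
qed

text \<open>The middle letter of a closed path is absorbed as a translation of the end of the first
  half.\<close>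

lemma cnt_odd: "cnt (2 * n + 1) \<le> card X * cnt (2 * n)"
proof -
  have "{w \<in> words (2 * n + 1). val w \<in> N} \<subseteq>
      (\<Union>x\<in>X. (\<lambda>(w, w'). w @ x # inv_word w') ` pairs n (lv x) \<one>)"
  proof
    fix w assume "w \<in> {w \<in> words (2 * n + 1). val w \<in> N}"
    then have w: "w \<in> words (2 * n + 1)" "val w \<in> N" by auto
    define u where "u = take n w"
    define x where "x = w ! n"
    define v where "v = drop (Suc n) w"
    have e: "w = u @ [x] @ v"
      using w(1) by (simp add: u_def x_def v_def words_def id_take_nth_drop[symmetric])
    have u: "u \<in> words n" "v \<in> words n"
      using w(1) by (auto simp: words_def u_def v_def dest: in_set_takeD in_set_dropD)
    have x: "x \<in> X" using w(1) e by (auto simp: words_def)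
    have l: "u \<in> lists X" "v \<in> lists X" using u words_lists by blast+
    have "val w = val u \<otimes> lv x \<otimes> val v"
    proof -
      have "x # v \<in> lists X" using x l(2) by simp
      from val_append[OF l(1) this] show ?thesis
        unfolding e using val_closed[OF l(1)] val_closed[OF l(2)] x by (simp add: m_assoc)
    qed
    then have "ends (lv x) u = ends \<one> (inv_word v)"
      using w(2) l x ends_eq_iff[of u "inv_word v" "lv x" \<one>] val_inv_word[OF l(2)]
      by (simp del: in_lists_conv_set)
    then have "(u, inv_word v) \<in> pairs n (lv x) \<one>" using u by (simp add: pairs_def)
    then show "w \<in> (\<Union>x\<in>X. (\<lambda>(w, w'). w @ x # inv_word w') ` pairs n (lv x) \<one>)"
      using x e by (intro UN_I[of x] image_eqI[of _ _ "(u, inv_word v)"]) auto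
  qed
  then have "cnt (2 * n + 1) \<le> card (\<Union>x\<in>X. (\<lambda>(w, w'). w @ x # inv_word w') ` pairs n (lv x) \<one>)"
    unfolding cnt_def using finite_X finite_pairs by (intro card_mono) auto
  also have "\<dots> \<le> (\<Sum>x\<in>X. card ((\<lambda>(w, w'). w @ x # inv_word w') ` pairs n (lv x) \<one>))"
    by (rule card_UN_le[OF finite_X])
  also have "\<dots> \<le> (\<Sum>x\<in>X. cnt (2 * n))"
    by (intro sum_mono order_trans[OF card_image_le[OF finite_pairs]] card_pairs_le) auto
  finally show ?thesis by simp
qed

section \<open>Squared end-point counts as probability measures\<close>

definition mass :: "nat \<Rightarrow> 'g \<Rightarrow> 'g set set \<Rightarrow> real"
  where "mass n g U = (\<Sum>c\<in>U \<inter> ends g ` words n. (freq n g c)\<^sup>2) / cnt (2 * n)"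

lemma freq_0: "c \<notin> ends g ` words n \<Longrightarrow> freq n g c = 0"
proof -
  assume "c \<notin> ends g ` words n"
  then have e: "{w \<in> words n. ends g w = c} = {}" by blast
  show ?thesis by (simp only: freq_def e card.empty of_nat_0)
qed

text \<open>The support in the definition may be enlarged to any finite set, so that two translates
  can be summed over a common one.\<close>

lemma mass_alt:
  assumes "finite S" "ends g ` words n \<subseteq> S"
  shows "mass n g U = (\<Sum>c\<in>U \<inter> S. (freq n g c)\<^sup>2) / cnt (2 * n)"
proof -
  have "(\<Sum>c\<in>U \<inter> ends g ` words n. (freq n g c)\<^sup>2) = (\<Sum>c\<in>U \<inter> S. (freq n g c)\<^sup>2)"
    by (rule sum.mono_neutral_left) (use assms freq_0 in auto)
  then show ?thesis by (simp add: mass_def)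
qed

lemma cnt_even_pos: assumes "X \<noteq> {}" shows "0 < cnt (2 * n)"
proof -
  obtain x where "x \<in> X" using assms by blast
  then have "replicate n x \<in> words n" by (auto simp: words_def)
  then have "(replicate n x, replicate n x) \<in> pairs n \<one> \<one>" by (simp add: pairs_def)
  then show ?thesis using finite_pairs by (auto simp: cnt_even card_gt_0_iff)
qed

lemma mass_nonneg: "0 \<le> mass n g U"
  by (simp add: mass_def sum_nonneg)

lemma mass_Un: "U \<inter> V = {} \<Longrightarrow> mass n g (U \<union> V) = mass n g U + mass n g V"
  unfolding mass_def Int_Un_distrib2 using finite_words
  by (subst sum.union_disjoint) (auto simp: add_divide_distrib)

lemma mass_all:
  assumes "g \<in> carrier G" "X \<noteq> {}"
  shows "mass n g (rcosets N) = 1"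
proof -
  have "ends g ` words n \<subseteq> rcosets N"
    using assms words_lists subgroup.subset[OF N] by (auto simp: ends_def intro!: rcosetsI)
  then have "rcosets N \<inter> ends g ` words n = ends g ` words n" by blast
  then show ?thesis
    using sum_freq[of "ends g ` words n" g n g] finite_words card_pairs_diag[OF assms(1), of n]
      cnt_even_pos[OF assms(2), of n]
    by (simp add: mass_def power2_eq_square)
qed

lemma mass_le_1:
  assumes "g \<in> carrier G" "X \<noteq> {}"
  shows "mass n g U \<le> 1"
proof -
  have "(\<Sum>c\<in>U \<inter> ends g ` words n. (freq n g c)\<^sup>2) \<le> (\<Sum>c\<in>ends g ` words n. (freq n g c)\<^sup>2)"
    using finite_words by (intro sum_mono2) auto
  also have "\<dots> = cnt (2 * n)"
    using sum_freq[of "ends g ` words n" g n g] finite_words card_pairs_diag[OF assms(1), of n]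
    by (simp add: power2_eq_square)
  finally show ?thesis
    using cnt_even_pos[OF assms(2), of n] by (simp add: mass_def)
qed

lemma coset_translate_inj:
  assumes "k \<in> carrier G" "c \<in> rcosets N" "c' \<in> rcosets N" "c #> k = c' #> k"
  shows "c = c'"
proof -
  have "c \<subseteq> carrier G" "c' \<subseteq> carrier G"
    using assms(2,3) subgroup.rcosets_carrier[OF N is_group] by auto
  then have "(c #> k) #> inv k = c" "(c' #> k) #> inv k = c'"
    using assms(1) by (simp_all add: coset_mult_assoc)
  then show ?thesis using assms(4) by metis
qed

text \<open>Translation by \<open>k\<close> carries the count \<open>freq n g\<close> to
  \<open>freq n (g \<otimes> k)\<close>, coset by coset.\<close>

lemma mass_translate:
  assumes g: "g \<in> carrier G" and k: "k \<in> carrier G" and U: "U \<subseteq> rcosets N"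
  shows "mass n (g \<otimes> k) ((\<lambda>c. c #> k) ` U) = mass n g U"
proof -
  have ends_in: "ends g w \<in> rcosets N" if "w \<in> words n" for w
    using that g words_lists subgroup.subset[OF N] by (auto simp: ends_def intro!: rcosetsI)
  have tr: "ends (g \<otimes> k) w = ends g w #> k" if "w \<in> words n" for w
    using ends_translate[OF words_lists[OF that] g k] .
  have "(\<lambda>c. c #> k) ` U \<inter> ends (g \<otimes> k) ` words n = (\<lambda>c. c #> k) ` (U \<inter> ends g ` words n)"
  proof (intro equalityI subsetI)
    fix c assume "c \<in> (\<lambda>c. c #> k) ` U \<inter> ends (g \<otimes> k) ` words n"
    then obtain u w where u: "u \<in> U" "c = u #> k" and w: "w \<in> words n" "c = ends (g \<otimes> k) w" by blast
    then have "u #> k = ends g w #> k" using tr by simp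
    then have "u = ends g w"
      using coset_translate_inj[OF k _ ends_in[OF w(1)]] u(1) U by blast
    then show "c \<in> (\<lambda>c. c #> k) ` (U \<inter> ends g ` words n)" using u w by blast
  next
    fix c assume "c \<in> (\<lambda>c. c #> k) ` (U \<inter> ends g ` words n)"
    then obtain w where w: "w \<in> words n" "ends g w \<in> U" "c = ends g w #> k" by blast
    then have "c = ends (g \<otimes> k) w" using tr by simp
    then show "c \<in> (\<lambda>c. c #> k) ` U \<inter> ends (g \<otimes> k) ` words n" using w by blast
  qed
  moreover have "inj_on (\<lambda>c. c #> k) (U \<inter> ends g ` words n)"
    by (rule inj_onI) (rule coset_translate_inj[OF k], use U in blast, use U in blast, assumption)
  moreover have "freq n (g \<otimes> k) (c #> k) = freq n g c" if "c \<in> rcosets N" for c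
  proof -
    have "{w \<in> words n. ends (g \<otimes> k) w = c #> k} = {w \<in> words n. ends g w = c}"
      using tr ends_in coset_translate_inj[OF k _ that] by (intro Collect_cong) metis
    then show ?thesis by (simp add: freq_def)
  qed
  moreover from this have "(\<Sum>c\<in>U \<inter> ends g ` words n. (freq n (g \<otimes> k) (c #> k))\<^sup>2)
      = (\<Sum>c\<in>U \<inter> ends g ` words n. (freq n g c)\<^sup>2)"
    using U by (intro sum.cong refl) (metis IntD1 subsetD)
  ultimately show ?thesis
    by (simp add: mass_def sum.reindex comp_def)
qed

text \<open>Cauchy-Schwarz for the difference of squares, factored as
  \<open>|f - h| * |f + h|\<close>. An almost maximal inner product makes the squared norm of the
  first factor at most \<open>2 * e * a\<close>; that of the second is at most
  \<open>4 * a\<close>.\<close>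

lemma mass_diff:
  assumes g: "g \<in> carrier G" and h: "h \<in> carrier G" and ne: "X \<noteq> {}"
    and e: "(1 - (e :: real)) * cnt (2 * n) \<le> card (pairs n g h)"
  shows "\<bar>mass n g U - mass n h U\<bar> \<le> sqrt (8 * e)"
proof -
  let ?S = "ends g ` words n \<union> ends h ` words n"
  have fin: "finite ?S" using finite_words by auto
  define a where "a = real (cnt (2 * n))"
  have a: "0 < a" using cnt_even_pos[OF ne] by (simp add: a_def)
  let ?f = "freq n g" and ?h = "freq n h"
  have gg: "(\<Sum>c\<in>?S. ?f c * ?f c) = a" "(\<Sum>c\<in>?S. ?h c * ?h c) = a"
    "(\<Sum>c\<in>?S. ?f c * ?h c) = card (pairs n g h)"
    using sum_freq[OF fin, of g n g] sum_freq[OF fin, of h n h] sum_freq[OF fin, of g n h]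
      card_pairs_diag[OF g, of n] card_pairs_diag[OF h, of n] by (simp_all only: a_def Un_upper1 Un_upper2)
  have le: "real (card (pairs n g h)) \<le> a" using card_pairs_le[OF g h] by (simp add: a_def)
  have "(\<Sum>c\<in>?S. (\<bar>?f c - ?h c\<bar>)\<^sup>2) =
      (\<Sum>c\<in>?S. ?f c * ?f c) + (\<Sum>c\<in>?S. ?h c * ?h c) - 2 * (\<Sum>c\<in>?S. ?f c * ?h c)"
    by (simp add: power2_eq_square algebra_simps sum.distrib sum_subtractf sum_distrib_left)
  also have "\<dots> = a + a - 2 * card (pairs n g h)" by (simp only: gg)
  also have "\<dots> \<le> 2 * e * a" using e by (simp add: a_def algebra_simps)
  finally have d: "(\<Sum>c\<in>?S. (\<bar>?f c - ?h c\<bar>)\<^sup>2) \<le> 2 * e * a" .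
  have "(\<Sum>c\<in>?S. (\<bar>?f c + ?h c\<bar>)\<^sup>2) =
      (\<Sum>c\<in>?S. ?f c * ?f c) + (\<Sum>c\<in>?S. ?h c * ?h c) + 2 * (\<Sum>c\<in>?S. ?f c * ?h c)"
    by (simp add: power2_eq_square algebra_simps sum.distrib sum_distrib_left)
  also have "\<dots> = a + a + 2 * card (pairs n g h)" by (simp only: gg)
  also have "\<dots> \<le> 4 * a" using le by simp
  finally have s: "(\<Sum>c\<in>?S. (\<bar>?f c + ?h c\<bar>)\<^sup>2) \<le> 4 * a" .
  have "(\<Sum>c\<in>?S. \<bar>?f c - ?h c\<bar> * \<bar>?f c + ?h c\<bar>)\<^sup>2 \<le>
      (\<Sum>c\<in>?S. (\<bar>?f c - ?h c\<bar>)\<^sup>2) * (\<Sum>c\<in>?S. (\<bar>?f c + ?h c\<bar>)\<^sup>2)"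
    by (rule Cauchy_Schwarz_ineq_sum)
  also have "\<dots> \<le> (2 * e * a) * (4 * a)"
  proof (rule mult_mono[OF d s])
    show "0 \<le> 2 * e * a" by (rule order_trans[OF _ d]) (simp add: sum_nonneg)
  qed (simp add: sum_nonneg)
  also have "\<dots> = (8 * e) * a\<^sup>2" by (simp add: power2_eq_square)
  finally have "(\<Sum>c\<in>?S. \<bar>?f c - ?h c\<bar> * \<bar>?f c + ?h c\<bar>) \<le> sqrt ((8 * e) * a\<^sup>2)"
    by (rule real_le_rsqrt)
  then have cs: "(\<Sum>c\<in>?S. \<bar>?f c - ?h c\<bar> * \<bar>?f c + ?h c\<bar>) \<le> sqrt (8 * e) * a"
    using a by (simp add: real_sqrt_mult)
  have "\<bar>(\<Sum>c\<in>U \<inter> ?S. (?f c)\<^sup>2) - (\<Sum>c\<in>U \<inter> ?S. (?h c)\<^sup>2)\<bar> = \<bar>\<Sum>c\<in>U \<inter> ?S. (?f c)\<^sup>2 - (?h c)\<^sup>2\<bar>"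
    by (simp add: sum_subtractf)
  also have "\<dots> \<le> (\<Sum>c\<in>U \<inter> ?S. \<bar>(?f c)\<^sup>2 - (?h c)\<^sup>2\<bar>)" by (rule sum_abs)
  also have "\<dots> \<le> (\<Sum>c\<in>?S. \<bar>(?f c)\<^sup>2 - (?h c)\<^sup>2\<bar>)"
    using fin by (intro sum_mono2) auto
  also have "\<dots> = (\<Sum>c\<in>?S. \<bar>?f c - ?h c\<bar> * \<bar>?f c + ?h c\<bar>)"
    by (intro sum.cong refl) (simp add: abs_mult[symmetric] power2_eq_square algebra_simps)
  finally have "\<bar>(\<Sum>c\<in>U \<inter> ?S. (?f c)\<^sup>2) - (\<Sum>c\<in>U \<inter> ?S. (?h c)\<^sup>2)\<bar> \<le> sqrt (8 * e) * a"
    using cs by simp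
  moreover have "mass n g U - mass n h U = ((\<Sum>c\<in>U \<inter> ?S. (?f c)\<^sup>2) - (\<Sum>c\<in>U \<inter> ?S. (?h c)\<^sup>2)) / a"
    using mass_alt[OF fin, of g n U] mass_alt[OF fin, of h n U] by (simp add: a_def diff_divide_distrib)
  ultimately show ?thesis using a by (simp add: abs_divide pos_divide_le_eq)
qed

text \<open>Averaging over \<open>\<one>\<close> and a generator takes care of the parity of the word length: if the
  squared norm of the distribution of the walk hardly drops in a step then all the translates by
  letters are close to each other, but possibly not to the untranslated distribution.\<close>

definition avg :: "'b + 'b \<Rightarrow> nat \<Rightarrow> 'g set set \<Rightarrow> real"
  where "avg x n U = (mass n \<one> U + mass n (lv x) U) / 2"

text \<open>The deficits from the maximal inner product are nonnegative and add up to less than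
  \<open>e * cnt (2 * n)\<close>, so each of them is below this bound.\<close>

lemma pairs_large:
  assumes e: "(real (card X) ^ 2 - e) * cnt (2 * n) < cnt (2 * n + 2)" and xy: "x \<in> X" "y \<in> X"
  shows "(1 - e) * cnt (2 * n) \<le> card (pairs n (lv x) (lv y))"
proof -
  define a where "a = real (cnt (2 * n))"
  let ?p = "\<lambda>p. real (card (pairs n (lv (fst p)) (lv (snd p))))"
  have "real (cnt (2 * n + 2)) = (\<Sum>p\<in>X \<times> X. ?p p)"
    using cnt_even[of "Suc n"] by (simp add: pairs_Suc sum.cartesian_product case_prod_unfold)
  moreover have "(\<Sum>p\<in>X \<times> X. a - ?p p) = real (card X) ^ 2 * a - (\<Sum>p\<in>X \<times> X. ?p p)"
    by (simp add: sum_subtractf card_cartesian_product power2_eq_square)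
  moreover have "a - ?p (x, y) \<le> (\<Sum>p\<in>X \<times> X. a - ?p p)"
    by (rule member_le_sum[of "(x, y)" "X \<times> X" "\<lambda>p. a - ?p p"])
      (use xy finite_X card_pairs_le[OF letter_closed letter_closed] in \<open>simp_all add: a_def mem_Times_iff\<close>)
  ultimately show ?thesis using e by (simp add: a_def algebra_simps)
qed

text \<open>Translation exchanges the two halves of the average up to the error: the first becomes
  the mass at \<open>inv (lv y)\<close>, close to the one at \<open>lv x\<close>, and the second the
  mass at \<open>lv x \<otimes> inv (lv y)\<close>, close to the one at
  \<open>\<one>\<close>.\<close>

lemma avg_translate:
  assumes ne: "x \<in> X" and e: "(real (card X) ^ 2 - e) * cnt (2 * n) < cnt (2 * n + 2)"
    and y: "y \<in> X" and U: "U \<subseteq> rcosets N"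
  shows "\<bar>avg x n ((\<lambda>c. c #> lv y) ` U) - avg x n U\<bar> \<le> sqrt (8 * e)"
proof -
  have X: "X \<noteq> {}" using ne by blast
  let ?U = "(\<lambda>c. c #> lv y) ` U" and ?y = "inv (lv y)"
  have y': "?y = lv (formal_inv y)" "formal_inv y \<in> X" using y letter_formal_inv by auto
  have c: "lv x \<in> carrier G" "lv y \<in> carrier G" using ne y by auto
  have "mass n \<one> ?U = mass n ?y U"
    using mass_translate[OF inv_closed[OF c(2)] c(2) U, of n] c by simp
  moreover have "mass n (lv x) ?U = mass n (lv x \<otimes> ?y) U"
    using mass_translate[of "lv x \<otimes> ?y" "lv y" U n] c U by (simp add: m_assoc)
  moreover have "\<bar>mass n ?y U - mass n (lv x) U\<bar> \<le> sqrt (8 * e)"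
    using mass_diff[OF _ c(1) X pairs_large[OF e y'(2) ne]] c y'(1) by (metis inv_closed)
  moreover have "\<bar>mass n (lv x \<otimes> ?y) U - mass n \<one> U\<bar> \<le> sqrt (8 * e)"
  proof (rule mass_diff[OF _ _ X])
    have "pairs n (lv x \<otimes> ?y) \<one> = pairs n (lv x) (lv y)"
      using pairs_translate[of "lv x" "lv y" ?y n] c by simp
    then show "(1 - e) * cnt (2 * n) \<le> card (pairs n (lv x \<otimes> ?y) \<one>)"
      using pairs_large[OF e ne y] by simp
  qed (use c in auto)
  ultimately show ?thesis unfolding avg_def by (simp add: abs_if field_simps split: if_splits)
qed

section \<open>A right-invariant mean on the cosets and its absence\<close>

definition coset_mean :: "('g set set \<Rightarrow> real) \<Rightarrow> bool"
  where "coset_mean m \<longleftrightarrow> (\<forall>U. 0 \<le> m U) \<and> m (rcosets N) = 1 \<and>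
    (\<forall>U V. U \<inter> V = {} \<longrightarrow> m (U \<union> V) = m U + m V) \<and>
    (\<forall>g\<in>carrier G. \<forall>U. U \<subseteq> rcosets N \<longrightarrow> m ((\<lambda>c. c #> g) ` U) = m U)"

lemma closed_coordinates:
  fixes f g :: "('a \<Rightarrow> real) \<Rightarrow> real"
  assumes "continuous_on UNIV f" "continuous_on UNIV g"
  shows "closed {m. f m = g m}" "closed {m. f m \<le> g m}"
  using assms by (auto intro: closed_Collect_eq closed_Collect_le)

text \<open>Each property of a mean is a closed condition. Positivity, total mass and additivity
  hold along the sequence exactly, invariance under a letter up to an error that tends to 0, so a
  cluster point has them all; invariance then extends along words to the group.\<close>

lemma exists_coset_mean:
  assumes ne: "X \<noteq> {}"
    and dense: "\<And>e. 0 < e \<Longrightarrow> \<exists>n. (real (card X) ^ 2 - e) * cnt (2 * n) < cnt (2 * n + 2)"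
  shows "\<exists>m. coset_mean m"
proof -
  obtain x where x: "x \<in> X" using ne by blast
  have lx: "lv x \<in> carrier G" using x by simp
  have "\<forall>k. \<exists>n. (real (card X) ^ 2 - inverse (real (Suc k))) * cnt (2 * n) < cnt (2 * n + 2)"
    using dense by simp
  then obtain n where n: "\<And>k. (real (card X) ^ 2 - inverse (real (Suc k))) * cnt (2 * n k) < cnt (2 * n k + 2)"
    by metis
  define \<nu> where "\<nu> k = avg x (n k)" for k
  have "\<nu> k U \<in> {0..1}" for k U
    using mass_nonneg[of "n k" _ U] mass_le_1[OF one_closed ne, of "n k" U] mass_le_1[OF lx ne, of "n k" U]
    by (simp add: \<nu>_def avg_def)
  then obtain m where m: "\<And>C. closed C \<Longrightarrow> eventually (\<lambda>k. \<nu> k \<in> C) sequentially \<Longrightarrow> m \<in> C"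
    using cluster_function[of \<nu>] by blast
  have co: "continuous_on UNIV (\<lambda>m :: 'g set set \<Rightarrow> real. m U)" for U
    by simp
  have p1: "m \<in> {m. 0 \<le> m U}" for U
    by (rule m) (auto intro!: closed_coordinates co continuous_intros always_eventually
        simp: \<nu>_def avg_def mass_nonneg)
  have p2: "m \<in> {m. m (rcosets N) = 1}"
    by (rule m) (auto intro!: closed_coordinates co continuous_intros always_eventually
        simp: \<nu>_def avg_def mass_all[OF one_closed ne] mass_all[OF lx ne])
  have p3: "m \<in> {m. m (U \<union> V) = m U + m V}" if "U \<inter> V = {}" for U V
    by (rule m) (auto intro!: closed_coordinates co continuous_intros always_eventually
        simp: \<nu>_def avg_def mass_Un[OF that] field_simps)
  have inv: "m ((\<lambda>c. c #> lv y) ` U) = m U" if y: "y \<in> X" and U: "U \<subseteq> rcosets N" for y U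
  proof -
    let ?U = "(\<lambda>c. c #> lv y) ` U"
    have "m \<in> {m. \<bar>m ?U - m U\<bar> \<le> r}" if r: "0 < r" for r
    proof (rule m)
      show "closed {m. \<bar>m ?U - m U\<bar> \<le> r}"
        by (intro closed_coordinates continuous_intros co)
      have "eventually (\<lambda>k. inverse (real (Suc k)) < r\<^sup>2 / 8) sequentially"
        using LIMSEQ_inverse_real_of_nat r by (intro order_tendstoD) auto
      then show "eventually (\<lambda>k. \<nu> k \<in> {m. \<bar>m ?U - m U\<bar> \<le> r}) sequentially"
      proof eventually_elim
        case (elim k)
        have "\<bar>\<nu> k ?U - \<nu> k U\<bar> \<le> sqrt (8 * inverse (real (Suc k)))"
          unfolding \<nu>_def by (rule avg_translate[OF x n y U])
        also have "\<dots> \<le> sqrt (r\<^sup>2)" using elim by (intro real_sqrt_le_mono) simp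
        finally show ?case using r by simp
      qed
    qed
    then have "\<bar>m ?U - m U\<bar> \<le> r" if "0 < r" for r using that by blast
    then have "\<bar>m ?U - m U\<bar> \<le> 0" by (rule field_le_epsilon[of _ 0, simplified])
    then show ?thesis by simp
  qed
  have p4: "m ((\<lambda>c. c #> g) ` U) = m U" if g: "g \<in> carrier G" and U: "U \<subseteq> rcosets N" for g U
  proof -
    have sub: "c \<subseteq> carrier G" if "c \<in> U" for c
      using that U subgroup.rcosets_carrier[OF N is_group] by auto
    have closed: "(\<lambda>c. c #> k) ` V \<subseteq> rcosets N" if k: "k \<in> carrier G" and V: "V \<subseteq> rcosets N" for k V
    proof
      fix c assume "c \<in> (\<lambda>c. c #> k) ` V"
      then obtain h where "h \<in> carrier G" "c = (N #> h) #> k"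
        using V by (auto simp: RCOSETS_def)
      then show "c \<in> rcosets N"
        using k subgroup.subset[OF N] by (simp add: coset_mult_assoc rcosetsI)
    qed
    have w: "m ((\<lambda>c. c #> val w) ` U) = m U" if "w \<in> lists X" "U \<subseteq> rcosets N" for w U
      using that
    proof (induction w arbitrary: U rule: list.induct)
      case Nil
      have "c #> \<one> = c" if "c \<in> U" for c
        using that Nil subgroup.rcosets_carrier[OF N is_group] by (intro coset_mult_one) auto
      then show ?case by simp
    next
      case (Cons y w)
      then have y: "y \<in> X" "w \<in> lists X" by auto
      let ?V = "(\<lambda>c. c #> lv y) ` U"
      have "c #> val (y # w) = (c #> lv y) #> val w" if "c \<in> U" for c
      proof -
        have "c \<subseteq> carrier G"
          using that Cons.prems(2) subgroup.rcosets_carrier[OF N is_group] by blast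
        then show ?thesis
          using letter_closed[OF y(1)] val_closed[OF y(2)] by (simp add: coset_mult_assoc)
      qed
      then have "(\<lambda>c. c #> val (y # w)) ` U = (\<lambda>c. c #> val w) ` ?V"
        by (auto simp: image_image)
      then show ?case
        using Cons.IH[OF y(2) closed[OF letter_closed[OF y(1)] Cons.prems(2)]] inv[OF y(1) Cons.prems(2)]
        by simp
    qed
    then show ?thesis using val_surj[OF g] U by metis
  qed
  have "coset_mean m"
    unfolding coset_mean_def
    using p1 p2 p3 by (intro conjI allI impI ballI p4) simp_all
  then show ?thesis by blast
qed

text \<open>Without a mean, each passage from \<open>2 * n\<close> to \<open>2 * n + 2\<close> falls
  short of the factor \<open>|X|^2\<close> by a fixed \<open>e\<close>. Iteration gives the rate for
  even lengths, and \<open>cnt_odd\<close> carries it to odd ones.\<close>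

lemma cnt_growth:
  assumes ne: "X \<noteq> {}" and no: "\<nexists>m. coset_mean m"
  shows "\<exists>(C :: real) r. 0 < r \<and> r < 1 \<and> (\<forall>n. real (cnt n) \<le> C * (r * real (card X)) ^ n)"
proof -
  obtain e where e: "0 < e" and le: "\<And>n. real (cnt (2 * n + 2)) \<le> (real (card X) ^ 2 - e) * cnt (2 * n)"
    using exists_coset_mean[OF ne] no by (meson not_le)
  define D where "D = real (card X)"
  have D: "0 < D" using ne finite_X by (auto simp: D_def card_gt_0_iff)
  \<comment> \<open>The \<open>1 / 2\<close> keeps \<open>r\<close> positive when \<open>e\<close>
    is at least \<open>D\<^sup>2\<close>.\<close>
  define r where "r = max (1 / 2) (sqrt (1 - e / D\<^sup>2))"
  have r0: "0 < r" by (simp add: r_def less_max_iff_disj)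
  have "1 - e / D\<^sup>2 < 1" using e D by simp
  then have r1: "r < 1" by (simp add: r_def)
  have "1 - e / D\<^sup>2 \<le> r\<^sup>2"
  proof (cases "0 \<le> 1 - e / D\<^sup>2")
    case True
    have "(sqrt (1 - e / D\<^sup>2))\<^sup>2 \<le> r\<^sup>2"
      using True by (intro power_mono) (auto simp: r_def)
    then show ?thesis using True by simp
  next
    case False
    then have "1 - e / D\<^sup>2 \<le> 0" by simp
    also have "0 \<le> r\<^sup>2" by simp
    finally show ?thesis .
  qed
  then have r2: "D\<^sup>2 - e \<le> (r * D)\<^sup>2"
    using D by (simp add: power_mult_distrib field_simps)
  have c0: "cnt 0 \<le> 1"
  proof -
    have "{w \<in> words 0. val w \<in> N} \<subseteq> {[]}" by (auto simp: words_def)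
    then have "card {w \<in> words 0. val w \<in> N} \<le> card {[] :: ('b + 'b) list}"
      by (intro card_mono) simp_all
    then show ?thesis by (simp add: cnt_def)
  qed
  have even: "real (cnt (2 * n)) \<le> (r * D) ^ (2 * n)" for n
  proof (induction n)
    case (Suc n)
    have "real (cnt (2 * Suc n)) \<le> (D\<^sup>2 - e) * cnt (2 * n)" using le[of n] by (simp add: D_def)
    also have "\<dots> \<le> (r * D)\<^sup>2 * cnt (2 * n)" using r2 by (intro mult_right_mono) auto
    also have "\<dots> \<le> (r * D)\<^sup>2 * (r * D) ^ (2 * n)" using Suc by (intro mult_left_mono) auto
    also have "\<dots> = (r * D) ^ (2 * Suc n)" by (simp add: power_add[symmetric])
    finally show ?case .
  qed (use c0 in simp)
  \<comment> \<open>For odd \<open>n\<close> the last letter contributes \<open>D\<close> where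
    \<open>r * D\<close> is wanted, which costs the constant \<open>1 / r\<close>.\<close>
  have "real (cnt n) \<le> (1 / r) * (r * D) ^ n" for n
  proof (cases "even n")
    case True
    then obtain k where "n = 2 * k" by blast
    moreover have "1 * (r * D) ^ n \<le> (1 / r) * (r * D) ^ n"
      using r0 r1 D by (intro mult_right_mono) auto
    ultimately show ?thesis using even[of k] by simp
  next
    case False
    then obtain k where k: "n = 2 * k + 1" by (rule oddE)
    have "real (cnt n) \<le> D * cnt (2 * k)"
      using cnt_odd[of k] unfolding k D_def by (metis of_nat_le_iff of_nat_mult)
    also have "\<dots> \<le> D * (r * D) ^ (2 * k)" using even[of k] D by (intro mult_left_mono) auto
    also have "\<dots> = (1 / r) * (r * D) ^ n" using r0 by (simp add: k)
    finally show ?thesis .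
  qed
  then show ?thesis using r0 r1 by (intro exI[of _ "1 / r"] exI[of _ r]) (simp add: D_def)
qed

end

text \<open>The mean is restricted to the cosets inside \<open>H\<close> and renormalised. It is
  invariant on the right whereas \<open>amenable\<close> asks for invariance on the left, hence the
  inversion in \<open>\<mu>\<close>.\<close>

theorem (in schreier) amenable_quotient:
  assumes H: "finite_index_subgroup H G" and NH: "N \<lhd> G\<lparr>carrier := H\<rparr>"
    and m: "coset_mean m"
  shows "amenable (G\<lparr>carrier := H\<rparr> Mod N)"
proof -
  let ?K = "G\<lparr>carrier := H\<rparr>" and ?Q = "G\<lparr>carrier := H\<rparr> Mod N"
  have Hsub: "subgroup H G" and Hfin: "finite (rcosets H)"
    using H by (simp_all add: finite_index_subgroup_def)
  interpret K: group ?K by (rule subgroup_imp_group[OF Hsub])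
  interpret Q: group ?Q by (rule normal.factorgroup_is_group[OF NH])
  have HG: "H \<subseteq> carrier G" by (rule subgroup.subset[OF Hsub])
  have NG: "N \<subseteq> carrier G" by (rule subgroup.subset[OF N])
  have rc: "N #>\<^bsub>?K\<^esub> h = N #> h" for h by (simp add: r_coset_def)
  have car: "carrier ?Q = (\<lambda>h. N #> h) ` H"
    by (auto simp: FactGroup_def RCOSETS_def rc)
  have Qsub: "carrier ?Q \<subseteq> rcosets N" using HG by (auto simp: car RCOSETS_def)
  have mult: "(N #> h) \<otimes>\<^bsub>?Q\<^esub> (N #> k) = (N #> h) #> k" if "h \<in> H" "k \<in> H" for h k
  proof -
    have "(N #> h) \<otimes>\<^bsub>?Q\<^esub> (N #> k) = N #> (h \<otimes> k)"
      using normal.rcos_sum[OF NH, of h k] that by (simp add: rc FactGroup_def)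
    then show ?thesis using that HG NG by (simp add: coset_mult_assoc subset_iff)
  qed
  have m0: "0 \<le> m U" and m1: "m (rcosets N) = 1" and mU: "U \<inter> V = {} \<Longrightarrow> m (U \<union> V) = m U + m V"
    and mt: "g \<in> carrier G \<Longrightarrow> U \<subseteq> rcosets N \<Longrightarrow> m ((\<lambda>c. c #> g) ` U) = m U" for U V g
    using m by (auto simp: coset_mean_def)
  have mono: "m U \<le> m V" if "U \<subseteq> V" for U V
    using mU[of U "V - U"] m0[of "V - U"] that by (simp add: Un_absorb1)
  have sub: "m (U \<union> V) \<le> m U + m V" for U V
    using mU[of U "V - U"] mono[of "V - U" V] by simp
  \<comment> \<open>Otherwise all translates of this set are null, but those by representatives of
    the finitely many cosets of \<open>H\<close> cover everything.\<close>
  have pos: "0 < m (carrier ?Q)"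
  proof (rule ccontr)
    assume "\<not> ?thesis"
    then have z: "m (carrier ?Q) = 0" using m0[of "carrier ?Q"] by simp
    define rep where "rep c = (SOME g. g \<in> carrier G \<and> c = H #> g)" for c
    have rep: "rep c \<in> carrier G \<and> c = H #> rep c" if "c \<in> rcosets H" for c
      unfolding rep_def by (rule someI_ex) (use that in \<open>auto simp: RCOSETS_def\<close>)
    have "m (\<Union>c\<in>C. (\<lambda>d. d #> rep c) ` carrier ?Q) = 0" if "finite C" "C \<subseteq> rcosets H" for C
      using that
    proof (induction C rule: finite_induct)
      case empty
      show ?case using mU[of "{}" "{}"] by simp
    next
      case (insert c C)
      have "m ((\<lambda>d. d #> rep c) ` carrier ?Q) = 0"
        using mt[OF _ Qsub, of "rep c"] rep[of c] insert.prems z by simp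
      then show ?case
        using insert sub[of "(\<lambda>d. d #> rep c) ` carrier ?Q" "\<Union>c\<in>C. (\<lambda>d. d #> rep c) ` carrier ?Q"]
          m0[of "\<Union>c\<in>insert c C. (\<lambda>d. d #> rep c) ` carrier ?Q"] by simp
    qed
    then have "m (\<Union>c\<in>rcosets H. (\<lambda>d. d #> rep c) ` carrier ?Q) = 0"
      using Hfin by blast
    moreover have "rcosets N \<subseteq> (\<Union>c\<in>rcosets H. (\<lambda>d. d #> rep c) ` carrier ?Q)"
    proof
      fix d assume "d \<in> rcosets N"
      then obtain g where g: "g \<in> carrier G" "d = N #> g" by (auto simp: RCOSETS_def)
      let ?c = "H #> g"
      have c: "?c \<in> rcosets H" using g by (auto simp: RCOSETS_def)
      have r: "rep ?c \<in> carrier G" "H #> g = H #> rep ?c" using rep[OF c] by auto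
      define h where "h = g \<otimes> inv (rep ?c)"
      have h: "h \<in> H" unfolding h_def using coset_eq_iff[OF Hsub g(1) r(1)] r(2) by simp
      then have hG: "h \<in> carrier G" using HG by blast
      have "g = h \<otimes> rep ?c" using g(1) r(1) by (simp add: h_def m_assoc)
      then have "d = (N #> h) #> rep ?c"
        using g(2) hG r(1) NG by (simp add: coset_mult_assoc)
      then show "d \<in> (\<Union>c\<in>rcosets H. (\<lambda>d. d #> rep c) ` carrier ?Q)"
        using c h by (auto simp: car)
    qed
    ultimately show False using mono m1 m0 by (metis not_one_le_zero)
  qed
  let ?\<iota> = "\<lambda>c. inv\<^bsub>?Q\<^esub> c"
  define \<mu> where "\<mu> U = m (?\<iota> ` U) / m (carrier ?Q)" for U
  have inj: "inj_on ?\<iota> (carrier ?Q)"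
    by (rule inj_onI) (metis Q.inv_inv)
  have img: "?\<iota> ` carrier ?Q = carrier ?Q"
    by (auto simp: image_iff) (metis Q.inv_closed Q.inv_inv)
  show ?thesis
    unfolding amenable_def
  proof (intro exI[of _ \<mu>] conjI allI impI ballI)
    show "\<mu> (carrier ?Q) = 1" using pos by (simp add: \<mu>_def img)
    show "0 \<le> \<mu> U" for U using m0 pos by (simp add: \<mu>_def)
    show "\<mu> (U \<union> V) = \<mu> U + \<mu> V"
      if "U \<subseteq> carrier ?Q" "V \<subseteq> carrier ?Q" "U \<inter> V = {}" for U V
    proof -
      have "?\<iota> ` U \<inter> ?\<iota> ` V = {}" using that inj by (metis image_empty inj_on_image_Int)
      then show ?thesis by (simp add: \<mu>_def image_Un mU add_divide_distrib)
    qed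
    show "\<mu> (g <#\<^bsub>?Q\<^esub> U) = \<mu> U" if g: "g \<in> carrier ?Q" and U: "U \<subseteq> carrier ?Q" for g U
    proof -
      obtain h where h: "h \<in> H" "inv\<^bsub>?Q\<^esub> g = N #> h"
        using Q.inv_closed[OF g] by (auto simp: car)
      have "?\<iota> (g \<otimes>\<^bsub>?Q\<^esub> u) = ?\<iota> u #> h" if u: "u \<in> U" for u
      proof -
        have uQ: "u \<in> carrier ?Q" using u U by blast
        obtain k where k: "k \<in> H" "?\<iota> u = N #> k"
          using Q.inv_closed[OF uQ] by (auto simp: car)
        show ?thesis using Q.inv_mult_group[OF g uQ] mult[OF k(1) h(1)] h(2) k(2) by simp
      qed
      then have "?\<iota> ` (g <#\<^bsub>?Q\<^esub> U) = (\<lambda>c. c #> h) ` (?\<iota> ` U)"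
        by (auto simp: l_coset_def image_iff)
      moreover have "?\<iota> ` U \<subseteq> rcosets N" using U Q.inv_closed Qsub by blast
      ultimately show ?thesis using mt h(1) HG by (auto simp: \<mu>_def)
    qed
  qed
qed

section \<open>Average-case complexity\<close>

text \<open>A length-invariant measure is constant on the words of each length, so a bound on the
  uniform average for each length serves all these measures with the same \<open>C\<close>.\<close>

lemma average_time:
  assumes M: "decides M X D" and X: "finite X" and f: "mono f" "\<And>n. 0 < f n"
    and C: "0 < C" "\<And>n. (\<Sum>w | set w \<subseteq> X \<and> length w = n. real (tm_time M w)) \<le> C * f n * real (card X) ^ n"
  shows "solves_with_average_time M X D (length_invariant_measures X) f"
  unfolding solves_with_average_time_def
proof (intro conjI M f(1) allI f(2) exI[of _ C] C(1) ballI)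
  fix \<mu> assume \<mu>: "\<mu> \<in> length_invariant_measures X"
  then have \<mu>0: "0 \<le> \<mu> w" if "w \<in> lists X" for w
    using that by (simp add: length_invariant_measures_def discrete_prob_measure_def)
  have sum1: "(\<mu> has_sum 1) (lists X)"
    using \<mu> by (simp add: length_invariant_measures_def discrete_prob_measure_def)
  have inv: "\<And>w w'. w \<in> lists X \<Longrightarrow> w' \<in> lists X \<Longrightarrow>
      length w = length w' \<Longrightarrow> \<mu> w = \<mu> w'"
    using \<mu> unfolding length_invariant_measures_def length_invariant_def mem_Collect_eq by metis
  let ?W = "\<lambda>n. {w. set w \<subseteq> X \<and> length w = n}"
  let ?g = "\<lambda>w. real (tm_time M w) / f (length w) * \<mu> w"
  have finW: "finite (?W n)" for n by (rule finite_lists_length_eq[OF X])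
  have inW: "w \<in> lists X" if "w \<in> ?W n" for w n using that by auto
  have g0: "0 \<le> ?g w" if "w \<in> lists X" for w
    using \<mu>0[OF that] f(2)[of "length w"] by simp
  have layer: "(\<Sum>w\<in>?W n. ?g w) \<le> C * (\<Sum>w\<in>?W n. \<mu> w)" for n
  proof (cases "?W n = {}")
    case False
    then obtain v where v: "v \<in> ?W n" by blast
    have e: "\<mu> w = \<mu> v" if "w \<in> ?W n" for w
      using inv[OF inW[OF that] inW[OF v]] that v by simp
    have "(\<Sum>w\<in>?W n. ?g w) = (\<Sum>w\<in>?W n. real (tm_time M w) * (\<mu> v / f n))"
      using e by (intro sum.cong refl) auto
    also have "\<dots> = (\<Sum>w\<in>?W n. real (tm_time M w)) * (\<mu> v / f n)"
      by (rule sum_distrib_right[symmetric])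
    also have "\<dots> \<le> (C * f n * real (card X) ^ n) * (\<mu> v / f n)"
      using C(2)[of n] \<mu>0[OF inW[OF v]] f(2)[of n] by (intro mult_right_mono) auto
    also have "\<dots> = C * (real (card X) ^ n * \<mu> v)"
      using f(2)[of n] by simp
    also have "real (card X) ^ n * \<mu> v = (\<Sum>w\<in>?W n. \<mu> v)"
      by (simp add: card_lists_length_eq[OF X])
    also have "\<dots> = (\<Sum>w\<in>?W n. \<mu> w)" using e by (intro sum.cong refl) auto
    finally show ?thesis .
  next
    case True
    show ?thesis by (simp only: True sum.empty mult_zero_right order_refl)
  qed
  have bound: "sum ?g F \<le> C" if F: "finite F" "F \<subseteq> lists X" for F
  proof -
    define m where "m = Max (insert 0 (length ` F))"
    have "F \<subseteq> (\<Union>n\<le>m. ?W n)"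
    proof
      fix w assume w: "w \<in> F"
      then have "length w \<le> m" unfolding m_def using F(1) by (intro Max_ge) auto
      then show "w \<in> (\<Union>n\<le>m. ?W n)" using w F(2) by auto
    qed
    then have "sum ?g F \<le> sum ?g (\<Union>n\<le>m. ?W n)"
      using finW g0 inW by (intro sum_mono2) auto
    also have "\<dots> = (\<Sum>n\<le>m. \<Sum>w\<in>?W n. ?g w)"
      using finW by (intro sum.UNION_disjoint) auto
    also have "\<dots> \<le> (\<Sum>n\<le>m. C * (\<Sum>w\<in>?W n. \<mu> w))"
      by (intro sum_mono layer)
    also have "\<dots> = C * (\<Sum>n\<le>m. \<Sum>w\<in>?W n. \<mu> w)"
      by (simp add: sum_distrib_left)
    also have "(\<Sum>n\<le>m. \<Sum>w\<in>?W n. \<mu> w) = sum \<mu> (\<Union>n\<le>m. ?W n)"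
      using finW by (intro sum.UNION_disjoint[symmetric]) auto
    also have "C * \<dots> \<le> C * infsum \<mu> (lists X)"
    proof (rule mult_left_mono)
      show "sum \<mu> (\<Union>n\<le>m. ?W n) \<le> infsum \<mu> (lists X)"
        using finW \<mu>0 sum1 by (intro finite_sum_le_infsum) (auto simp: summable_on_def)
    qed (use C(1) in simp)
    also have "infsum \<mu> (lists X) = 1" using sum1 by (rule infsumI)
    finally show ?thesis by simp
  qed
  show "?g summable_on lists X"
    using g0 bound by (intro nonneg_bdd_above_summable_on bdd_aboveI2[of _ _ C]) auto
  then show "infsum ?g (lists X) \<le> C"
    using bound by (rule infsum_le_finite_sums)
qed

lemma subexponential_bound:
  assumes f: "subexponential f" and s: "1 < s"
  shows "\<exists>K. 0 \<le> K \<and> (\<forall>n. f n \<le> K * s ^ n)"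
proof -
  have "(\<lambda>n. f n / s ^ n) \<longlonglongrightarrow> 0" using f s by (simp add: subexponential_def)
  then obtain K where K: "\<And>n. norm (f n / s ^ n) \<le> K"
    using convergent_imp_Bseq BseqE by (metis convergentI)
  have "0 \<le> K" using order_trans[OF norm_ge_zero K[of 0]] .
  moreover have "f n \<le> K * s ^ n" for n
    using K[of n] s by (simp add: abs_divide divide_le_eq)
  ultimately show ?thesis by blast
qed

lemma decides_cong:
  assumes "decides M X D" "\<And>w. w \<in> lists X \<Longrightarrow> w \<in> D \<longleftrightarrow> w \<in> D'"
  shows "decides M X D'"
  using assms by (simp add: decides_def)

section \<open>Rewriting words of the group into words of the quotient\<close>

locale filtered_word_problem = G: schreier G A \<pi> N + Q: fg_group Q B \<rho>
  for G :: "('g, 'm) monoid_scheme" (structure) and A :: "'a set" and \<pi> and N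
    and Q :: "('g set, 'n) monoid_scheme" and B :: "nat set" and \<rho> +
  fixes H :: "'g set"
  assumes H: "finite_index_subgroup H G" and NH: "N \<lhd> G\<lparr>carrier := H\<rparr>"
    and Q_carrier: "carrier Q = (\<lambda>h. N #> h) ` H"
    and Q_mult: "\<And>h k. h \<in> H \<Longrightarrow> k \<in> H \<Longrightarrow>
      (N #> h) \<otimes>\<^bsub>Q\<^esub> (N #> k) = N #> (h \<otimes> k)"
    and Q_one: "\<one>\<^bsub>Q\<^esub> = N"
begin

lemma H_sub: "subgroup H G" "finite (rcosets H)"
  using H by (simp_all add: finite_index_subgroup_def)

lemma N_sub_H: "N \<subseteq> H"
  using subgroup.subset[OF normal_imp_subgroup[OF NH]] by simp

text \<open>Rewriting with coset representatives turns a word in \<open>X\<close> into the image in \<open>Q\<close> of an element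
  of \<open>H\<close>.\<close>

definition rep :: "'g set \<Rightarrow> 'g"
  where "rep c = (if c = H then \<one> else SOME g. g \<in> carrier G \<and> c = H #> g)"

lemma rep:
  assumes "c \<in> rcosets H"
  shows "rep c \<in> carrier G" "c = H #> rep c"
proof -
  have "\<exists>g. g \<in> carrier G \<and> c = H #> g" using assms by (auto simp: RCOSETS_def)
  from someI_ex[OF this] show "rep c \<in> carrier G" "c = H #> rep c"
    using subgroup.subset[OF H_sub(1)] by (auto simp: rep_def)
qed

abbreviation nxt :: "'g set \<Rightarrow> 'a + 'a \<Rightarrow> 'g set" where "nxt c x \<equiv> c #> letter_val G \<pi> x"

text \<open>The Schreier generator of the coset \<open>c\<close> and the element \<open>g\<close>.
  It satisfies the cocycle identity \<open>schreier_elt_mult\<close>, which makes letterwise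
  rewriting correct.\<close>

definition schreier_elt :: "'g set \<Rightarrow> 'g \<Rightarrow> 'g"
  where "schreier_elt c g = rep c \<otimes> g \<otimes> inv (rep (c #> g))"

lemma coset_move:
  assumes "c \<in> rcosets H" "g \<in> carrier G"
  shows "c #> g \<in> rcosets H" "c #> g = H #> (rep c \<otimes> g)"
proof -
  have "c #> g = (H #> rep c) #> g" using rep(2)[OF assms(1)] by simp
  then show e: "c #> g = H #> (rep c \<otimes> g)"
    using rep(1)[OF assms(1)] assms(2) subgroup.subset[OF H_sub(1)] by (simp add: G.coset_mult_assoc)
  show "c #> g \<in> rcosets H"
    unfolding e using rep(1)[OF assms(1)] assms(2) subgroup.subset[OF H_sub(1)]
    by (intro G.rcosetsI) auto
qed

lemma schreier_elt_in:
  assumes "c \<in> rcosets H" "g \<in> carrier G"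
  shows "schreier_elt c g \<in> H"
proof -
  let ?d = "c #> g"
  have "H #> (rep c \<otimes> g) = H #> rep ?d"
    using coset_move[OF assms] rep(2)[of ?d] by simp
  then show ?thesis
    using G.coset_eq_iff[OF H_sub(1), of "rep c \<otimes> g" "rep ?d"] rep(1)[OF assms(1)]
      rep(1)[OF coset_move(1)[OF assms]] assms(2)
    by (simp add: schreier_elt_def)
qed

lemma schreier_elt_mult:
  assumes "c \<in> rcosets H" "g \<in> carrier G" "h \<in> carrier G"
  shows "schreier_elt c (g \<otimes> h) = schreier_elt c g \<otimes> schreier_elt (c #> g) h"
proof -
  have "c \<subseteq> carrier G" using subgroup.rcosets_carrier[OF H_sub(1) G.is_group] assms(1) by blast
  then have "c #> (g \<otimes> h) = (c #> g) #> h"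
    using assms by (simp add: G.coset_mult_assoc)
  then show ?thesis
    using rep(1)[OF assms(1)] rep(1)[OF coset_move(1)[OF assms(1,2)]] assms
      rep(1)[OF coset_move(1)[OF coset_move(1)[OF assms(1,2)] assms(3)]]
    by (simp add: schreier_elt_def G.m_assoc)
qed

definition out :: "'g set \<Rightarrow> 'a + 'a \<Rightarrow> (nat + nat) list"
  where "out c x = (SOME u. u \<in> lists Q.X \<and> Q.val u = N #> schreier_elt c (letter_val G \<pi> x))"

lemma out:
  assumes "c \<in> rcosets H" "x \<in> G.X"
  shows "out c x \<in> lists Q.X" "Q.val (out c x) = N #> schreier_elt c (letter_val G \<pi> x)"
proof -
  have "N #> schreier_elt c (letter_val G \<pi> x) \<in> carrier Q"
    unfolding Q_carrier using schreier_elt_in[OF assms(1)] assms(2) by simp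
  then have "\<exists>u. u \<in> lists Q.X \<and> Q.val u = N #> schreier_elt c (letter_val G \<pi> x)"
    using Q.val_surj by metis
  from someI_ex[OF this] show "out c x \<in> lists Q.X"
    "Q.val (out c x) = N #> schreier_elt c (letter_val G \<pi> x)" by (simp_all add: out_def)
qed

lemma foldl_nxt:
  assumes "c \<in> rcosets H" "w \<in> lists G.X"
  shows "foldl nxt c w = c #> G.val w"
  using assms(2,1)
proof (induction w arbitrary: c rule: list.induct)
  case Nil
  then show ?case
    using subgroup.rcosets_carrier[OF H_sub(1) G.is_group] by (simp add: G.coset_mult_one)
next
  case (Cons x w)
  then have x: "x \<in> G.X" "w \<in> lists G.X" by auto
  have "c \<subseteq> carrier G" using subgroup.rcosets_carrier[OF H_sub(1) G.is_group] Cons.prems(2) by blast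
  then show ?case
    using Cons.IH[OF x(2) coset_move(1)[OF Cons.prems(2) G.letter_closed[OF x(1)]]]
      G.letter_closed[OF x(1)] G.val_closed[OF x(2)]
    by (simp add: G.coset_mult_assoc)
qed

lemma val_transduce:
  assumes "c \<in> rcosets H" "w \<in> lists G.X"
  shows "transduce nxt out c w \<in> lists Q.X \<and>
    Q.val (transduce nxt out c w) = N #> schreier_elt c (G.val w)"
  using assms(2,1)
proof (induction w arbitrary: c rule: list.induct)
  case Nil
  have "schreier_elt c \<one> = \<one>"
    using rep(1)[OF Nil.prems(2)] subgroup.rcosets_carrier[OF H_sub(1) G.is_group Nil.prems(2)]
    by (simp add: schreier_elt_def G.coset_mult_one)
  then show ?case using G.coset_mult_one[OF subgroup.subset[OF G.N]] by (simp add: Q_one)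
next
  case (Cons x w)
  then have x: "x \<in> G.X" "w \<in> lists G.X" by auto
  note lx = G.letter_closed[OF x(1)] and vw = G.val_closed[OF x(2)]
  note c' = coset_move(1)[OF Cons.prems(2) lx]
  have IH: "transduce nxt out (nxt c x) w \<in> lists Q.X"
    "Q.val (transduce nxt out (nxt c x) w) = N #> schreier_elt (nxt c x) (G.val w)"
    using Cons.IH[OF x(2) c'] by auto
  have "Q.val (transduce nxt out c (x # w)) =
      (N #> schreier_elt c (letter_val G \<pi> x)) \<otimes>\<^bsub>Q\<^esub> (N #> schreier_elt (nxt c x) (G.val w))"
    using Q.val_append[OF out(1)[OF Cons.prems(2) x(1)] IH(1)] IH(2) out(2)[OF Cons.prems(2) x(1)]
    by simp
  also have "\<dots> = N #> schreier_elt c (G.val (x # w))"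
    using Q_mult[OF schreier_elt_in[OF Cons.prems(2) lx] schreier_elt_in[OF c' vw]]
      schreier_elt_mult[OF Cons.prems(2) lx vw] by simp
  finally show ?case using out(1)[OF Cons.prems(2) x(1)] IH(1) by simp
qed

lemma H_rcoset: "H \<in> rcosets H"
  by (rule subgroup.subgroup_in_rcosets[OF H_sub(1) G.is_group])

text \<open>The coset automaton returns to \<open>H\<close> exactly for values in \<open>H\<close>.
  For these the rewritten word represents the coset of the value itself, because the representative
  of \<open>H\<close> is \<open>\<one>\<close>.\<close>

lemma in_N_iff:
  assumes w: "w \<in> lists G.X"
  shows "foldl nxt H w \<in> {H} \<and> transduce nxt out H w \<in> WP Q B \<rho> \<longleftrightarrow> G.val w \<in> N"
proof -
  note vw = G.val_closed[OF w]
  have "foldl nxt H w = H \<longleftrightarrow> G.val w \<in> H"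
    unfolding foldl_nxt[OF H_rcoset w]
    using G.coset_join1[OF _ vw H_sub(1)] G.coset_join2[OF vw H_sub(1)]
      subgroup.subset[OF H_sub(1)] by blast
  moreover have "transduce nxt out H w \<in> WP Q B \<rho> \<longleftrightarrow> G.val w \<in> N" if "G.val w \<in> H"
  proof -
    have "H #> G.val w = H" using that G.coset_join2[OF vw H_sub(1)] by blast
    then have "schreier_elt H (G.val w) = G.val w"
      using vw by (simp add: schreier_elt_def rep_def)
    then have "transduce nxt out H w \<in> WP Q B \<rho> \<longleftrightarrow> N #> G.val w = N"
      using val_transduce[OF H_rcoset w] by (simp add: WP_def Q_one)
    also have "\<dots> \<longleftrightarrow> G.val w \<in> N"
      using G.coset_join1[OF _ vw G.N] G.coset_join2[OF vw G.N] subgroup.subset[OF G.N] by blast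
    finally show ?thesis .
  qed
  ultimately show ?thesis using N_sub_H by blast
qed

text \<open>The filter costs at most \<open>c2\<close> times the polynomial. The second decider
  costs at most \<open>K * (1 / r) ^ n\<close> and runs on a fraction of at most
  \<open>C * r ^ n\<close> of the words of length \<open>n\<close>, so the exponentials
  cancel.\<close>

theorem average_case:
  assumes M1: "decides M1 Q.X (WP Q B \<rho>)"
      "\<And>w. w \<in> lists Q.X \<Longrightarrow> tm_time M1 w \<le> c1 * (length w + 1) ^ e" and e: "1 \<le> e"
    and wp: "word_problem_subexponential G"
    and growth: "0 < r" "r < 1" "\<And>n. real (G.cnt n) \<le> C * (r * real (card G.X)) ^ n"
  shows "\<exists>M. solves_with_average_time M G.X (WP G A \<pi>) (length_invariant_measures G.X)
    (\<lambda>n. (real n + 1) ^ e)"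
proof -
  obtain A' :: "nat set" and \<pi>' M2 f where A': "finite_generating_set G A' \<pi>'"
    and M2: "decides M2 (signed_letters A') (WP G A' \<pi>')" and f: "subexponential f"
    and T2: "\<And>w. w \<in> lists (signed_letters A') \<Longrightarrow> real (tm_time M2 w) \<le> f (length w)"
    using wp unfolding word_problem_subexponential_def solvable_in_subexponential_time_def by metis
  interpret G': fg_group G A' \<pi>' by unfold_locales (rule A')
  \<comment> \<open>The subexponential bound is available for the generators \<open>A'\<close>, so
    each letter of \<open>G.X\<close> is spelled out in them.\<close>
  have "\<exists>u. u \<in> lists G'.X \<and> G'.val u = letter_val G \<pi> x" if "x \<in> G.X" for x
    using G'.val_surj[OF G.letter_closed[OF that]] by metis
  then obtain tr where tr: "\<And>x. x \<in> G.X \<Longrightarrow> tr x \<in> lists G'.X \<and> G'.val (tr x) = letter_val G \<pi> x"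
    by metis
  define out2 where "out2 = (\<lambda>(c :: 'g set) x. tr x)"
  have val2: "transduce nxt out2 c w \<in> lists G'.X \<and> G'.val (transduce nxt out2 c w) = G.val w"
    if "w \<in> lists G.X" for c w
    using that
  proof (induction w arbitrary: c rule: list.induct)
    case (Cons x w)
    then have x: "x \<in> G.X" "w \<in> lists G.X" by auto
    then show ?case
      using Cons.IH[OF x(2)] tr[OF x(1)] by (simp add: out2_def G'.val_append del: in_lists_conv_set)
  qed simp
  interpret F: filter_machine G.X M1 Q.X "WP Q B \<rho>" M2 G'.X "WP G A' \<pi>'" "rcosets H" "{H}" H
      nxt out out2
  proof
    show "finite G.X" by (rule G.finite_X)
    show "finite (rcosets H)" by (rule H_sub(2))
    show "H \<in> rcosets H" by (rule H_rcoset)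
    show "nxt c x \<in> rcosets H" if "c \<in> rcosets H" "x \<in> G.X" for c x
      using coset_move(1)[OF that(1) G.letter_closed[OF that(2)]] .
    show "out c x \<in> lists Q.X" if "c \<in> rcosets H" "x \<in> G.X" for c x
      using out(1)[OF that] .
    show "out2 c x \<in> lists G'.X" if "x \<in> G.X" for c x
      using tr[OF that] by (simp add: out2_def)
  qed (rule M1 M2)+
  obtain M where M: "decides M G.X {w. foldl nxt H w \<in> {H} \<and> F.o1 w \<in> WP Q B \<rho> \<and> F.o2 w \<in> WP G A' \<pi>'}"
    and T: "\<And>w. w \<in> lists G.X \<Longrightarrow> tm_time M w \<le> (4 * F.bound + 8) * (length w + 1) + tm_time M1 (F.o1 w) +
      (if foldl nxt H w \<in> {H} \<and> F.o1 w \<in> WP Q B \<rho> then tm_time M2 (F.o2 w) else 0)"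
    using F.filter_realisable by blast
  have dec: "decides M G.X (WP G A \<pi>)"
  proof (rule decides_cong[OF M])
    fix w assume w: "w \<in> lists G.X"
    have "foldl nxt H w \<in> {H} \<and> F.o1 w \<in> WP Q B \<rho> \<longleftrightarrow> G.val w \<in> N"
      by (rule in_N_iff[OF w])
    moreover have "F.o2 w \<in> WP G A' \<pi>' \<longleftrightarrow> G.val w = \<one>"
      using val2[OF w, of H] by (simp add: WP_def del: in_lists_conv_set)
    moreover have "w \<in> WP G A \<pi> \<longleftrightarrow> G.val w = \<one>"
      using w by (simp add: WP_def del: in_lists_conv_set)
    ultimately show "w \<in> {w. foldl nxt H w \<in> {H} \<and> F.o1 w \<in> WP Q B \<rho> \<and> F.o2 w \<in> WP G A' \<pi>'}
        \<longleftrightarrow> w \<in> WP G A \<pi>"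
      using subgroup.one_closed[OF G.N] by auto
  qed
  define b where "b = F.bound"
  \<comment> \<open>A translated word is at most \<open>b\<close> times as long as the original.
    Taking \<open>Suc b\<close> gives a genuine root also for \<open>b = 0\<close> and turns the
    bound for the second decider into \<open>K * (1 / r) ^ n\<close>.\<close>
  define s where "s = root (Suc b) (1 / r)"
  have s1: "1 < s" using growth(1,2) by (simp add: s_def)
  have sb: "s ^ Suc b = 1 / r" using growth(1) unfolding s_def by (intro real_root_pow_pos2) auto
  obtain K where K: "0 \<le> K" "\<And>n. f n \<le> K * s ^ n"
    using subexponential_bound[OF f s1] by blast
  have len: "length (F.o1 w) \<le> b * length w" "length (F.o2 w) \<le> b * length w"
    if "w \<in> lists G.X" for w
    using F.transduce_in[OF H_rcoset that] by (auto simp: b_def)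
  have T2': "real (tm_time M2 (F.o2 w)) \<le> K * (1 / r) ^ length w" if w: "w \<in> lists G.X" for w
  proof -
    have "real (tm_time M2 (F.o2 w)) \<le> K * s ^ length (F.o2 w)"
      using T2[of "F.o2 w"] val2[OF w] K(2) order_trans by blast
    also have "\<dots> \<le> K * s ^ (Suc b * length w)"
      using len(2)[OF w] s1 K(1) by (intro mult_left_mono power_increasing) auto
    also have "\<dots> = K * (1 / r) ^ length w"
      by (simp only: power_mult sb)
    finally show ?thesis .
  qed
  define c2 where "c2 = (4 * b + 8) + c1 * (b + 1) ^ e"
  have T': "real (tm_time M w) \<le> real c2 * (real (length w) + 1) ^ e +
      (if G.val w \<in> N then K * (1 / r) ^ length w else 0)" if w: "w \<in> lists G.X" for w
  proof -
    let ?n = "length w"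
    have "tm_time M1 (F.o1 w) \<le> c1 * (length (F.o1 w) + 1) ^ e"
      using M1(2) val_transduce[OF H_rcoset w] by blast
    also have "\<dots> \<le> c1 * ((b + 1) * (?n + 1)) ^ e"
      using len(1)[OF w] by (intro mult_le_mono2 power_mono) (simp_all add: algebra_simps)
    also have "\<dots> = c1 * (b + 1) ^ e * (?n + 1) ^ e" by (simp only: power_mult_distrib mult.assoc)
    finally have 1: "tm_time M1 (F.o1 w) \<le> c1 * (b + 1) ^ e * (?n + 1) ^ e" .
    have "(?n + 1) ^ 1 \<le> (?n + 1) ^ e" using e by (intro power_increasing) auto
    then have "(4 * b + 8) * (?n + 1) \<le> (4 * b + 8) * (?n + 1) ^ e" by (intro mult_le_mono2) simp
    with 1 have "(4 * b + 8) * (?n + 1) + tm_time M1 (F.o1 w) \<le> c2 * (?n + 1) ^ e"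
      unfolding c2_def add_mult_distrib by (rule add_mono[rotated])
    then have "tm_time M w \<le> c2 * (?n + 1) ^ e + (if G.val w \<in> N then tm_time M2 (F.o2 w) else 0)"
      using T[OF w] in_N_iff[OF w] unfolding b_def by auto
    then have "real (tm_time M w) \<le> real (c2 * (?n + 1) ^ e) +
        (if G.val w \<in> N then real (tm_time M2 (F.o2 w)) else 0)"
      by (auto simp: of_nat_add[symmetric] simp del: of_nat_add of_nat_mult of_nat_power split: if_splits)
    also have "\<dots> \<le> real (c2 * (?n + 1) ^ e) + (if G.val w \<in> N then K * (1 / r) ^ length w else 0)"
      using T2'[OF w] by simp
    also have "real (c2 * (?n + 1) ^ e) = real c2 * (real ?n + 1) ^ e" by (simp add: add.commute)
    finally show ?thesis .
  qed
  have C0: "0 \<le> C" using growth(3)[of 0] by (metis mult.right_neutral of_nat_0_le_iff order_trans power_0)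
  \<comment> \<open>The summand 1 ensures \<open>0 < D\<close>, as \<open>average_time\<close>
    requires.\<close>
  define D where "D = real c2 + K * C + 1"
  have D: "0 < D" using K(1) C0 by (simp add: D_def add_nonneg_pos)
  have "solves_with_average_time M G.X (WP G A \<pi>) (length_invariant_measures G.X) (\<lambda>n. (real n + 1) ^ e)"
  proof (rule average_time[OF dec G.finite_X _ _ D])
    show "mono (\<lambda>n. (real n + 1) ^ e)" by (intro monoI power_mono) auto
    show "0 < (real n + 1) ^ e" for n by simp
    fix n
    let ?d = "real (card G.X) ^ n" and ?p = "(real n + 1) ^ e"
    have p1: "1 \<le> ?p" by (rule one_le_power) simp
    have "(\<Sum>w\<in>G.words n. real (tm_time M w)) \<le>
        (\<Sum>w\<in>G.words n. real c2 * ?p + (if G.val w \<in> N then K * (1 / r) ^ n else 0))"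
    proof (rule sum_mono)
      fix w assume w: "w \<in> G.words n"
      then have lw: "length w = n" by (simp add: G.words_def)
      show "real (tm_time M w) \<le> real c2 * ?p + (if G.val w \<in> N then K * (1 / r) ^ n else 0)"
        using T'[OF G.words_lists[OF w]] unfolding lw .
    qed
    also have "\<dots> = real c2 * ?p * ?d + K * (1 / r) ^ n * real (G.cnt n)"
    proof -
      have "(\<Sum>w\<in>G.words n. if G.val w \<in> N then K * (1 / r) ^ n else 0) =
          (\<Sum>w\<in>{w \<in> G.words n. G.val w \<in> N}. K * (1 / r) ^ n)"
        by (rule sum.inter_filter[OF G.finite_words, symmetric])
      then show ?thesis by (simp add: sum.distrib G.card_words G.cnt_def)
    qed
    also have "\<dots> \<le> real c2 * ?p * ?d + K * (1 / r) ^ n * (C * (r * real (card G.X)) ^ n)"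
      using growth K(1) by (intro add_left_mono mult_left_mono) auto
    also have "K * (1 / r) ^ n * (C * (r * real (card G.X)) ^ n) = K * C * ?d"
      using growth(1) by (simp add: power_mult_distrib power_divide)
    also have "real c2 * ?p * ?d + K * C * ?d \<le> D * ?p * ?d"
    proof -
      have "K * C * 1 \<le> K * C * ?p" using p1 K(1) C0 by (intro mult_left_mono) auto
      moreover have "D * ?p = real c2 * ?p + K * C * ?p + ?p" by (simp add: D_def algebra_simps)
      ultimately have "real c2 * ?p + K * C \<le> D * ?p" using p1 by linarith
      then show ?thesis by (simp add: mult_right_mono flip: distrib_right)
    qed
    finally show "(\<Sum>w | set w \<subseteq> G.X \<and> length w = n. real (tm_time M w)) \<le> D * ?p * ?d"
      by (simp add: G.words_def)
  qed
  then show ?thesis ..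
qed

end

text \<open>Non-amenability of the quotient excludes a mean on the cosets of \<open>N\<close>, which
  gives the exponential decay that \<open>average_case\<close> needs; the exponent \<open>e\<close>
  is left open to serve both claims.\<close>

lemma average_case_quotient:
  fixes G :: "('g, 'm) monoid_scheme" and A :: "'a set" and B :: "nat set"
  assumes G: "group G" and A: "finite_generating_set G A \<pi>" and wp: "word_problem_subexponential G"
    and H: "finite_index_subgroup H G" and NH: "N \<lhd> G\<lparr>carrier := H\<rparr>"
    and na: "\<not> amenable (G\<lparr>carrier := H\<rparr> Mod N)"
    and B: "finite_generating_set (G\<lparr>carrier := H\<rparr> Mod N) B \<rho>"
    and M1: "decides M1 (signed_letters B) (WP (G\<lparr>carrier := H\<rparr> Mod N) B \<rho>)"
      "\<And>w. w \<in> lists (signed_letters B) \<Longrightarrow> tm_time M1 w \<le> c1 * (length w + 1) ^ e" and e: "1 \<le> e"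
  shows "\<exists>M. solves_with_average_time M (signed_letters A) (WP G A \<pi>)
    (length_invariant_measures (signed_letters A)) (\<lambda>n. (real n + 1) ^ e)"
proof -
  interpret G: group G by (rule G)
  let ?K = "G\<lparr>carrier := H\<rparr>"
  let ?Q = "?K Mod N"
  have Hsub: "subgroup H G" using H by (simp add: finite_index_subgroup_def)
  have Nsub: "subgroup N G"
    using G.incl_subgroup[OF Hsub normal_imp_subgroup[OF NH]] .
  interpret Q: group ?Q by (rule normal.factorgroup_is_group[OF NH])
  have rc: "N #>\<^bsub>?K\<^esub> h = N #>\<^bsub>G\<^esub> h" for h by (simp add: r_coset_def)
  interpret W: filtered_word_problem G A \<pi> N ?Q B \<rho> H
  proof (intro filtered_word_problem.intro filtered_word_problem_axioms.intro schreier.intro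
      schreier_axioms.intro fg_group.intro fg_group_axioms.intro)
    show "carrier ?Q = (\<lambda>h. N #>\<^bsub>G\<^esub> h) ` H"
      by (auto simp: FactGroup_def RCOSETS_def rc)
    show "(N #>\<^bsub>G\<^esub> h) \<otimes>\<^bsub>?Q\<^esub> (N #>\<^bsub>G\<^esub> k) = N #>\<^bsub>G\<^esub> (h \<otimes>\<^bsub>G\<^esub> k)" if "h \<in> H" "k \<in> H" for h k
      using normal.rcos_sum[OF NH, of h k] that by (simp add: rc FactGroup_def)
    show "\<one>\<^bsub>?Q\<^esub> = N" by (simp add: FactGroup_def)
  qed (rule G.group_axioms Q.group_axioms A Nsub B H NH)+
  have nm: "\<nexists>m. W.G.coset_mean m" using W.G.amenable_quotient[OF H NH] na by blast
  have "\<exists>C r. 0 < r \<and> r < 1 \<and> (\<forall>n. real (W.G.cnt n) \<le> C * (r * real (card (signed_letters A))) ^ n)"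
  proof (cases "signed_letters A = {}")
    case True
    \<comment> \<open>Over an empty alphabet only the empty word exists; \<open>cnt_growth\<close>
      covers nonempty alphabets.\<close>
    have "real (W.G.cnt n) \<le> 1 * (1 / 2 * real (card (signed_letters A))) ^ n" for n
    proof -
      have "W.G.cnt n \<le> card (W.G.words n)"
        unfolding W.G.cnt_def using W.G.finite_words by (intro card_mono) auto
      then have "W.G.cnt n \<le> card (signed_letters A) ^ n" by (simp add: W.G.card_words)
      then show ?thesis using True by (cases n) auto
    qed
    then show ?thesis by (intro exI[of _ 1] exI[of _ "1 / 2"]) simp
  qed (use W.G.cnt_growth[OF _ nm] in blast)
  then obtain C r where "0 < r" "r < 1"
    "\<And>n. real (W.G.cnt n) \<le> C * (r * real (card (signed_letters A))) ^ n" by blast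
  then show ?thesis using W.average_case[OF M1 e wp] by blast
qed

text \<open>\<open>automatic_group\<close> yields an automaton for each suffix separately; a choice
  function bundles them into the parameters of the locale \<open>automatic\<close>.\<close>

lemma (in group) automatic_quadratic_time:
  assumes "automatic_group G"
  shows "\<exists>(B :: nat set) \<rho> M c. finite_generating_set G B \<rho> \<and>
    decides M (signed_letters B) (WP G B \<rho>) \<and>
    (\<forall>w\<in>lists (signed_letters B). tm_time M w \<le> c * (length w + 1) ^ 2)"
proof -
  obtain B :: "nat set" and \<rho> W where B: "finite_generating_set G B \<rho>"
    and W: "regular_language (signed_letters B) W" "word_val G \<rho> ` W = carrier G"
    and L: "\<forall>s \<in> insert [] ((\<lambda>x. [x]) ` signed_letters B).
      regular_language (padded_letters (signed_letters B))
        {pad_pair u v | u v. u \<in> W \<and> v \<in> W \<and> word_val G \<rho> (u @ s) = word_val G \<rho> v}"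
    using assms unfolding automatic_group_def by (elim exE conjE) (rule that)
  let ?S = "insert [] ((\<lambda>x. [x]) ` signed_letters B)"
  let ?P = "padded_letters (signed_letters B)"
  define ok where "ok s a \<longleftrightarrow> finite (fst a) \<and> fst (snd a) \<in> fst a \<and>
      (\<forall>q\<in>fst a. \<forall>z\<in>?P. snd (snd (snd a)) q z \<in> fst a) \<and>
      {pad_pair u v | u v. u \<in> W \<and> v \<in> W \<and> word_val G \<rho> (u @ s) = word_val G \<rho> v}
        = {z \<in> lists ?P. foldl (snd (snd (snd a))) (fst (snd a)) z \<in> fst (snd (snd a))}"
    for s and a :: "nat set \<times> nat \<times> nat set \<times> (nat \<Rightarrow> (nat + nat) option \<times> (nat + nat) option \<Rightarrow> nat)"
  have "\<forall>s\<in>?S. \<exists>a. ok s a"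
  proof
    fix s assume "s \<in> ?S"
    from bspec[OF L this] obtain Q :: "nat set" and q0 F \<delta> where "finite Q" "q0 \<in> Q"
      "\<forall>q\<in>Q. \<forall>z\<in>?P. \<delta> q z \<in> Q"
      "{pad_pair u v | u v. u \<in> W \<and> v \<in> W \<and> word_val G \<rho> (u @ s) = word_val G \<rho> v}
        = {z \<in> lists ?P. foldl \<delta> q0 z \<in> F}"
      unfolding regular_language_def by (elim exE conjE) (rule that)
    then have "ok s (Q, q0, F, \<delta>)" by (simp only: ok_def fst_conv snd_conv simp_thms)
    then show "\<exists>a. ok s a" ..
  qed
  then obtain a where a: "\<forall>s\<in>?S. ok s (a s)" by (rule exE[OF bchoice])
  interpret automatic G B \<rho> W "\<lambda>s. fst (a s)" "\<lambda>s. fst (snd (a s))"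
    "\<lambda>s. fst (snd (snd (a s)))" "\<lambda>s. snd (snd (snd (a s)))"
  proof unfold_locales
    show "finite_generating_set G B \<rho>" by (rule B)
    show "W \<subseteq> lists (signed_letters B)" using W(1) unfolding regular_language_def by blast
    show "word_val G \<rho> ` W = carrier G" by (rule W(2))
  next
    fix s assume s: "s \<in> ?S"
    note oks = bspec[OF a s, unfolded ok_def]
    show "finite (fst (a s)) \<and> fst (snd (a s)) \<in> fst (a s)" using oks by (elim conjE) (intro conjI)
    show "{pad_pair u v | u v. u \<in> W \<and> v \<in> W \<and> word_val G \<rho> (u @ s) = word_val G \<rho> v}
        = {z \<in> lists ?P. foldl (snd (snd (snd (a s)))) (fst (snd (a s))) z \<in> fst (snd (snd (a s)))}"
      using oks by (elim conjE)
    have "\<forall>q\<in>fst (a s). \<forall>z\<in>?P. snd (snd (snd (a s))) q z \<in> fst (a s)"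
      using oks by (elim conjE)
    then show "snd (snd (snd (a s))) q z \<in> fst (a s)" if "q \<in> fst (a s)" "z \<in> ?P" for q z
      using that by blast
  qed
  show ?thesis using quadratic_time B by blast
qed

theorem corollaryB:
  fixes G :: "('g, 'm) monoid_scheme" and A :: "'a set" and \<pi> :: "'a \<Rightarrow> 'g"
  assumes "group G"
    and "finitely_presented G"
    and "word_problem_subexponential G"
    and "finite_generating_set G A \<pi>"
  shows
    "((\<exists>H N. finite_index_subgroup H G \<and> N \<lhd> G\<lparr>carrier := H\<rparr> \<and>
         word_hyperbolic (G\<lparr>carrier := H\<rparr> Mod N) \<and>
         \<not> virtually_cyclic (G\<lparr>carrier := H\<rparr> Mod N))
      \<longrightarrow> linear_average_time (signed_letters A) (WP G A \<pi>)
            (length_invariant_measures (signed_letters A)))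
   \<and> ((\<exists>H N. finite_index_subgroup H G \<and> N \<lhd> G\<lparr>carrier := H\<rparr> \<and>
         automatic_group (G\<lparr>carrier := H\<rparr> Mod N) \<and>
         \<not> amenable (G\<lparr>carrier := H\<rparr> Mod N))
      \<longrightarrow> quadratic_average_time (signed_letters A) (WP G A \<pi>)
            (length_invariant_measures (signed_letters A)))"
proof (intro conjI impI; elim exE conjE)
  fix H N
  assume H: "finite_index_subgroup H G" "N \<lhd> G\<lparr>carrier := H\<rparr>"
    and hyp: "word_hyperbolic (G\<lparr>carrier := H\<rparr> Mod N)"
    and nvc: "\<not> virtually_cyclic (G\<lparr>carrier := H\<rparr> Mod N)"
  let ?Q = "G\<lparr>carrier := H\<rparr> Mod N"
  interpret Q: group ?Q by (rule normal.factorgroup_is_group[OF H(2)])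
  obtain B :: "nat set" and \<rho> where B: "finite_generating_set ?Q B \<rho>"
    "gromov_hyperbolic (carrier ?Q) (word_dist ?Q B \<rho>)"
    using hyp unfolding word_hyperbolic_def by blast
  obtain \<delta> where "hyp_group ?Q B \<rho> \<delta>" using Q.hyp_groupI[OF B] by blast
  then interpret hyp_group ?Q B \<rho> \<delta> .
  have na: "\<not> amenable ?Q" using amenable_imp_virtually_cyclic nvc by blast
  obtain M1 c where M1: "decides M1 (signed_letters B) (WP ?Q B \<rho>)"
    "\<And>w. w \<in> lists (signed_letters B) \<Longrightarrow> tm_time M1 w \<le> c * (length w + 1)"
    using linear_time_decider by blast
  obtain M where "solves_with_average_time M (signed_letters A) (WP G A \<pi>)
      (length_invariant_measures (signed_letters A)) (\<lambda>n. (real n + 1) ^ 1)"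
    using average_case_quotient[OF assms(1,4,3) H na B(1) M1(1), of c 1] M1(2) by auto
  then show "linear_average_time (signed_letters A) (WP G A \<pi>)
      (length_invariant_measures (signed_letters A))"
    unfolding linear_average_time_def by (intro exI[of _ M] exI[of _ 1]) simp
next
  fix H N
  assume H: "finite_index_subgroup H G" "N \<lhd> G\<lparr>carrier := H\<rparr>"
    and aut: "automatic_group (G\<lparr>carrier := H\<rparr> Mod N)"
    and na: "\<not> amenable (G\<lparr>carrier := H\<rparr> Mod N)"
  let ?Q = "G\<lparr>carrier := H\<rparr> Mod N"
  interpret Q: group ?Q by (rule normal.factorgroup_is_group[OF H(2)])
  obtain B :: "nat set" and \<rho> M1 c where B: "finite_generating_set ?Q B \<rho>"
    and M1: "decides M1 (signed_letters B) (WP ?Q B \<rho>)"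
    "\<And>w. w \<in> lists (signed_letters B) \<Longrightarrow> tm_time M1 w \<le> c * (length w + 1) ^ 2"
    using Q.automatic_quadratic_time[OF aut] by blast
  obtain M where M: "solves_with_average_time M (signed_letters A) (WP G A \<pi>)
      (length_invariant_measures (signed_letters A)) (\<lambda>n. (real n + 1) ^ 2)"
    using average_case_quotient[OF assms(1,4,3) H na B M1] by auto
  have "(\<lambda>n. (real n + 1) ^ 2) = (\<lambda>n. 1 * real n ^ 2 + 2 * real n + 1)"
    by (simp add: power2_eq_square algebra_simps fun_eq_iff)
  then show "quadratic_average_time (signed_letters A) (WP G A \<pi>)
      (length_invariant_measures (signed_letters A))"
    unfolding quadratic_average_time_def using M
    by (intro exI[of _ M] exI[of _ 1] exI[of _ 2]) (simp only: zero_less_one simp_thms)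
qed

end
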